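(* Fix $\alpha\in(0,1)$ and $\mu\in[1/2,1]$ with $4\mu+\alpha\notin\mathbb{Z}$. For every $r_0\in V_\mu:=h^{4\mu+\alpha}(\mathbb{T})\cap[r>0]$, the unique maximal solution $r(\cdot,r_0)$ of the axisymmetric surface diffusion problem (ASD), with maximal interval of existence $[0,t^+(r_0))$, satisfies $$r(\cdot,r_0)\in C^\omega\big((0,t^+(r_0))\times\mathbb{T}\big),$$ i.e. it is real analytic jointly in time and space for positive time.
   Context: Problem (ASD): for a positive function $r=r(t,x)$, $2\pi$-periodic in $x$ (i.e. $x\in\mathbb{T}$), $$r_t=\frac1r\,\partial_x\Big[\frac{r}{\sqrt{1+r_x^2}}\,\partial_x\mathcal{H}(r)\Big]\ (t>0),\qquad r(0,\cdot)=r_0,\qquad \mathcal{H}(r)=\frac{1}{r\sqrt{1+r_x^2}}-\frac{r_{xx}}{(1+r_x^2)^{3/2}}.$$ For each $r_0\in V_\mu$ there is a unique maximal solution $r(\cdot,r_0)\in C^1_{1-\mu}(J(r_0),h^{\alpha}(\mathbb{T}))\cap C_{1-\mu}(J(r_0),h^{4+\alpha}(\mathbb{T}))$, with $J(r_0)=[0,t^+(r_0))$; this is the solution meant in the claim. Function spaces: $\mathbb{T}=[-\pi,\pi]$ with $-\pi,\pi$ identified and metric $d_{\mathbb{T}}(x,y)=\min\{|x-y|,2\pi-|x-y|\}$. For $k\in\mathbb{N}_0$, $\alpha\in(0,1)$, $C^{k+\alpha}(\mathbb{T})$ is the usual Hölder space of real-valued functions, and $h^{k+\alpha}(\mathbb{T})=\{f\in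 C^{k+\alpha}(\mathbb{T}):\lim_{\delta\to0}\sup_{0<d_{\mathbb{T}}(x,y)<\delta}|f^{(k)}(x)-f^{(k)}(y)|/d_{\mathbb{T}}(x,y)^\alpha=0\}$ with the norm of $C^{k+\alpha}(\mathbb{T})$. For a Banach space $E$, an interval $J\subset\mathbb{R}_+$ containing $0$ and $\dot J:=J\setminus\{0\}$: for $\mu\in(0,1)$, $BUC_{1-\mu}(J,E)$ is the set of $u\in C(\dot J,E)$ such that $t\mapsto t^{1-\mu}u(t)$ is bounded and uniformly continuous on $\dot J$ and $\lim_{t\to0^+}t^{1-\mu}\|u(t)\|_E=0$; for $\mu=1$, $BUC_0(J,E)=BUC(J,E)$. If $J=[0,a)$, $C_{1-\mu}(J,E)=\{u\in C(\dot J,E):u\in BUC_{1-\mu}([0,T],E)\ \text{for all } T<\sup J\}$ and $C^1_{1-\mu}(J,E)=\{u\in C^1(\dot J,E):u,\dot u\in C_{1-\mu}(J,E)\}$. *)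

theory Defs
  imports "HOL-Analysis.Analysis"
begin

section \<open>Little Hoelder spaces on the circle\<close>

text \<open>Functions on the circle are represented by their \<open>2 * pi\<close>-periodic lifts to the real
  line; \<open>[-pi, pi]\<close>, with its end points identified, is the fundamental domain.\<close>

definition periodic_2pi :: "(real \<Rightarrow> real) \<Rightarrow> bool" where
  "periodic_2pi f \<longleftrightarrow> (\<forall>x. f (x + 2 * pi) = f x)"

text \<open>The metric of the circle; only meaningful for arguments in \<open>[-pi, pi]\<close>.\<close>

definition dist_T :: "real \<Rightarrow> real \<Rightarrow> real" where
  "dist_T x y = min \<bar>x - y\<bar> (2 * pi - \<bar>x - y\<bar>)"

definition hoelder_quot :: "real \<Rightarrow> (real \<Rightarrow> real) \<Rightarrow> real \<times> real \<Rightarrow> real" where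
  "hoelder_quot a g = (\<lambda>(x, y). \<bar>g x - g y\<bar> / dist_T x y powr a)"

definition pairs_T :: "(real \<times> real) set" where
  "pairs_T = {(x, y). x \<in> {-pi..pi} \<and> y \<in> {-pi..pi} \<and> 0 < dist_T x y}"

definition close_pairs_T :: "real \<Rightarrow> (real \<times> real) set" where
  "close_pairs_T \<delta> = {(x, y). (x, y) \<in> pairs_T \<and> dist_T x y < \<delta>}"

definition hoelder_space :: "nat \<Rightarrow> real \<Rightarrow> (real \<Rightarrow> real) set" where
  "hoelder_space k a = {f. periodic_2pi f
      \<and> (\<forall>j<k. \<forall>x. (deriv ^^ j) f differentiable (at x))
      \<and> continuous_on UNIV ((deriv ^^ k) f)
      \<and> bdd_above (hoelder_quot a ((deriv ^^ k) f) ` pairs_T)}"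

text \<open>All suprema below are over sets that are bounded for members of \<^term>\<open>hoelder_space k a\<close>.\<close>

definition hoelder_norm :: "nat \<Rightarrow> real \<Rightarrow> (real \<Rightarrow> real) \<Rightarrow> real" where
  "hoelder_norm k a f =
     (\<Sum>j\<le>k. SUP x\<in>{-pi..pi}. \<bar>(deriv ^^ j) f x\<bar>) +
     (SUP p\<in>pairs_T. hoelder_quot a ((deriv ^^ k) f) p)"

definition little_hoelder :: "nat \<Rightarrow> real \<Rightarrow> (real \<Rightarrow> real) set" where
  "little_hoelder k a = {f \<in> hoelder_space k a.
     ((\<lambda>\<delta>. SUP p\<in>close_pairs_T \<delta>. hoelder_quot a ((deriv ^^ k) f) p) \<longlongrightarrow> 0) (at_right 0)}"

text \<open>The space of initial data. The order \<open>4 * \<mu> + \<alpha>\<close>, assumed not to be an integer, is split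
  into its integer part and its Hoelder exponent.\<close>

definition V_space :: "real \<Rightarrow> real \<Rightarrow> (real \<Rightarrow> real) set" where
  "V_space \<alpha> \<mu> = {f \<in> little_hoelder (nat \<lfloor>4 * \<mu> + \<alpha>\<rfloor>) (frac (4 * \<mu> + \<alpha>)). \<forall>x. f x > 0}"


section \<open>Time-weighted function spaces\<close>

text \<open>A Banach space of functions of \<open>x\<close> is given by its carrier \<open>E\<close> and its norm \<open>N\<close>;
  \<open>u t\<close> is the value of the curve \<open>u\<close> at time \<open>t\<close>.\<close>

definition cont_curve ::
  "(real \<Rightarrow> real) set \<Rightarrow> ((real \<Rightarrow> real) \<Rightarrow> real) \<Rightarrow> real set \<Rightarrow> (real \<Rightarrow> real \<Rightarrow> real) \<Rightarrow> bool" where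
  "cont_curve E N D u \<longleftrightarrow>
     (\<forall>t\<in>D. u t \<in> E) \<and>
     (\<forall>t\<in>D. ((\<lambda>s. N (\<lambda>x. u s x - u t x)) \<longlongrightarrow> 0) (at t within D))"

definition bdd_unif_curve ::
  "((real \<Rightarrow> real) \<Rightarrow> real) \<Rightarrow> real set \<Rightarrow> (real \<Rightarrow> real \<Rightarrow> real) \<Rightarrow> bool" where
  "bdd_unif_curve N D u \<longleftrightarrow>
     (\<exists>C. \<forall>t\<in>D. N (u t) \<le> C) \<and>
     (\<forall>\<epsilon>>0. \<exists>\<delta>>0. \<forall>s\<in>D. \<forall>t\<in>D. \<bar>s - t\<bar> < \<delta> \<longrightarrow> N (\<lambda>x. u s x - u t x) < \<epsilon>)"

text \<open>\<open>BUC_weighted \<mu> E N J\<close> is the space $BUC_{1-\mu}(J,E)$. For \<open>\<mu> = 1\<close> it is the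
  unweighted space on all of \<open>J\<close>, including the point \<open>0\<close>.\<close>

definition BUC_weighted ::
  "real \<Rightarrow> (real \<Rightarrow> real) set \<Rightarrow> ((real \<Rightarrow> real) \<Rightarrow> real) \<Rightarrow> real set \<Rightarrow> (real \<Rightarrow> real \<Rightarrow> real) set" where
  "BUC_weighted \<mu> E N J =
     (if \<mu> = 1 then {u. cont_curve E N J u \<and> bdd_unif_curve N J u}
      else {u. cont_curve E N (J - {0}) u
             \<and> bdd_unif_curve N (J - {0}) (\<lambda>t x. t powr (1 - \<mu>) * u t x)
             \<and> ((\<lambda>t. t powr (1 - \<mu>) * N (u t)) \<longlongrightarrow> 0) (at 0 within (J - {0}))})"

text \<open>The half-open interval \<open>[0, a)\<close>, where \<open>a\<close> may be infinite.\<close>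

definition time_interval :: "ereal \<Rightarrow> real set" where
  "time_interval a = {t. 0 \<le> t \<and> ereal t < a}"

definition C_weighted ::
  "real \<Rightarrow> (real \<Rightarrow> real) set \<Rightarrow> ((real \<Rightarrow> real) \<Rightarrow> real) \<Rightarrow> ereal \<Rightarrow> (real \<Rightarrow> real \<Rightarrow> real) set" where
  "C_weighted \<mu> E N a =
     {u. cont_curve E N (time_interval a - {0}) u \<and>
         (\<forall>T\<in>time_interval a. u \<in> BUC_weighted \<mu> E N {0..T})}"

text \<open>The time derivative \<open>v\<close> is the limit of the difference quotients in the norm of \<open>E\<close>,
  required at positive times only; for \<open>\<mu> = 1\<close> the value \<open>v 0\<close> is then the
  continuous extension.\<close>

definition C1_weighted ::
  "real \<Rightarrow> (real \<Rightarrow> real) set \<Rightarrow> ((real \<Rightarrow> real) \<Rightarrow> real) \<Rightarrow> ereal \<Rightarrow> (real \<Rightarrow> real \<Rightarrow> real) set" where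
  "C1_weighted \<mu> E N a =
     {u \<in> C_weighted \<mu> E N a. \<exists>v \<in> C_weighted \<mu> E N a. \<forall>t \<in> time_interval a - {0}.
        ((\<lambda>s. N (\<lambda>x. (u s x - u t x) / (s - t) - v t x)) \<longlongrightarrow> 0) (at t)}"


section \<open>The axisymmetric surface diffusion problem\<close>

definition mean_curv :: "(real \<Rightarrow> real) \<Rightarrow> real \<Rightarrow> real" where
  "mean_curv f x = 1 / (f x * sqrt (1 + (deriv f x)\<^sup>2))
                   - deriv (deriv f) x / (1 + (deriv f x)\<^sup>2) powr (3 / 2)"

definition ASD_rhs :: "(real \<Rightarrow> real) \<Rightarrow> real \<Rightarrow> real" where
  "ASD_rhs f x =
     1 / f x * deriv (\<lambda>y. f y / sqrt (1 + (deriv f y)\<^sup>2) * deriv (mean_curv f) y) x"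

text \<open>For \<open>\<mu> < 1\<close> the weighted spaces do not constrain \<open>r 0\<close>. Since the time
  derivative of a curve in the weighted \<open>C\<^sup>1\<close> space is integrable at \<open>0\<close> in the norm of
  $h^{\alpha}$, such a curve has a limit there, and the initial condition is understood
  in this sense.\<close>

definition ASD_solution ::
  "real \<Rightarrow> real \<Rightarrow> (real \<Rightarrow> real) \<Rightarrow> ereal \<Rightarrow> (real \<Rightarrow> real \<Rightarrow> real) \<Rightarrow> bool" where
  "ASD_solution \<alpha> \<mu> r0 a r \<longleftrightarrow>
     0 < a \<and>
     r \<in> C1_weighted \<mu> (little_hoelder 0 \<alpha>) (hoelder_norm 0 \<alpha>) a \<and>
     r \<in> C_weighted \<mu> (little_hoelder 4 \<alpha>) (hoelder_norm 4 \<alpha>) a \<and>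
     (\<forall>t\<in>time_interval a. \<forall>x. r t x > 0) \<and>
     (\<forall>t\<in>time_interval a - {0}. \<forall>x.
        ((\<lambda>s. r s x) has_real_derivative ASD_rhs (r t) x) (at t)) \<and>
     r 0 = r0 \<and>
     ((\<lambda>t. hoelder_norm 0 \<alpha> (\<lambda>x. r t x - r0 x)) \<longlongrightarrow> 0) (at_right 0)"

text \<open>\<open>r\<close> is a solution on \<open>[0, a)\<close> that cannot be extended to a solution on a longer
  interval; only its values at times in \<open>[0, a)\<close> matter.\<close>

definition ASD_maximal_solution ::
  "real \<Rightarrow> real \<Rightarrow> (real \<Rightarrow> real) \<Rightarrow> ereal \<Rightarrow> (real \<Rightarrow> real \<Rightarrow> real) \<Rightarrow> bool" where
  "ASD_maximal_solution \<alpha> \<mu> r0 a r \<longleftrightarrow>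
     ASD_solution \<alpha> \<mu> r0 a r \<and>
     \<not> (\<exists>b q. a < b \<and> ASD_solution \<alpha> \<mu> r0 b q \<and> (\<forall>t\<in>time_interval a. q t = r t))"


section \<open>Joint real analyticity\<close>

text \<open>Near every point of the (open) set \<open>S\<close>, the function is the sum of an
  unconditionally convergent double power series.\<close>

definition real_analytic_on :: "(real \<times> real \<Rightarrow> real) \<Rightarrow> (real \<times> real) set \<Rightarrow> bool" where
  "real_analytic_on u S \<longleftrightarrow>
     (\<forall>(t0, x0)\<in>S. \<exists>\<epsilon>>0. \<exists>c :: nat \<times> nat \<Rightarrow> real. \<forall>t x. \<bar>t - t0\<bar> < \<epsilon> \<and> \<bar>x - x0\<bar> < \<epsilon> \<longrightarrow>
        ((\<lambda>(i, j). c (i, j) * (t - t0) ^ i * (x - x0) ^ j) has_sum u (t, x)) UNIV)"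

text \<open>Real analytic functions on the product of an open set \<open>I\<close> of times and the circle. The
  circle carries the analytic structure for which the covering by the real line is a local
  analytic diffeomorphism, so analyticity is that of the periodic lift.\<close>

definition C_omega_cylinder :: "real set \<Rightarrow> (real \<Rightarrow> real \<Rightarrow> real) set" where
  "C_omega_cylinder I =
     {u. (\<forall>t\<in>I. periodic_2pi (u t)) \<and> real_analytic_on (\<lambda>(t, x). u t x) (I \<times> UNIV)}"

end

theory Submission
  imports Defs
begin

text \<open>The parameter trick of Angenent. Fix a positive time \<open>t0\<close> and consider the solution along the curves
  \<open>s \<mapsto> (t0 - T + (1 + l) T s, x + m T s)\<close>. They solve an equation that is analytic in \<open>(l, m)\<close>,
  with initial values that do not depend on \<open>(l, m)\<close>; if the solution depends analytically on
  the parameters, evaluation at \<open>s = 1\<close> gives analyticity of \<open>(l, m) \<mapsto> r (t0 + l T, x + m T)\<close>.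

  The square of \<open>r\<close> satisfies a conservation law with algebraic fluxes. In the arclength coordinate of
  the profile at time \<open>t0\<close> its leading coefficient at \<open>t0\<close> is constant, so that for small \<open>T\<close> the
  problem is a small perturbation of a constant-coefficient fourth-order equation. It is solved by
  contraction in the Wiener algebra of absolutely convergent Fourier series with coefficients continuous
  in time. Running the same contraction with coefficients that are absolutely convergent power series in
  two formal variables produces an analytic family of fixed points, which is the given solution by
  uniqueness.\<close>

section \<open>Absolutely summable families\<close>

text \<open>Two features keep the argument elementary. With \<open>V = r^2\<close> and the auxiliary
  unknowns \<open>z\<close> and \<open>r\<close>, which are determined by frozen Newton steps, the
  fixed-point map consists of ring operations and of linear operators that act mode by mode. A
  contractive algebra homomorphism that commutes with these operators therefore carries fixed points
  to fixed points. Evaluation of formal power series at parameter values is such a map, and this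
  replaces an implicit function theorem for analytic maps. The obstacle is the top order: the
  operator that regains all four derivatives has a bound that does not improve as the time step
  shrinks, so the coefficient of the second derivative of \<open>V\<close> in the perturbation must
  itself be small. Comparison with a constant-coefficient operator gives this only if the leading
  coefficient at the base time is constant in space, which a general coordinate does not provide.
  The Wiener algebra has to contain the jet of \<open>V\<close> up to order two; four continuous
  space derivatives of \<open>r\<close> at positive times are just enough, as they make the Fourier
  coefficients of the second derivative decay like \<open>1 / k^2\<close>.\<close>

typedef (overloaded) ('m, 'c::real_normed_vector) l1 =
  "{f :: 'm \<Rightarrow> 'c. (\<lambda>m. norm (f m)) summable_on UNIV}"
  morphisms lcoeff Abs_l1
  by (rule exI[of _ "\<lambda>_. 0"]) simp

setup_lifting type_definition_l1

lemma lcoeff_abs_summable: "(\<lambda>m. norm (lcoeff F m)) summable_on UNIV"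
  using lcoeff[of F] by simp

lemma lcoeff_Abs_l1: "(\<lambda>m. norm (f m)) summable_on UNIV \<Longrightarrow> lcoeff (Abs_l1 f) = f"
  by (simp add: Abs_l1_inverse)

lemma l1_eqI: "(\<And>m. lcoeff F m = lcoeff G m) \<Longrightarrow> F = G"
  by (metis ext lcoeff_inject)

lemma abs_summable_add:
  fixes f g :: "'m \<Rightarrow> 'c::real_normed_vector"
  assumes "(\<lambda>m. norm (f m)) summable_on A" "(\<lambda>m. norm (g m)) summable_on A"
  shows "(\<lambda>m. norm (f m + g m)) summable_on A"
  by (rule summable_on_comparison_test[OF summable_on_add[OF assms]]) (auto simp: norm_triangle_ineq)

instantiation l1 :: (type, real_normed_vector) real_vector
begin

lift_definition zero_l1 :: "('a, 'b) l1" is "\<lambda>_. 0" by simp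
lift_definition plus_l1 :: "('a, 'b) l1 \<Rightarrow> ('a, 'b) l1 \<Rightarrow> ('a, 'b) l1" is "\<lambda>f g m. f m + g m"
  by (rule abs_summable_add)
lift_definition uminus_l1 :: "('a, 'b) l1 \<Rightarrow> ('a, 'b) l1" is "\<lambda>f m. - f m" by simp
lift_definition minus_l1 :: "('a, 'b) l1 \<Rightarrow> ('a, 'b) l1 \<Rightarrow> ('a, 'b) l1" is "\<lambda>f g m. f m - g m"
  using abs_summable_add[where g="\<lambda>m. - g m" for g] by fastforce
lift_definition scaleR_l1 :: "real \<Rightarrow> ('a, 'b) l1 \<Rightarrow> ('a, 'b) l1" is "\<lambda>c f m. c *\<^sub>R f m"
  by (auto intro: summable_on_cmult_right)

instance
  by standard (transfer; simp add: algebra_simps)+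

end

lemma lcoeff_simps [simp]:
  "lcoeff 0 m = 0" "lcoeff (F + G) m = lcoeff F m + lcoeff G m" "lcoeff (F - G) m = lcoeff F m - lcoeff G m"
  "lcoeff (- F) m = - lcoeff F m" "lcoeff (c *\<^sub>R F) m = c *\<^sub>R lcoeff F m"
  by (simp_all add: zero_l1.rep_eq plus_l1.rep_eq minus_l1.rep_eq uminus_l1.rep_eq scaleR_l1.rep_eq)

instantiation l1 :: (type, real_normed_vector) real_normed_vector
begin

definition norm_l1 :: "('a, 'b) l1 \<Rightarrow> real" where "norm F = (\<Sum>\<^sub>\<infinity>m. norm (lcoeff F m))"
definition sgn_l1 :: "('a, 'b) l1 \<Rightarrow> ('a, 'b) l1" where "sgn_l1 F = F /\<^sub>R norm F"
definition dist_l1 :: "('a, 'b) l1 \<Rightarrow> ('a, 'b) l1 \<Rightarrow> real" where "dist_l1 F G = norm (F - G)"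
definition uniformity_l1 :: "(('a, 'b) l1 \<times> ('a, 'b) l1) filter" where
  "uniformity_l1 = (INF e\<in>{0<..}. principal {(x, y). dist (x::('a, 'b) l1) y < e})"
definition open_l1 :: "('a, 'b) l1 set \<Rightarrow> bool" where
  "open_l1 U = (\<forall>x\<in>U. eventually (\<lambda>(x', y). x' = x \<longrightarrow> y \<in> U) uniformity)"

instance
proof
  fix F G H :: "('a, 'b) l1" and c d :: real
  show "norm F = 0 \<longleftrightarrow> F = 0"
  proof
    assume "norm F = 0"
    then have "norm (lcoeff F m) = 0" for m
      using nonneg_infsum_le_0D[of "\<lambda>m. norm (lcoeff F m)" UNIV m] lcoeff_abs_summable[of F]
      by (simp add: norm_l1_def)
    then show "F = 0" by (intro l1_eqI) simp
  qed (simp add: norm_l1_def)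
  have "norm (F + G) \<le> (\<Sum>\<^sub>\<infinity>m. norm (lcoeff F m) + norm (lcoeff G m))"
    unfolding norm_l1_def
    by (intro infsum_mono lcoeff_abs_summable summable_on_add) (auto simp: norm_triangle_ineq)
  then show "norm (F + G) \<le> norm F + norm G"
    unfolding norm_l1_def by (simp add: infsum_add lcoeff_abs_summable)
  show "norm (c *\<^sub>R F) = \<bar>c\<bar> * norm F"
    unfolding norm_l1_def by (simp add: infsum_cmult_right')
qed (simp_all add: sgn_l1_def dist_l1_def uniformity_l1_def open_l1_def)

end

lemma norm_lcoeff_le: "norm (lcoeff F m) \<le> norm F"
proof -
  have "(\<Sum>\<^sub>\<infinity>n\<in>{m}. norm (lcoeff F n)) \<le> (\<Sum>\<^sub>\<infinity>n. norm (lcoeff F n))"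
    by (rule infsum_mono2) (auto simp: lcoeff_abs_summable)
  then show ?thesis by (simp add: norm_l1_def)
qed

lemma bounded_linear_lcoeff: "bounded_linear (\<lambda>F. lcoeff F m)"
  by (rule bounded_linear_intro[where K=1]) (auto simp: norm_lcoeff_le)

lemma norm_Abs_l1:
  assumes "(\<lambda>m. norm (f m)) summable_on UNIV"
  shows "norm (Abs_l1 f) = (\<Sum>\<^sub>\<infinity>m. norm (f m))"
  by (simp add: norm_l1_def lcoeff_Abs_l1[OF assms])

text \<open>\<open>Abs_l1\<close> is meaningful only for summable families, so summability and the
  norm bound come together from one estimate on finite partial sums. Completeness obtains its limit
  in this way.\<close>

lemma l1_boundedI:
  fixes f :: "'m \<Rightarrow> 'c::real_normed_vector"
  assumes "\<And>A. finite A \<Longrightarrow> (\<Sum>m\<in>A. norm (f m)) \<le> B"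
  shows "(\<lambda>m. norm (f m)) summable_on UNIV" "norm (Abs_l1 f) \<le> B"
proof -
  show s: "(\<lambda>m. norm (f m)) summable_on UNIV"
    by (rule nonneg_bdd_above_summable_on) (auto intro!: bdd_aboveI2[where M=B] assms)
  show "norm (Abs_l1 f) \<le> B"
    unfolding norm_Abs_l1[OF s] by (rule infsum_le_finite_sums[OF s]) (use assms in auto)
qed

lemma sum_norm_lcoeff_le: "finite A \<Longrightarrow> (\<Sum>m\<in>A. norm (lcoeff F m)) \<le> norm F"
  unfolding norm_l1_def by (rule finite_sum_le_infsum) (auto simp: lcoeff_abs_summable)

instance l1 :: (type, banach) banach
proof
  fix X :: "nat \<Rightarrow> ('a, 'b) l1"
  assume X: "Cauchy X"
  have "Cauchy (\<lambda>n. lcoeff (X n) m)" for m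
    by (rule bounded_linear.Cauchy[OF bounded_linear_lcoeff X])
  then have "\<exists>l. (\<lambda>n. lcoeff (X n) m) \<longlonglongrightarrow> l" for m
    by (simp add: Cauchy_convergent convergentD)
  then obtain l where l: "\<And>m. (\<lambda>n. lcoeff (X n) m) \<longlonglongrightarrow> l m" by metis
  \<comment> \<open>Convergence of the coefficients alone does not give convergence in norm. For
    each finite index set the Cauchy bound passes to the limit in \<open>k\<close>, and the
    threshold does not depend on the set.\<close>
  have key: "\<exists>N. \<forall>n\<ge>N. \<forall>A. finite A \<longrightarrow> (\<Sum>m\<in>A. norm (lcoeff (X n) m - l m)) \<le> e" if "e > 0" for e
  proof -
    obtain N where N: "\<And>n k. n \<ge> N \<Longrightarrow> k \<ge> N \<Longrightarrow> norm (X n - X k) < e"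
      using X \<open>e > 0\<close> by (metis Cauchy_iff)
    have "(\<Sum>m\<in>A. norm (lcoeff (X n) m - l m)) \<le> e" if "n \<ge> N" "finite A" for n A
    proof (rule tendsto_upperbound)
      show "(\<lambda>k. \<Sum>m\<in>A. norm (lcoeff (X n) m - lcoeff (X k) m)) \<longlonglongrightarrow> (\<Sum>m\<in>A. norm (lcoeff (X n) m - l m))"
        by (intro tendsto_intros l)
      have "(\<Sum>m\<in>A. norm (lcoeff (X n) m - lcoeff (X k) m)) \<le> e" if "k \<ge> N" for k
        using sum_norm_lcoeff_le[OF \<open>finite A\<close>, of "X n - X k"] N[OF \<open>n \<ge> N\<close> that] by simp
      then show "\<forall>\<^sub>F k in sequentially. (\<Sum>m\<in>A. norm (lcoeff (X n) m - lcoeff (X k) m)) \<le> e"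
        by (auto simp: eventually_sequentially)
    qed simp
    then show ?thesis by blast
  qed
  obtain N where N: "\<And>A. finite A \<Longrightarrow> (\<Sum>m\<in>A. norm (lcoeff (X N) m - l m)) \<le> 1"
    using key[of 1] by auto
  have "(\<lambda>m. norm (lcoeff (X N) m - (lcoeff (X N) m - l m))) summable_on UNIV"
    using abs_summable_add[OF lcoeff_abs_summable[of "X N"], of "\<lambda>m. - (lcoeff (X N) m - l m)"]
      l1_boundedI(1)[OF N] by (simp add: norm_minus_commute)
  then have sl: "(\<lambda>m. norm (l m)) summable_on UNIV" by simp
  have "X \<longlonglongrightarrow> Abs_l1 l"
  proof (rule LIMSEQ_I)
    fix e :: real assume "e > 0"
    obtain N where N: "\<And>n A. n \<ge> N \<Longrightarrow> finite A \<Longrightarrow> (\<Sum>m\<in>A. norm (lcoeff (X n) m - l m)) \<le> e / 2"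
      using key[of "e / 2"] \<open>e > 0\<close> by auto
    have "norm (X n - Abs_l1 l) < e" if "n \<ge> N" for n
    proof -
      have "X n - Abs_l1 l = Abs_l1 (\<lambda>m. lcoeff (X n) m - l m)"
        by (rule l1_eqI) (simp add: lcoeff_Abs_l1[OF sl] lcoeff_Abs_l1[OF l1_boundedI(1)[OF N[OF that]]])
      then show ?thesis using l1_boundedI(2)[OF N[OF that]] \<open>e > 0\<close> by simp
    qed
    then show "\<exists>no. \<forall>n\<ge>no. norm (X n - Abs_l1 l) < e" by blast
  qed
  then show "convergent X" by (auto simp: convergent_def)
qed

section \<open>Monomials and their density\<close>

definition monom_l1 :: "'m \<Rightarrow> 'c::real_normed_vector \<Rightarrow> ('m, 'c) l1" where
  "monom_l1 m c = Abs_l1 (\<lambda>n. if n = m then c else 0)"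

lemma lcoeff_monom_l1 [simp]: "lcoeff (monom_l1 m c) n = (if n = m then c else 0)"
proof -
  have "(\<lambda>n. norm (if n = m then c else 0)) summable_on UNIV"
    by (rule finite_nonzero_values_imp_summable_on) (auto intro: finite_subset[of _ "{m}"])
  then show ?thesis by (simp add: monom_l1_def lcoeff_Abs_l1)
qed

lemma norm_monom_l1 [simp]: "norm (monom_l1 m c) = norm c"
proof -
  have "(\<Sum>\<^sub>\<infinity>n. norm (lcoeff (monom_l1 m c) n)) = (\<Sum>\<^sub>\<infinity>n\<in>{m}. norm (lcoeff (monom_l1 m c) n))"
    by (rule infsum_cong_neutral) auto
  then show ?thesis by (simp add: norm_l1_def)
qed

lemma bounded_linear_monom_l1: "bounded_linear (monom_l1 m)"
  by (rule bounded_linear_intro[where K=1]) (auto intro!: l1_eqI)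

lemma has_sum_monom_l1: "((\<lambda>m. monom_l1 m (lcoeff F m)) has_sum F) UNIV"
  unfolding has_sum_def
proof (rule tendstoI)
  fix e :: real assume e: "e > 0"
  have "((\<lambda>m. norm (lcoeff F m)) has_sum norm F) UNIV"
    unfolding norm_l1_def using lcoeff_abs_summable has_sum_infsum by blast
  then have "\<forall>\<^sub>F A in finite_subsets_at_top UNIV. dist (\<Sum>m\<in>A. norm (lcoeff F m)) (norm F) < e"
    unfolding has_sum_def using e by (rule tendstoD)
  moreover have "\<forall>\<^sub>F A in finite_subsets_at_top UNIV. finite (A :: 'a set)"
    by (rule eventually_finite_subsets_at_top_weakI) simp
  ultimately show "\<forall>\<^sub>F A in finite_subsets_at_top UNIV. dist (\<Sum>m\<in>A. monom_l1 m (lcoeff F m)) F < e"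
  proof eventually_elim
    case (elim A)
    have cs: "lcoeff (\<Sum>m\<in>A. monom_l1 m (lcoeff F m)) n = (if n \<in> A then lcoeff F n else 0)" for n
    proof -
      have "lcoeff (\<Sum>m\<in>A. monom_l1 m (lcoeff F m)) n = (\<Sum>m\<in>A. lcoeff (monom_l1 m (lcoeff F m)) n)"
        by (rule linear_sum[OF bounded_linear.linear[OF bounded_linear_lcoeff]])
      also have "\<dots> = (\<Sum>m\<in>A. if n = m then lcoeff F n else 0)"
        by (rule sum.cong) auto
      finally show ?thesis using elim by simp
    qed
    have "norm (F - (\<Sum>m\<in>A. monom_l1 m (lcoeff F m))) = (\<Sum>\<^sub>\<infinity>n\<in>-A. norm (lcoeff F n))"
      unfolding norm_l1_def by (rule infsum_cong_neutral) (auto simp: cs)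
    moreover have "norm F = (\<Sum>n\<in>A. norm (lcoeff F n)) + (\<Sum>\<^sub>\<infinity>n\<in>-A. norm (lcoeff F n))"
    proof -
      have "(\<Sum>\<^sub>\<infinity>n\<in>A \<union> -A. norm (lcoeff F n)) = (\<Sum>\<^sub>\<infinity>n\<in>A. norm (lcoeff F n)) + (\<Sum>\<^sub>\<infinity>n\<in>-A. norm (lcoeff F n))"
        by (rule infsum_Un_disjoint) (auto intro: summable_on_subset[OF lcoeff_abs_summable])
      then show ?thesis using elim by (simp add: norm_l1_def)
    qed
    ultimately show ?case using elim by (simp add: dist_norm norm_minus_commute)
  qed
qed

text \<open>Finite combinations of monomials are dense, so continuous linear maps that agree on
  monomials agree everywhere. Associativity, multiplicativity and commutation rules are proved
  through this.\<close>

lemma bounded_linear_eq_l1: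
  assumes "bounded_linear A" "bounded_linear B" "\<And>m c. A (monom_l1 m c) = B (monom_l1 m c)"
  shows "A F = B F"
proof -
  have "((\<lambda>m. A (monom_l1 m (lcoeff F m))) has_sum A F) UNIV"
    by (rule has_sum_bounded_linear[OF assms(1) has_sum_monom_l1])
  moreover have "((\<lambda>m. B (monom_l1 m (lcoeff F m))) has_sum B F) UNIV"
    by (rule has_sum_bounded_linear[OF assms(2) has_sum_monom_l1])
  ultimately show ?thesis
    unfolding assms(3) by (rule has_sum_unique)
qed

text \<open>The convolution product is the sum of this family over all pairs of indices, not grouped
  by the value of \<open>a + b\<close>. With integer indices infinitely many pairs share a sum, and
  ungrouped summation treats every commutative monoid alike: integers for Fourier modes, pairs of
  naturals for power series.\<close>

definition l1_prod :: "('m::comm_monoid_add, 'c::real_normed_algebra) l1 \<Rightarrow> ('m, 'c) l1 \<Rightarrow> 'm \<times> 'm \<Rightarrow> ('m, 'c) l1" where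
  "l1_prod F G = (\<lambda>(a, b). monom_l1 (a + b) (lcoeff F a * lcoeff G b))"

lemma l1_prod_abs_summable:
  "(\<lambda>p. norm (lcoeff F (fst p)) * norm (lcoeff G (snd p))) summable_on UNIV"
  "(\<lambda>p. norm (l1_prod F G p)) summable_on UNIV"
  "(\<Sum>\<^sub>\<infinity>p. norm (l1_prod F G p)) \<le> norm F * norm G"
proof -
  let ?h = "\<lambda>p. norm (lcoeff F (fst p)) * norm (lcoeff G (snd p))"
  have s: "(\<lambda>(a, b). norm (lcoeff F a) * norm (lcoeff G b)) summable_on UNIV \<times> UNIV"
    by (rule summable_on_SigmaI[where g="\<lambda>a. norm (lcoeff F a) * norm G"])
      (auto intro!: has_sum_cmult_right summable_on_cmult_left lcoeff_abs_summable
        has_sum_infsum simp: norm_l1_def)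
  then show h: "?h summable_on UNIV" by (simp add: case_prod_unfold)
  have le: "norm (l1_prod F G p) \<le> ?h p" for p
    by (simp add: l1_prod_def case_prod_unfold norm_mult_ineq)
  show "(\<lambda>p. norm (l1_prod F G p)) summable_on UNIV"
    by (rule summable_on_comparison_test[OF h]) (auto intro: le)
  then have "(\<Sum>\<^sub>\<infinity>p. norm (l1_prod F G p)) \<le> (\<Sum>\<^sub>\<infinity>p. ?h p)"
    by (intro infsum_mono h le)
  also have "\<dots> = (\<Sum>\<^sub>\<infinity>a. \<Sum>\<^sub>\<infinity>b. norm (lcoeff F a) * norm (lcoeff G b))"
    using infsum_Sigma'_banach[OF s] by (simp add: case_prod_unfold)
  also have "\<dots> = norm F * norm G"
    by (simp add: norm_l1_def infsum_cmult_right' infsum_cmult_left')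
  finally show "(\<Sum>\<^sub>\<infinity>p. norm (l1_prod F G p)) \<le> norm F * norm G" .
qed

lemma l1_prod_summable: "l1_prod F G summable_on UNIV"
  for F G :: "('m::comm_monoid_add, 'c::{real_normed_algebra, banach}) l1"
  by (rule abs_summable_summable[OF l1_prod_abs_summable(2)])

instantiation l1 :: (comm_monoid_add, "{real_normed_algebra_1, comm_ring_1, banach}") "{real_normed_algebra_1, comm_ring_1}"
begin

definition times_l1 :: "('a, 'b) l1 \<Rightarrow> ('a, 'b) l1 \<Rightarrow> ('a, 'b) l1" where
  "times_l1 F G = infsum (l1_prod F G) UNIV"

definition one_l1 :: "('a, 'b) l1" where
  "one_l1 = monom_l1 0 1"

lemma times_add_left: "(F + G) * H = F * H + G * H" for F G H :: "('a, 'b) l1"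
proof -
  have "l1_prod (F + G) H = (\<lambda>p. l1_prod F H p + l1_prod G H p)"
    by (auto simp: l1_prod_def fun_eq_iff algebra_simps intro!: l1_eqI)
  then show ?thesis by (simp add: times_l1_def infsum_add l1_prod_summable)
qed

lemma times_commute: "F * G = G * F" for F G :: "('a, 'b) l1"
proof -
  have "infsum (l1_prod F G) UNIV = infsum (\<lambda>p. l1_prod F G (prod.swap p)) UNIV"
    by (rule infsum_reindex_bij_betw[symmetric]) (simp add: bij_betw_def)
  also have "(\<lambda>p. l1_prod F G (prod.swap p)) = l1_prod G F"
    by (auto simp: l1_prod_def fun_eq_iff add.commute mult.commute)
  finally show ?thesis by (simp add: times_l1_def)
qed

lemma times_scaleR_left: "(c *\<^sub>R F) * G = c *\<^sub>R (F * G)" for F G :: "('a, 'b) l1"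
proof -
  have "l1_prod (c *\<^sub>R F) G = (\<lambda>p. c *\<^sub>R l1_prod F G p)"
    by (auto simp: l1_prod_def fun_eq_iff intro!: l1_eqI)
  then show ?thesis by (simp add: times_l1_def infsum_scaleR_right)
qed

lemma times_norm_le: "norm (F * G) \<le> norm F * norm G" for F G :: "('a, 'b) l1"
proof -
  have "norm (F * G) \<le> (\<Sum>\<^sub>\<infinity>p. norm (l1_prod F G p))"
    unfolding times_l1_def by (rule norm_infsum_bound[OF l1_prod_abs_summable(2)])
  then show ?thesis using l1_prod_abs_summable(3)[of F G] by simp
qed

lemma times_monom: "monom_l1 a c * monom_l1 b d = monom_l1 (a + b) (c * d)" for c d :: 'b
proof -
  have "infsum (l1_prod (monom_l1 a c) (monom_l1 b d)) UNIV
      = infsum (l1_prod (monom_l1 a c) (monom_l1 b d)) {(a, b)}"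
    by (rule infsum_cong_neutral) (auto simp: l1_prod_def intro!: l1_eqI split: if_splits)
  then show ?thesis by (simp add: times_l1_def l1_prod_def)
qed

lemma times_bounded_linear: "bounded_linear (\<lambda>F. F * G)" for G :: "('a, 'b) l1"
  by (rule bounded_linear_intro[where K="norm G"])
    (simp_all add: times_add_left times_scaleR_left times_norm_le)

lemma times_bounded_linear': "bounded_linear (\<lambda>F. G * F)" for G :: "('a, 'b) l1"
  using times_bounded_linear[of G] by (simp only: times_commute[of G])

instance
proof
  fix F G H :: "('a, 'b) l1" and c :: real
  note bl = times_bounded_linear and bl' = times_bounded_linear' and comp = bounded_linear_compose
  \<comment> \<open>Associativity is extended from monomials one factor at a time: first in
    \<open>F\<close>, then in \<open>G\<close>, then in \<open>H\<close>.\<close>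
  have "(F * monom_l1 m c) * monom_l1 p q = F * (monom_l1 m c * monom_l1 p q)" for m p and c q :: 'b
    by (rule bounded_linear_eq_l1[OF comp[OF bl[of "monom_l1 p q"] bl[of "monom_l1 m c"]]
          bl[of "monom_l1 m c * monom_l1 p q"]]) (simp add: times_monom add.assoc mult.assoc)
  then have "(F * G) * monom_l1 p q = F * (G * monom_l1 p q)" for p and q :: 'b
    by (rule bounded_linear_eq_l1[OF comp[OF bl[of "monom_l1 p q"] bl'[of F]]
          comp[OF bl'[of F] bl[of "monom_l1 p q"]]])
  then show "F * G * H = F * (G * H)"
    by (rule bounded_linear_eq_l1[OF bl'[of "F * G"] comp[OF bl'[of F] bl'[of G]]])
  show "F * G = G * F" by (rule times_commute)
  show "(F + G) * H = F * H + G * H" by (rule times_add_left)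
  show "F * (G + H) = F * G + F * H" by (simp only: times_commute[of F] times_add_left)
  show "c *\<^sub>R F * G = c *\<^sub>R (F * G)" by (rule times_scaleR_left)
  show "F * c *\<^sub>R G = c *\<^sub>R (F * G)" by (simp only: times_commute[of F] times_scaleR_left)
  have "1 * F = id F"
    by (rule bounded_linear_eq_l1[OF bl'[of 1]]) (simp_all add: one_l1_def times_monom id_def bounded_linear_ident)
  then show "1 * F = F" by simp
  then show "F * 1 = F" by (simp only: times_commute[of F])
  have "lcoeff (0 :: ('a, 'b) l1) 0 \<noteq> lcoeff 1 0" by (simp add: one_l1_def)
  then show "(0 :: ('a, 'b) l1) \<noteq> 1" by metis
  show "norm (1 :: ('a, 'b) l1) = 1" by (simp add: one_l1_def)
qed (simp_all add: times_norm_le)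

end

section \<open>Homomorphisms\<close>

text \<open>Such maps preserve every polynomial expression, and norm at most one makes them map
  balls into balls. Both are needed to transport a fixed point of the contraction and to stay where
  uniqueness holds.\<close>

definition nhom :: "('a::{real_normed_algebra_1} \<Rightarrow> 'b::{real_normed_algebra_1}) \<Rightarrow> bool" where
  "nhom h \<longleftrightarrow> linear h \<and> (\<forall>x y. h (x * y) = h x * h y) \<and> h 1 = 1 \<and> (\<forall>x. norm (h x) \<le> norm x)"

lemma nhomD:
  assumes "nhom h"
  shows "linear h" "h (x * y) = h x * h y" "h 1 = 1" "norm (h x) \<le> norm x"
    "h (x + y) = h x + h y" "h (x - y) = h x - h y" "h (c *\<^sub>R x) = c *\<^sub>R h x" "h 0 = 0" "bounded_linear h"
    "h (x ^ n) = h x ^ n"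
proof -
  show l: "linear h" and m: "\<And>x y. h (x * y) = h x * h y" and o: "h 1 = 1" and "norm (h x) \<le> norm x"
    using assms by (auto simp: nhom_def)
  show "h (x + y) = h x + h y" "h (x - y) = h x - h y" "h (c *\<^sub>R x) = c *\<^sub>R h x" "h 0 = 0"
    using l by (simp_all add: linear_add linear_diff linear_scale linear_0)
  show "bounded_linear h"
    using assms by (auto simp: nhom_def intro!: bounded_linear_intro[where K=1] simp: linear_add linear_scale)
  show "h (x ^ n) = h x ^ n" by (induction n) (simp_all add: m o)
qed

text \<open>One construction for two evaluations: with \<open>w k = cis (k * y)\<close> it sums a
  Fourier series at a point, with \<open>w (i, j) = l ^ i * m ^ j\<close> a power series at
  parameter values. The map \<open>h\<close> acts on the coefficients first, for instance by fixing
  the time.\<close>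

definition l1_eval :: "('c \<Rightarrow> 'd) \<Rightarrow> ('m \<Rightarrow> 'd) \<Rightarrow> ('m, 'c::real_normed_vector) l1 \<Rightarrow> 'd::real_normed_algebra_1" where
  "l1_eval h w F = (\<Sum>\<^sub>\<infinity>m. h (lcoeff F m) * w m)"

lemma l1_eval_bounds:
  fixes h :: "'c::real_normed_algebra_1 \<Rightarrow> 'd::{real_normed_algebra_1, banach}" and w :: "'m \<Rightarrow> 'd"
  assumes h: "nhom h" and w: "\<And>m. norm (w m) \<le> 1"
  shows "(\<lambda>m. norm (h (lcoeff F m) * w m)) summable_on UNIV"
    "((\<lambda>m. h (lcoeff F m) * w m) has_sum l1_eval h w F) UNIV"
    "bounded_linear (l1_eval h w)" "norm (l1_eval h w F) \<le> norm F"
proof -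
  have le: "norm (h (lcoeff F m) * w m) \<le> norm (lcoeff F m)" for m F
  proof -
    have "norm (h (lcoeff F m) * w m) \<le> norm (h (lcoeff F m)) * norm (w m)" by (rule norm_mult_ineq)
    also have "\<dots> \<le> norm (lcoeff F m) * 1"
      by (intro mult_mono nhomD[OF h] w) auto
    finally show ?thesis by simp
  qed
  show s: "(\<lambda>m. norm (h (lcoeff F m) * w m)) summable_on UNIV" for F
    by (rule summable_on_comparison_test[OF lcoeff_abs_summable[of F]]) (auto intro: le)
  then show hs: "((\<lambda>m. h (lcoeff F m) * w m) has_sum l1_eval h w F) UNIV" for F
    unfolding l1_eval_def by (intro has_sum_infsum) (rule abs_summable_summable)
  show n: "norm (l1_eval h w F) \<le> norm F" for F
  proof -
    have "norm (l1_eval h w F) \<le> (\<Sum>\<^sub>\<infinity>m. norm (h (lcoeff F m) * w m))"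
      unfolding l1_eval_def by (rule norm_infsum_bound[OF s])
    also have "\<dots> \<le> norm F"
      unfolding norm_l1_def by (rule infsum_mono[OF s lcoeff_abs_summable]) (rule le)
    finally show ?thesis .
  qed
  show "bounded_linear (l1_eval h w)"
  proof (rule bounded_linear_intro[where K=1])
    fix F G :: "('m, 'c) l1" and c :: real
    have "((\<lambda>m. h (lcoeff (F + G) m) * w m) has_sum l1_eval h w F + l1_eval h w G) UNIV"
      using has_sum_add[OF hs[of F] hs[of G]] by (simp add: nhomD[OF h] algebra_simps)
    then show "l1_eval h w (F + G) = l1_eval h w F + l1_eval h w G"
      using hs has_sum_unique by blast
    have "((\<lambda>m. h (lcoeff (c *\<^sub>R F) m) * w m) has_sum c *\<^sub>R l1_eval h w F) UNIV"
      using has_sum_scaleR[OF hs[of F], of c] by (simp add: nhomD[OF h])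
    then show "l1_eval h w (c *\<^sub>R F) = c *\<^sub>R l1_eval h w F"
      using hs has_sum_unique by blast
    show "norm (l1_eval h w F) \<le> norm F * 1" using n by simp
  qed
qed

lemma l1_eval_monom [simp]: "linear h \<Longrightarrow> l1_eval h w (monom_l1 m c) = h c * w m"
proof -
  assume "linear h"
  then have "(\<Sum>\<^sub>\<infinity>n. h (lcoeff (monom_l1 m c) n) * w n) = (\<Sum>\<^sub>\<infinity>n\<in>{m}. h (lcoeff (monom_l1 m c) n) * w n)"
    by (intro infsum_cong_neutral) (auto simp: linear_0)
  then show ?thesis by (simp add: l1_eval_def)
qed

text \<open>The weight \<open>w\<close> is a character of the index monoid, bounded by one. On
  monomials multiplicativity is exactly this property, and density does the rest.\<close>

lemma nhom_l1_eval:
  fixes h :: "'c::{real_normed_algebra_1, comm_ring_1, banach} \<Rightarrow> 'd::{real_normed_algebra_1, comm_ring_1, banach}"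
    and w :: "'m::comm_monoid_add \<Rightarrow> 'd"
  assumes h: "nhom h" and w: "\<And>m. norm (w m) \<le> 1" and w0: "w 0 = 1"
    and wm: "\<And>m n. w (m + n) = w m * w n"
  shows "nhom (l1_eval h w)"
proof -
  note b = l1_eval_bounds[where h=h and w=w, OF h w]
  have bl: "bounded_linear (\<lambda>F. l1_eval h w (F * G))" "bounded_linear (\<lambda>F. l1_eval h w (G * F))"
    "bounded_linear (\<lambda>F. l1_eval h w F * l1_eval h w G)" "bounded_linear (\<lambda>F. l1_eval h w G * l1_eval h w F)"
    for G :: "('m, 'c) l1"
    by (rule bounded_linear_compose[OF b(3)], rule bounded_linear_mult_left bounded_linear_mult_right)
      (rule bounded_linear_compose[OF b(3)], rule bounded_linear_mult_left bounded_linear_mult_right,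
       rule bounded_linear_compose[OF bounded_linear_mult_left b(3)],
       rule bounded_linear_compose[OF bounded_linear_mult_right b(3)])
  have 1: "l1_eval h w (F * monom_l1 m c) = l1_eval h w F * l1_eval h w (monom_l1 m c)" for F m c
    by (rule bounded_linear_eq_l1[OF bl(1) bl(3)])
      (simp add: times_monom nhomD(1,2)[OF h] wm mult_ac)
  have "l1_eval h w (F * G) = l1_eval h w F * l1_eval h w G" for F G
    by (rule bounded_linear_eq_l1[OF bl(2) bl(4)]) (rule 1)
  then show ?thesis
    using b(3,4) by (auto simp: nhom_def bounded_linear.linear one_l1_def nhomD[OF h] w0)
qed

section \<open>Coefficientwise operators\<close>

text \<open>Diagonal operators cover both the solution operators, which act on each mode separately,
  and homomorphisms applied to the coefficients. A bound uniform in the index is an operator bound,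
  with no loss from the summation.\<close>

definition l1_diag :: "('m \<Rightarrow> 'c \<Rightarrow> 'd) \<Rightarrow> ('m, 'c::real_normed_vector) l1 \<Rightarrow> ('m, 'd::real_normed_vector) l1" where
  "l1_diag H F = Abs_l1 (\<lambda>m. H m (lcoeff F m))"

lemma l1_diag_bounds:
  assumes lin: "\<And>m. linear (H m)" and le: "\<And>m x. norm (H m x) \<le> B * norm x"
  shows "lcoeff (l1_diag H F) m = H m (lcoeff F m)" "linear (l1_diag H)"
    "norm (l1_diag H F) \<le> B * norm F"
proof -
  have s: "(\<lambda>m. norm (H m (lcoeff F m))) summable_on UNIV" for F
    by (rule summable_on_comparison_test[OF summable_on_cmult_right[OF lcoeff_abs_summable[of F]]])
      (auto intro: le)
  show c: "lcoeff (l1_diag H F) m = H m (lcoeff F m)" for m F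
    by (simp add: l1_diag_def lcoeff_Abs_l1[OF s])
  show "linear (l1_diag H)"
    by (rule linearI) (auto intro!: l1_eqI simp: c linear_add[OF lin] linear_scale[OF lin])
  have "norm (l1_diag H F) \<le> (\<Sum>\<^sub>\<infinity>m. B * norm (lcoeff F m))"
    unfolding norm_l1_def c
    by (rule infsum_mono[OF s summable_on_cmult_right[OF lcoeff_abs_summable]]) (rule le)
  then show "norm (l1_diag H F) \<le> B * norm F"
    by (simp add: norm_l1_def infsum_cmult_right')
qed

lemma nhom_l1_diag:
  fixes h :: "'c::{real_normed_algebra_1, comm_ring_1, banach} \<Rightarrow> 'd::{real_normed_algebra_1, comm_ring_1, banach}"
  assumes h: "nhom h"
  shows "nhom (l1_diag (\<lambda>m :: 'm::comm_monoid_add. h))" "lcoeff (l1_diag (\<lambda>m. h) F) m = h (lcoeff F m)"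
proof -
  note b = l1_diag_bounds[where H="\<lambda>_. h" and B=1, simplified, OF nhomD(1)[OF h] nhomD(4)[OF h]]
  let ?D = "l1_diag (\<lambda>m :: 'm. h)"
  have bD: "bounded_linear ?D"
    by (rule bounded_linear_intro[where K=1]) (auto simp: linear_add[OF b(2)] linear_scale[OF b(2)] b(3))
  have mon: "?D (monom_l1 m c) = monom_l1 m (h c)" for m c
    by (rule l1_eqI) (simp add: b(1) nhomD[OF h])
  have bl: "bounded_linear (\<lambda>F. ?D (F * G))" "bounded_linear (\<lambda>F. ?D (G * F))"
    "bounded_linear (\<lambda>F. ?D F * ?D G)" "bounded_linear (\<lambda>F. ?D G * ?D F)" for G :: "('m, 'c) l1"
    by (rule bounded_linear_compose[OF bD], rule bounded_linear_mult_left bounded_linear_mult_right)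
      (rule bounded_linear_compose[OF bD], rule bounded_linear_mult_left bounded_linear_mult_right,
       rule bounded_linear_compose[OF bounded_linear_mult_left bD],
       rule bounded_linear_compose[OF bounded_linear_mult_right bD])
  have 1: "?D (F * monom_l1 m c) = ?D F * ?D (monom_l1 m c)" for F m c
    by (rule bounded_linear_eq_l1[OF bl(1) bl(3)]) (simp add: mon times_monom nhomD[OF h])
  have "?D (F * G) = ?D F * ?D G" for F G
    by (rule bounded_linear_eq_l1[OF bl(2) bl(4)]) (rule 1)
  then show "nhom ?D"
    using b(2,3) by (auto simp: nhom_def one_l1_def mon nhomD[OF h])
  show "lcoeff (l1_diag (\<lambda>m. h) F) m = h (lcoeff F m)" for F :: "('x, 'c) l1" and m
    by (rule l1_diag_bounds(1)[where B=1]) (simp_all add: nhomD[OF h])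
qed

lemma nhom_monom_0: "nhom (monom_l1 (0 :: 'm::comm_monoid_add) :: 'c::{real_normed_algebra_1, comm_ring_1, banach} \<Rightarrow> _)"
  by (auto simp: nhom_def times_monom one_l1_def intro!: bounded_linear.linear bounded_linear_monom_l1)

section \<open>Continuous functions of time\<close>

instantiation bcontfun :: (topological_space, "{real_normed_algebra_1, comm_ring_1}") "{real_normed_algebra_1, comm_ring_1}"
begin

definition times_bcontfun :: "('a, 'b) bcontfun \<Rightarrow> ('a, 'b) bcontfun \<Rightarrow> ('a, 'b) bcontfun" where
  "times_bcontfun f g = Bcontfun (\<lambda>x. f x * g x)"

definition one_bcontfun :: "('a, 'b) bcontfun" where "one_bcontfun = const_bcontfun 1"

lemma apply_times_bcontfun: "apply_bcontfun (f * g) x = f x * g x" for f g :: "('a, 'b) bcontfun"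
proof -
  have "norm (f x * g x) \<le> norm f * norm g" for x
    using norm_mult_ineq[of "f x" "g x"] mult_mono[OF norm_bounded[of f x] norm_bounded[of g x]] by fastforce
  then have "(\<lambda>x. f x * g x) \<in> bcontfun"
    by (intro bcontfun_normI) (auto intro!: continuous_intros)
  then show ?thesis by (simp add: times_bcontfun_def Bcontfun_inverse)
qed

lemma apply_one_bcontfun: "apply_bcontfun (1 :: ('a, 'b) bcontfun) x = 1"
  by (simp add: one_bcontfun_def)

instance
proof
  fix f g h :: "('a, 'b) bcontfun" and c :: real
  show "f * g * h = f * (g * h)" "(f + g) * h = f * h + g * h" "f * (g + h) = f * g + f * h"
    "c *\<^sub>R f * g = c *\<^sub>R (f * g)" "f * c *\<^sub>R g = c *\<^sub>R (f * g)" "1 * f = f" "f * 1 = f" "f * g = g * f"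
    by (auto intro!: bcontfun_eqI simp: apply_times_bcontfun apply_one_bcontfun algebra_simps)
  have "apply_bcontfun (0 :: ('a, 'b) bcontfun) x \<noteq> apply_bcontfun 1 x" for x
    by (simp add: apply_one_bcontfun)
  then show "(0 :: ('a, 'b) bcontfun) \<noteq> 1" by metis
  show "norm (f * g) \<le> norm f * norm g"
  proof (rule norm_bound)
    fix x
    have "norm (apply_bcontfun (f * g) x) \<le> norm (f x) * norm (g x)"
      by (simp add: apply_times_bcontfun norm_mult_ineq)
    also have "\<dots> \<le> norm f * norm g" by (intro mult_mono norm_bounded) auto
    finally show "norm (apply_bcontfun (f * g) x) \<le> norm f * norm g" .
  qed
  show "norm (1 :: ('a, 'b) bcontfun) = 1"
    using norm_bounded[of "1 :: ('a, 'b) bcontfun"] norm_bound[of "1 :: ('a, 'b) bcontfun" 1]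
    by (simp add: apply_one_bcontfun antisym)
qed

end

instance bcontfun :: (metric_space, banach) banach ..

lemma nhom_apply_bcontfun: "nhom (\<lambda>f :: 'a::topological_space \<Rightarrow>\<^sub>C 'b::{real_normed_algebra_1, comm_ring_1}. apply_bcontfun f x)"
  by (auto simp: nhom_def apply_times_bcontfun apply_one_bcontfun norm_bounded intro!: linearI)

section \<open>Locally Lipschitz maps\<close>

text \<open>Lipschitz on every ball. The notion is closed under sums, products and projections, so
  Lipschitz constants of the large polynomial expressions below follow from their syntax without
  being computed.\<close>

definition loc_lip :: "('x::real_normed_vector \<Rightarrow> 'y::real_normed_vector) \<Rightarrow> bool" where
  "loc_lip f \<longleftrightarrow> (\<forall>B. \<exists>C. \<forall>x y. norm x \<le> B \<longrightarrow> norm y \<le> B \<longrightarrow> norm (f x - f y) \<le> C * norm (x - y))"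

lemma loc_lip_linear:
  assumes "bounded_linear f" shows "loc_lip f"
proof -
  interpret bounded_linear f by fact
  obtain K where "\<And>x. norm (f x) \<le> norm x * K" using bounded by blast
  then have "norm (f x - f y) \<le> K * norm (x - y)" for x y
    using diff by (metis mult.commute)
  then show ?thesis unfolding loc_lip_def by blast
qed

lemma loc_lip_const [intro]: "loc_lip (\<lambda>x. c)"
  unfolding loc_lip_def by (auto intro!: exI[of _ 0])

lemma loc_lipD:
  assumes "loc_lip f"
  shows "\<exists>C\<ge>0. \<forall>x y. norm x \<le> B \<longrightarrow> norm y \<le> B \<longrightarrow> norm (f x - f y) \<le> C * norm (x - y)"
proof -
  obtain C where C: "\<forall>x y. norm x \<le> B \<longrightarrow> norm y \<le> B \<longrightarrow> norm (f x - f y) \<le> C * norm (x - y)"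
    using assms unfolding loc_lip_def by blast
  have "norm (f x - f y) \<le> max C 0 * norm (x - y)" if "norm x \<le> B" "norm y \<le> B" for x y
    using order_trans[OF C[rule_format, OF that] mult_right_mono[of C "max C 0" "norm (x - y)"]] by simp
  then show ?thesis by (intro exI[of _ "max C 0"]) auto
qed

lemma loc_lip_add [intro]:
  assumes "loc_lip f" "loc_lip g"
  shows "loc_lip (\<lambda>x. f x + g x)"
  unfolding loc_lip_def
proof
  fix B
  obtain C where C0: "C \<ge> 0" and C: "\<And>x y. norm x \<le> B \<Longrightarrow> norm y \<le> B \<Longrightarrow> norm (f x - f y) \<le> C * norm (x - y)"
    using loc_lipD[OF assms(1), of B] by blast
  obtain D where D0: "D \<ge> 0" and D: "\<And>x y. norm x \<le> B \<Longrightarrow> norm y \<le> B \<Longrightarrow> norm (g x - g y) \<le> D * norm (x - y)"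
    using loc_lipD[OF assms(2), of B] by blast
  have "norm ((f x + g x) - (f y + g y)) \<le> (C + D) * norm (x - y)" if "norm x \<le> B" "norm y \<le> B" for x y
    using C[OF that] D[OF that] norm_triangle_ineq[of "f x - f y" "g x - g y"]
    by (simp add: algebra_simps)
  then show "\<exists>C. \<forall>x y. norm x \<le> B \<longrightarrow> norm y \<le> B \<longrightarrow> norm ((f x + g x) - (f y + g y)) \<le> C * norm (x - y)"
    by blast
qed

lemma loc_lip_compose_linear:
  assumes "bounded_linear h" "loc_lip f"
  shows "loc_lip (\<lambda>x. h (f x))"
  unfolding loc_lip_def
proof
  fix B
  obtain C where C0: "C \<ge> 0" and C: "\<And>x y. norm x \<le> B \<Longrightarrow> norm y \<le> B \<Longrightarrow> norm (f x - f y) \<le> C * norm (x - y)"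
    using loc_lipD[OF assms(2), of B] by blast
  obtain K where K: "K > 0" "\<And>x. norm (h x) \<le> norm x * K"
    using bounded_linear.pos_bounded[OF assms(1)] by blast
  have "norm (h (f x) - h (f y)) \<le> (K * C) * norm (x - y)" if "norm x \<le> B" "norm y \<le> B" for x y
  proof -
    have "norm (h (f x) - h (f y)) = norm (h (f x - f y))"
      using assms(1) by (simp add: bounded_linear.linear linear_diff)
    also have "\<dots> \<le> (C * norm (x - y)) * K"
      using K(2)[of "f x - f y"] mult_right_mono[OF C[OF that], of K] K(1) by linarith
    finally show ?thesis by (simp add: mult_ac)
  qed
  then show "\<exists>C. \<forall>x y. norm x \<le> B \<longrightarrow> norm y \<le> B \<longrightarrow> norm (h (f x) - h (f y)) \<le> C * norm (x - y)"
    by blast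
qed

lemma loc_lip_scaleR [intro]: "loc_lip f \<Longrightarrow> loc_lip (\<lambda>x. c *\<^sub>R f x)"
  by (rule loc_lip_compose_linear[OF bounded_linear_scaleR_right])

lemma loc_lip_fst [intro]: "loc_lip f \<Longrightarrow> loc_lip (\<lambda>x. fst (f x))"
  by (rule loc_lip_compose_linear[OF bounded_linear_fst])

lemma loc_lip_snd [intro]: "loc_lip f \<Longrightarrow> loc_lip (\<lambda>x. snd (f x))"
  by (rule loc_lip_compose_linear[OF bounded_linear_snd])

lemma loc_lip_ident [intro]: "loc_lip (\<lambda>x. x)"
  by (rule loc_lip_linear[OF bounded_linear_ident])

lemma loc_lip_diff [intro]: "loc_lip f \<Longrightarrow> loc_lip g \<Longrightarrow> loc_lip (\<lambda>x. f x - g x)"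
  using loc_lip_add[of f "\<lambda>x. (- 1) *\<^sub>R g x"] loc_lip_scaleR[of g "- 1"] by simp

lemma loc_lip_mult [intro]:
  fixes f g :: "'x::real_normed_vector \<Rightarrow> 'a::real_normed_algebra"
  assumes "loc_lip f" "loc_lip g"
  shows "loc_lip (\<lambda>x. f x * g x)"
  unfolding loc_lip_def
proof
  fix B
  obtain C where C: "C \<ge> 0" and C2: "\<And>x y. norm x \<le> B \<Longrightarrow> norm y \<le> B \<Longrightarrow> norm (f x - f y) \<le> C * norm (x - y)"
    using loc_lipD[OF assms(1), of B] by blast
  obtain D where D: "D \<ge> 0" and D2: "\<And>x y. norm x \<le> B \<Longrightarrow> norm y \<le> B \<Longrightarrow> norm (g x - g y) \<le> D * norm (x - y)"
    using loc_lipD[OF assms(2), of B] by blast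
  have "norm (f x * g x - f y * g y) \<le> (C * (norm (g 0) + D * B) + (norm (f 0) + C * B) * D) * norm (x - y)"
    if "norm x \<le> B" "norm y \<le> B" for x y
  proof -
    have B: "norm (0 :: 'x) \<le> B" using order_trans[OF norm_ge_zero that(1)] by simp
    have "norm (g x) \<le> norm (g 0) + D * B"
      using D2[OF that(1) B] norm_triangle_sub[of "g x" "g 0"] mult_left_mono[OF that(1) D] by simp
    moreover have "norm (f y) \<le> norm (f 0) + C * B"
      using C2[OF that(2) B] norm_triangle_sub[of "f y" "f 0"] mult_left_mono[OF that(2) C] by simp
    moreover have "f x * g x - f y * g y = (f x - f y) * g x + f y * (g x - g y)"
      by (simp add: algebra_simps)
    moreover have "norm ((f x - f y) * g x) \<le> (C * norm (x - y)) * (norm (g 0) + D * B)"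
      by (rule order_trans[OF norm_mult_ineq mult_mono]) (use C C2 that calculation in auto)
    moreover have "norm (f y * (g x - g y)) \<le> (norm (f 0) + C * B) * (D * norm (x - y))"
      by (rule order_trans[OF norm_mult_ineq mult_mono])
        (use C D C2 D2 that B calculation in \<open>auto intro!: add_nonneg_nonneg mult_nonneg_nonneg\<close>)
    ultimately show ?thesis
      using norm_triangle_ineq[of "(f x - f y) * g x" "f y * (g x - g y)"] by (simp add: algebra_simps)
  qed
  then show "\<exists>C. \<forall>x y. norm x \<le> B \<longrightarrow> norm y \<le> B \<longrightarrow> norm (f x * g x - f y * g y) \<le> C * norm (x - y)"
    by blast
qed

section \<open>The quasilinear system in a Banach algebra\<close>

text \<open>With \<open>V = r\<^sup>2\<close> the equation is the conservation law
  \<open>V\<^sub>t = - (\<Gamma>\<^sub>2\<^sub>x\<^sub>x + \<Gamma>\<^sub>1\<^sub>x)\<close>, where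
  \<open>\<Gamma>\<^sub>2 = 2 r r\<^sub>x\<^sub>x / (1 + r\<^sub>x\<^sup>2)\<^sup>2\<close> and
  \<open>\<Gamma>\<^sub>1 = 2 r\<^sub>x / (r (1 + r\<^sub>x\<^sup>2)) + 2 r r\<^sub>x r\<^sub>x\<^sub>x\<^sup>2 / (1 + r\<^sub>x\<^sup>2)\<^sup>3\<close>. Both are
  polynomials in \<open>V\<close>, \<open>V\<^sub>x\<close>, \<open>V\<^sub>x\<^sub>x\<close> and \<open>z = 1 / (V + V\<^sub>x\<^sup>2 / 4)\<close>. They are written below in
  a coordinate \<open>y\<close> with \<open>\<partial>\<^sub>x = k0 \<partial>\<^sub>y\<close>; \<open>k1\<close> and \<open>k2\<close> are the derivatives of \<open>k0\<close>, and \<open>p0\<close>, \<open>p1\<close>,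
  \<open>p2\<close> those of \<open>V\<close>, with respect to \<open>y\<close>.\<close>

definition flux2 :: "'a::real_algebra_1 \<Rightarrow> 'a \<Rightarrow> 'a \<Rightarrow> 'a \<Rightarrow> 'a \<Rightarrow> 'a \<Rightarrow> 'a" where
  "flux2 k0 k1 p0 p1 p2 z =
     p0 * p0 * z * z * (k0 * k0 * p2 + k0 * k1 * p1) - (1/2) *\<^sub>R (p0 * (k0 * p1) * (k0 * p1) * z * z)"

definition flux1 :: "'a::real_algebra_1 \<Rightarrow> 'a \<Rightarrow> 'a \<Rightarrow> 'a \<Rightarrow> 'a \<Rightarrow> 'a \<Rightarrow> 'a" where
  "flux1 k0 k1 p0 p1 p2 z = k0 * p1 * z + k0 * p1 *
     ((1/2) *\<^sub>R (p0 * (k0 * k0 * p2 + k0 * k1 * p1)) - (1/4) *\<^sub>R (k0 * p1 * (k0 * p1))) *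
     ((1/2) *\<^sub>R (p0 * (k0 * k0 * p2 + k0 * k1 * p1)) - (1/4) *\<^sub>R (k0 * p1 * (k0 * p1))) * z * z * z"

text \<open>In the coordinate \<open>y\<close>, along a curve on which time runs at speed \<open>1 + l\<close> and \<open>x\<close> moves at speed
  \<open>m\<close>, the equation is \<open>p0\<^sub>t + a \<partial>\<^sub>y\<^sup>4 p0 = \<partial>\<^sub>y\<^sup>2 rhs2 + \<partial>\<^sub>y rhs1 + rhs0\<close>. The constant \<open>a\<close> is the
  leading coefficient at the base point, so that \<open>rhs2\<close> has a small Lipschitz constant in \<open>p2\<close>.\<close>

definition rhs2 :: "real \<Rightarrow> 'a::real_algebra_1 \<Rightarrow> 'a \<Rightarrow> 'a \<Rightarrow> 'a \<Rightarrow> 'a \<Rightarrow> 'a \<Rightarrow> 'a \<Rightarrow> 'a" where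
  "rhs2 a k0 k1 l p0 p1 p2 z = a *\<^sub>R p2 - (1 + l) * (k0 * k0 * flux2 k0 k1 p0 p1 p2 z)"

definition rhs1 :: "'a::real_algebra_1 \<Rightarrow> 'a \<Rightarrow> 'a \<Rightarrow> 'a \<Rightarrow> 'a \<Rightarrow> 'a \<Rightarrow> 'a \<Rightarrow> 'a" where
  "rhs1 k0 k1 l p0 p1 p2 z =
     (1 + l) * (3 *\<^sub>R (k0 * k1 * flux2 k0 k1 p0 p1 p2 z) - k0 * flux1 k0 k1 p0 p1 p2 z)"

definition rhs0 :: "'a::real_algebra_1 \<Rightarrow> 'a \<Rightarrow> 'a \<Rightarrow> 'a \<Rightarrow> 'a \<Rightarrow> 'a \<Rightarrow> 'a \<Rightarrow> 'a \<Rightarrow> 'a \<Rightarrow> 'a" where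
  "rhs0 k0 k1 k2 l m p0 p1 p2 z =
     (1 + l) * (k1 * flux1 k0 k1 p0 p1 p2 z - (k1 * k1 + k0 * k2) * flux2 k0 k1 p0 p1 p2 z) + m * (k0 * p1)"

type_synonym 'a state = "'a \<times> 'a \<times> 'a \<times> 'a \<times> 'a"

text \<open>\<open>L j\<close> stands for \<open>\<partial>\<^sub>y\<^sup>j\<close> composed with the solution operator of \<open>\<partial>\<^sub>t + a \<partial>\<^sub>y\<^sup>4\<close>. The last two
  components are simplified Newton steps for \<open>z = 1 / (p0 + (k0 p1)\<^sup>2 / 4)\<close> and \<open>r = sqrt p0\<close>.\<close>

definition step :: "real \<Rightarrow> 'a::real_algebra_1 \<Rightarrow> 'a \<Rightarrow> 'a \<Rightarrow> 'a \<Rightarrow> 'a \<Rightarrow>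
    (nat \<Rightarrow> 'a \<Rightarrow> 'a) \<Rightarrow> (nat \<Rightarrow> 'a) \<Rightarrow> 'a \<Rightarrow> 'a \<Rightarrow> 'a state \<Rightarrow> 'a state" where
  "step a k0 k1 k2 zs qs L \<zeta> l m = (\<lambda>(p0, p1, p2, z, r).
     let g2 = rhs2 a k0 k1 l p0 p1 p2 z; g1 = rhs1 k0 k1 l p0 p1 p2 z; g0 = rhs0 k0 k1 k2 l m p0 p1 p2 z
     in (\<zeta> 0 + L 2 g2 + L 1 g1 + L 0 g0, \<zeta> 1 + L 3 g2 + L 2 g1 + L 1 g0, \<zeta> 2 + L 4 g2 + L 3 g1 + L 2 g0,
         z + zs * (1 - z * (p0 + (1/4) *\<^sub>R (k0 * p1 * (k0 * p1)))), r + (1/2) *\<^sub>R (qs * (p0 - r * r))))"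

text \<open>For large \<open>w\<close> the step is a contraction in this norm although \<open>p2\<close> and \<open>r\<close> depend on \<open>p0\<close>, \<open>p1\<close>
  and \<open>z\<close>, and \<open>z\<close> on \<open>p0\<close> and \<open>p1\<close>, with constants that are not small.\<close>

definition wnorm :: "real \<Rightarrow> 'a::real_normed_vector state \<Rightarrow> real" where
  "wnorm w = (\<lambda>(p0, p1, p2, z, r). w\<^sup>2 * (norm p0 + norm p1) + w * norm z + norm p2 + norm r)"

lemma norm_tuple_le:
  "norm (a, b) \<le> norm a + norm b"
  using norm_Pair_le[of a b] by simp

lemma norm_component_le:
  fixes a :: "'a::real_normed_vector" and b :: "'b::real_normed_vector"
  shows "norm a \<le> norm (a, b)" "norm b \<le> norm (a, b)"
  by (simp_all add: norm_Pair real_le_rsqrt)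

lemma norm_le_wnorm:
  assumes "w \<ge> 1" shows "norm p \<le> wnorm w p"
proof -
  obtain p0 p1 p2 z r where p: "p = (p0, p1, p2, z, r)" by (cases p)
  have "norm p \<le> norm p0 + (norm p1 + (norm p2 + (norm z + norm r)))"
    unfolding p using norm_tuple_le[of p0 "(p1, p2, z, r)"] norm_tuple_le[of p1 "(p2, z, r)"]
      norm_tuple_le[of p2 "(z, r)"] norm_tuple_le[of z r] by linarith
  also have "\<dots> \<le> wnorm w p"
    using mult_right_mono[of 1 "w\<^sup>2" "norm p0 + norm p1"] mult_right_mono[of 1 w "norm z"] assms
    by (simp add: p wnorm_def one_le_power)
  finally show ?thesis .
qed

lemma wnorm_le_norm:
  assumes "w \<ge> 1" shows "wnorm w p \<le> 5 * w\<^sup>2 * norm p"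
proof -
  obtain p0 p1 p2 z r where p: "p = (p0, p1, p2, z, r)" by (cases p)
  have le: "norm p0 \<le> norm p" "norm p1 \<le> norm p" "norm p2 \<le> norm p" "norm z \<le> norm p" "norm r \<le> norm p"
    unfolding p using norm_component_le[where a=p0 and b="(p1, p2, z, r)"] norm_component_le[where a=p1 and b="(p2, z, r)"]
      norm_component_le[where a=p2 and b="(z, r)"] norm_component_le[where a=z and b=r] by - linarith+
  have w: "1 \<le> w\<^sup>2" "w \<le> w\<^sup>2" using assms mult_left_mono[of 1 w w] by (auto simp: one_le_power power2_eq_square[symmetric])
  have "w\<^sup>2 * norm p0 \<le> w\<^sup>2 * norm p" "w\<^sup>2 * norm p1 \<le> w\<^sup>2 * norm p"
    by (intro mult_left_mono le; simp)+
  moreover have "w * norm z \<le> w\<^sup>2 * norm p" "1 * norm p2 \<le> w\<^sup>2 * norm p" "1 * norm r \<le> w\<^sup>2 * norm p"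
    by (intro mult_mono le w; simp)+
  ultimately show ?thesis by (simp add: p wnorm_def algebra_simps)
qed

lemma wnorm_triangle:
  assumes "w \<ge> 0" shows "wnorm w (p + q) \<le> wnorm w p + wnorm w q"
proof -
  obtain p0 p1 p2 z r where p: "p = (p0, p1, p2, z, r)" by (cases p)
  obtain p0' p1' p2' z' r' where q: "q = (p0', p1', p2', z', r')" by (cases q)
  have "w\<^sup>2 * norm (p0 + p0') \<le> w\<^sup>2 * (norm p0 + norm p0')"
    "w\<^sup>2 * norm (p1 + p1') \<le> w\<^sup>2 * (norm p1 + norm p1')" "w * norm (z + z') \<le> w * (norm z + norm z')"
    by (intro mult_left_mono norm_triangle_ineq; simp add: assms)+
  then show ?thesis
    using norm_triangle_ineq[of p2 p2'] norm_triangle_ineq[of r r']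
    by (simp add: p q wnorm_def algebra_simps)
qed

text \<open>\<open>rhs2\<close> is affine in \<open>p2\<close>. The bracket in front of
  \<open>p2\<close> vanishes at the base point, where \<open>l = 0\<close> and the relation called
  \<open>lead\<close> below holds; this smallness, and not just a bound, makes the top-order term
  contract.\<close>

lemma rhs2_split:
  "rhs2 a k0 k1 l p0 p1 p2 z = (a *\<^sub>R 1 - (1 + l) * (k0 * k0 * (p0 * p0 * z * z * (k0 * k0)))) * p2
     - (1 + l) * (k0 * k0 * (p0 * p0 * z * z * (k0 * k1 * p1) - (1/2) *\<^sub>R (p0 * (k0 * p1) * (k0 * p1) * z * z)))"
  for k0 :: "'a::{real_normed_algebra_1, comm_ring_1}"
  by (simp add: rhs2_def flux2_def algebra_simps)

text \<open>Only the value \<open>M\<close> at the first argument multiplies \<open>p - p'\<close>;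
  the variation of \<open>M\<close> is charged to the lower-order variables, with \<open>p'\<close>
  merely bounded. So smallness of \<open>M\<close> near the base point gives a small Lipschitz
  constant in \<open>p\<close>.\<close>

lemma norm_affine_diff:
  fixes M :: "'a::real_normed_algebra"
  shows "norm (M * p - N - (M' * p' - N')) \<le> norm M * norm (p - p') + (norm ((M - M') * p') + norm (N - N'))"
proof -
  have "M * p - N - (M' * p' - N') = M * (p - p') + ((M - M') * p' - (N - N'))"
    by (simp add: algebra_simps)
  then have "norm (M * p - N - (M' * p' - N')) \<le> norm (M * (p - p')) + norm ((M - M') * p' - (N - N'))"
    by (simp only: norm_triangle_ineq)
  also have "\<dots> \<le> norm M * norm (p - p') + (norm ((M - M') * p') + norm (N - N'))"
    by (intro add_mono norm_mult_ineq norm_triangle_ineq4)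
  finally show ?thesis .
qed

text \<open>With \<open>zs\<close> frozen, the error in \<open>z\<close> is multiplied by
  \<open>1 - zs * w\<close>, which is zero at the base point and therefore small near it.\<close>

lemma norm_newton_inverse_diff:
  fixes z :: "'a::{real_normed_algebra_1, comm_ring_1}"
  shows "norm ((z + zs * (1 - z * w)) - (z' + zs * (1 - z' * w')))
    \<le> norm (1 - zs * w) * norm (z - z') + norm (z' * (zs * w - zs * w'))"
proof -
  have "(z + zs * (1 - z * w)) - (z' + zs * (1 - z' * w')) = (1 - zs * w) * (z - z') - z' * (zs * w - zs * w')"
    by (simp add: algebra_simps)
  then show ?thesis
    using order_trans[OF norm_triangle_ineq4 add_right_mono[OF norm_mult_ineq]] by metis
qed

lemma norm_tuple4_le: "norm (a, b, c, d) \<le> norm a + norm b + norm c + norm d"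
  using norm_tuple_le[of a "(b, c, d)"] norm_tuple_le[of b "(c, d)"] norm_tuple_le[of c d] by linarith

lemma norm_tuple6_le: "norm (a, b, c, d, e, f) \<le> norm a + norm b + norm c + norm d + norm e + norm f"
  using norm_tuple_le[of a "(b, c, d, e, f)"] norm_tuple_le[of b "(c, d, e, f)"] norm_tuple4_le[of c d e f]
  by linarith

text \<open>The estimates are triangular. The dependence of \<open>rhs2\<close> on
  \<open>p2\<close>, and of the Newton steps for \<open>z\<close> and \<open>r\<close> on their own
  variable, carries a factor that vanishes at the base point; the dependence on the other variables
  only has the constant \<open>C\<close>. For \<open>rhs1\<close> and \<open>rhs0\<close> no small
  factor is required, since \<open>step\<close> applies to them only operators \<open>L j\<close>
  with \<open>j < 4\<close>.\<close>

definition step_lipschitz :: "real \<Rightarrow> 'a::{real_normed_algebra_1} \<Rightarrow> 'a \<Rightarrow> 'a \<Rightarrow> 'a \<Rightarrow> 'a \<Rightarrow> 'a \<Rightarrow> 'a \<Rightarrow> 'a \<Rightarrow> real \<Rightarrow> real \<Rightarrow> bool" where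
  "step_lipschitz a k0 k1 k2 zs qs c0 c1 cr B C \<longleftrightarrow> (\<forall>l m p0 p1 p2 z r p0' p1' p2' z' r'. norm l \<le> 1 \<longrightarrow> norm m \<le> 1 \<longrightarrow>
      norm p0 \<le> B \<longrightarrow> norm p1 \<le> B \<longrightarrow> norm p2 \<le> B \<longrightarrow> norm z \<le> B \<longrightarrow> norm r \<le> B \<longrightarrow>
      norm p0' \<le> B \<longrightarrow> norm p1' \<le> B \<longrightarrow> norm p2' \<le> B \<longrightarrow> norm z' \<le> B \<longrightarrow> norm r' \<le> B \<longrightarrow>
      norm c0 \<le> B \<longrightarrow> norm c1 \<le> B \<longrightarrow> norm zs \<le> B \<longrightarrow> norm cr \<le> B \<longrightarrow>
      norm (rhs1 k0 k1 l p0 p1 p2 z - rhs1 k0 k1 l p0' p1' p2' z')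
        \<le> C * (norm (p0 - p0') + norm (p1 - p1') + norm (p2 - p2') + norm (z - z')) \<and>
      norm (rhs0 k0 k1 k2 l m p0 p1 p2 z - rhs0 k0 k1 k2 l m p0' p1' p2' z')
        \<le> C * (norm (p0 - p0') + norm (p1 - p1') + norm (p2 - p2') + norm (z - z')) \<and>
      norm (rhs2 a k0 k1 l p0 p1 p2 z - rhs2 a k0 k1 l p0' p1' p2' z')
        \<le> C * (norm l + norm (p0 - c0) + norm (z - zs)) * norm (p2 - p2')
          + C * (norm (p0 - p0') + norm (p1 - p1') + norm (z - z')) \<and>
      norm ((z + zs * (1 - z * (p0 + (1/4) *\<^sub>R (k0 * p1 * (k0 * p1)))))
          - (z' + zs * (1 - z' * (p0' + (1/4) *\<^sub>R (k0 * p1' * (k0 * p1'))))))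
        \<le> C * (norm (p0 - c0) + norm (p1 - c1)) * norm (z - z') + C * (norm (p0 - p0') + norm (p1 - p1')) \<and>
      norm ((r + (1/2) *\<^sub>R (qs * (p0 - r * r))) - (r' + (1/2) *\<^sub>R (qs * (p0' - r' * r'))))
        \<le> C * (norm (r - cr) + norm (r' - cr)) * norm (r - r') + C * norm (p0 - p0'))"

lemma step_lipschitz_constants:
  fixes k0 k1 k2 zs qs c0 c1 c2 cr :: "'a::{real_normed_algebra_1, comm_ring_1}" and a B :: real
  assumes lead: "k0 * k0 * (c0 * c0 * zs * zs * (k0 * k0)) = a *\<^sub>R 1"
    and inv: "zs * (c0 + (1/4) *\<^sub>R (k0 * c1 * (k0 * c1))) = 1" and "qs * cr = 1"
  shows "\<exists>C\<ge>1. step_lipschitz a k0 k1 k2 zs qs c0 c1 cr B C"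
proof -
  \<comment> \<open>A radius for tuples: up to four entries bounded by \<open>B\<close>, and the
    parameters \<open>l\<close> and \<open>m\<close> bounded by one.\<close>
  define B' where "B' = 4 * \<bar>B\<bar> + 2"
  let ?M = "\<lambda>x :: 'a \<times> 'a \<times> 'a \<times> 'a. a *\<^sub>R 1 - (1 + fst x) * (k0 * k0 * (fst (snd x) * fst (snd x) * snd (snd (snd x)) * snd (snd (snd x)) * (k0 * k0)))"
  let ?N = "\<lambda>x :: 'a \<times> 'a \<times> 'a \<times> 'a. (1 + fst x) * (k0 * k0 * (fst (snd x) * fst (snd x) * snd (snd (snd x)) * snd (snd (snd x)) * (k0 * k1 * fst (snd (snd x)))
       - (1/2) *\<^sub>R (fst (snd x) * (k0 * fst (snd (snd x))) * (k0 * fst (snd (snd x))) * snd (snd (snd x)) * snd (snd (snd x)))))"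
  let ?W = "\<lambda>x :: 'a \<times> 'a. zs * (fst x + (1/4) *\<^sub>R (k0 * snd x * (k0 * snd x)))"
  let ?G1 = "\<lambda>x :: 'a \<times> 'a \<times> 'a \<times> 'a \<times> 'a \<times> 'a. rhs1 k0 k1 (fst x) (fst (snd (snd x))) (fst (snd (snd (snd x)))) (fst (snd (snd (snd (snd x))))) (snd (snd (snd (snd (snd x)))))"
  let ?G0 = "\<lambda>x :: 'a \<times> 'a \<times> 'a \<times> 'a \<times> 'a \<times> 'a. rhs0 k0 k1 k2 (fst x) (fst (snd x)) (fst (snd (snd x))) (fst (snd (snd (snd x)))) (fst (snd (snd (snd (snd x))))) (snd (snd (snd (snd (snd x)))))"
  have lM: "loc_lip ?M" by (intro loc_lip_diff loc_lip_mult loc_lip_add loc_lip_const loc_lip_fst loc_lip_snd loc_lip_ident)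
  have lN: "loc_lip ?N" by (intro loc_lip_diff loc_lip_mult loc_lip_add loc_lip_const loc_lip_scaleR loc_lip_fst loc_lip_snd loc_lip_ident)
  have lW: "loc_lip ?W" by (intro loc_lip_diff loc_lip_mult loc_lip_add loc_lip_const loc_lip_scaleR loc_lip_fst loc_lip_snd loc_lip_ident)
  have lG1: "loc_lip ?G1" unfolding rhs1_def flux1_def flux2_def
    by (intro loc_lip_diff loc_lip_mult loc_lip_add loc_lip_const loc_lip_scaleR loc_lip_fst loc_lip_snd loc_lip_ident)
  have lG0: "loc_lip ?G0" unfolding rhs0_def flux1_def flux2_def
    by (intro loc_lip_diff loc_lip_mult loc_lip_add loc_lip_const loc_lip_scaleR loc_lip_fst loc_lip_snd loc_lip_ident)
  obtain CM where CM: "CM \<ge> 0" "\<forall>x y. norm x \<le> B' \<longrightarrow> norm y \<le> B' \<longrightarrow> norm (?M x - ?M y) \<le> CM * norm (x - y)"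
    using loc_lipD[OF lM, of B'] by blast
  obtain CN where CN: "CN \<ge> 0" "\<forall>x y. norm x \<le> B' \<longrightarrow> norm y \<le> B' \<longrightarrow> norm (?N x - ?N y) \<le> CN * norm (x - y)"
    using loc_lipD[OF lN, of B'] by blast
  obtain CW where CW: "CW \<ge> 0" "\<forall>x y. norm x \<le> B' \<longrightarrow> norm y \<le> B' \<longrightarrow> norm (?W x - ?W y) \<le> CW * norm (x - y)"
    using loc_lipD[OF lW, of B'] by blast
  obtain C1 where C1: "C1 \<ge> 0" "\<forall>x y. norm x \<le> B' \<longrightarrow> norm y \<le> B' \<longrightarrow> norm (?G1 x - ?G1 y) \<le> C1 * norm (x - y)"
    using loc_lipD[OF lG1, of B'] by blast
  obtain C0 where C0: "C0 \<ge> 0" "\<forall>x y. norm x \<le> B' \<longrightarrow> norm y \<le> B' \<longrightarrow> norm (?G0 x - ?G0 y) \<le> C0 * norm (x - y)"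
    using loc_lipD[OF lG0, of B'] by blast
  \<comment> \<open>One constant dominates all estimates. \<open>CM * \<bar>B\<bar>\<close> stems
    from the variation of the coefficient of \<open>p2\<close> against a bounded \<open>p2'\<close>,
    and \<open>\<bar>B\<bar> * CW\<close> from the variation of \<open>zs * w\<close> in the Newton
    step against a bounded \<open>z'\<close>.\<close>
  define C where "C = 1 + C1 + C0 + CM + (CM * \<bar>B\<bar> + CN) + CW + \<bar>B\<bar> * CW + norm qs"
  have C: "1 \<le> C" "C1 \<le> C" "C0 \<le> C" "CM \<le> C" "CM * \<bar>B\<bar> + CN \<le> C" "CW \<le> C" "\<bar>B\<bar> * CW \<le> C" "norm qs \<le> C"
    using CM(1) CN(1) CW(1) C1(1) C0(1) mult_nonneg_nonneg[OF CM(1) abs_ge_zero[of B]] mult_nonneg_nonneg[OF abs_ge_zero[of B] CW(1)]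
      norm_ge_zero[of qs]
    unfolding C_def by - linarith+
  show ?thesis unfolding step_lipschitz_def
  proof (rule exI[of _ C], rule conjI[OF C(1)], intro conjI allI impI)
    fix l m p0 p1 p2 z r p0' p1' p2' z' r' :: 'a
    assume b: "norm l \<le> 1" "norm m \<le> 1" "norm p0 \<le> B" "norm p1 \<le> B" "norm p2 \<le> B" "norm z \<le> B" "norm r \<le> B"
      "norm p0' \<le> B" "norm p1' \<le> B" "norm p2' \<le> B" "norm z' \<le> B" "norm r' \<le> B"
      "norm c0 \<le> B" "norm c1 \<le> B" "norm zs \<le> B" "norm cr \<le> B"
    define S where "S = norm (p0 - p0') + norm (p1 - p1') + norm (p2 - p2') + norm (z - z')"
    have S: "S \<ge> 0" by (simp add: S_def)
    have n6: "norm (l, m, p0, p1, p2, z) \<le> B'" "norm (l, m, p0', p1', p2', z') \<le> B'"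
      using norm_tuple6_le[of l m p0 p1 p2 z] norm_tuple6_le[of l m p0' p1' p2' z'] b unfolding B'_def by - linarith+
    have d6: "norm ((l, m, p0, p1, p2, z) - (l, m, p0', p1', p2', z')) \<le> S"
      using norm_tuple6_le[of "0 :: 'a" "0 :: 'a" "p0 - p0'" "p1 - p1'" "p2 - p2'" "z - z'"] by (simp add: S_def)
    have n4: "norm (l, p0, p1, z) \<le> B'" "norm (l, p0', p1', z') \<le> B'" "norm (0 :: 'a, c0, p1, zs) \<le> B'"
      using norm_tuple4_le[of l p0 p1 z] norm_tuple4_le[of l p0' p1' z'] norm_tuple4_le[of "0 :: 'a" c0 p1 zs] b
      unfolding B'_def norm_zero by - linarith+
    have d4: "norm ((l, p0, p1, z) - (l, p0', p1', z')) \<le> norm (p0 - p0') + norm (p1 - p1') + norm (z - z')"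
      "norm ((l, p0, p1, z) - (0, c0, p1, zs)) \<le> norm l + norm (p0 - c0) + norm (z - zs)"
      using norm_tuple4_le[of "0 :: 'a" "p0 - p0'" "p1 - p1'" "z - z'"] norm_tuple4_le[of l "p0 - c0" "0 :: 'a" "z - zs"] by simp_all
    have n2: "norm (p0, p1) \<le> B'" "norm (p0', p1') \<le> B'" "norm (c0, c1) \<le> B'"
      using norm_tuple_le[of p0 p1] norm_tuple_le[of p0' p1'] norm_tuple_le[of c0 c1] b unfolding B'_def by - linarith+
    have d2: "norm ((p0, p1) - (p0', p1')) \<le> norm (p0 - p0') + norm (p1 - p1')"
      "norm ((p0, p1) - (c0, c1)) \<le> norm (p0 - c0) + norm (p1 - c1)"
      using norm_tuple_le[of "p0 - p0'" "p1 - p1'"] norm_tuple_le[of "p0 - c0" "p1 - c1"] by simp_all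
    have "norm (rhs1 k0 k1 l p0 p1 p2 z - rhs1 k0 k1 l p0' p1' p2' z') \<le> C1 * norm ((l, m, p0, p1, p2, z) - (l, m, p0', p1', p2', z'))"
      using C1(2)[rule_format, OF n6] by simp
    also have "\<dots> \<le> C * S" by (intro mult_mono d6 C S) (use C in auto)
    finally show "norm (rhs1 k0 k1 l p0 p1 p2 z - rhs1 k0 k1 l p0' p1' p2' z')
        \<le> C * (norm (p0 - p0') + norm (p1 - p1') + norm (p2 - p2') + norm (z - z'))" by (simp add: S_def)
    have "norm (rhs0 k0 k1 k2 l m p0 p1 p2 z - rhs0 k0 k1 k2 l m p0' p1' p2' z') \<le> C0 * norm ((l, m, p0, p1, p2, z) - (l, m, p0', p1', p2', z'))"
      using C0(2)[rule_format, OF n6] by simp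
    also have "\<dots> \<le> C * S" by (intro mult_mono d6 C S) (use C in auto)
    finally show "norm (rhs0 k0 k1 k2 l m p0 p1 p2 z - rhs0 k0 k1 k2 l m p0' p1' p2' z')
        \<le> C * (norm (p0 - p0') + norm (p1 - p1') + norm (p2 - p2') + norm (z - z'))" by (simp add: S_def)
    have M1: "norm (?M (l, p0, p1, z)) \<le> C * (norm l + norm (p0 - c0) + norm (z - zs))"
    proof -
      have "?M (0, c0, p1, zs) = 0" using lead by simp
      then have "norm (?M (l, p0, p1, z)) \<le> CM * norm ((l, p0, p1, z) - (0, c0, p1, zs))"
        using CM(2)[rule_format, OF n4(1) n4(3)] by simp
      also have "\<dots> \<le> C * (norm l + norm (p0 - c0) + norm (z - zs))"
        by (intro mult_mono d4 C) (use C in auto)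
      finally show ?thesis .
    qed
    let ?T = "norm (p0 - p0') + norm (p1 - p1') + norm (z - z')"
    have M2: "norm ((?M (l, p0, p1, z) - ?M (l, p0', p1', z')) * p2') \<le> (CM * ?T) * \<bar>B\<bar>"
    proof (rule order_trans[OF norm_mult_ineq mult_mono])
      have "CM * norm ((l, p0, p1, z) - (l, p0', p1', z')) \<le> CM * ?T"
        by (intro mult_left_mono d4 CM)
      then show "norm (?M (l, p0, p1, z) - ?M (l, p0', p1', z')) \<le> CM * ?T"
        using CM(2)[rule_format, OF n4(1,2)] by linarith
    qed (use b CM in auto)
    have N1: "norm (?N (l, p0, p1, z) - ?N (l, p0', p1', z')) \<le> CN * ?T"
    proof -
      have "CN * norm ((l, p0, p1, z) - (l, p0', p1', z')) \<le> CN * ?T"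
        by (intro mult_left_mono d4 CN)
      then show ?thesis using CN(2)[rule_format, OF n4(1,2)] by linarith
    qed
    have "norm (rhs2 a k0 k1 l p0 p1 p2 z - rhs2 a k0 k1 l p0' p1' p2' z') \<le>
        norm (?M (l, p0, p1, z)) * norm (p2 - p2') + ((CM * ?T) * \<bar>B\<bar> + CN * ?T)"
      using norm_affine_diff[of "?M (l, p0, p1, z)" p2 "?N (l, p0, p1, z)" "?M (l, p0', p1', z')" p2' "?N (l, p0', p1', z')"]
        add_mono[OF M2 N1] unfolding rhs2_split fst_conv snd_conv by linarith
    also have "\<dots> \<le> C * (norm l + norm (p0 - c0) + norm (z - zs)) * norm (p2 - p2') + C * ?T"
    proof (rule add_mono)
      show "norm (?M (l, p0, p1, z)) * norm (p2 - p2') \<le> C * (norm l + norm (p0 - c0) + norm (z - zs)) * norm (p2 - p2')"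
        by (rule mult_right_mono[OF M1]) simp
      have "(CM * \<bar>B\<bar> + CN) * ?T \<le> C * ?T" by (rule mult_right_mono[OF C(5)]) simp
      then show "(CM * ?T) * \<bar>B\<bar> + CN * ?T \<le> C * ?T" by (simp add: algebra_simps)
    qed
    finally show "norm (rhs2 a k0 k1 l p0 p1 p2 z - rhs2 a k0 k1 l p0' p1' p2' z')
        \<le> C * (norm l + norm (p0 - c0) + norm (z - zs)) * norm (p2 - p2') + C * ?T" .
    have W1: "norm (1 - ?W (p0, p1)) \<le> C * (norm (p0 - c0) + norm (p1 - c1))"
    proof -
      have "?W (c0, c1) = 1" using inv by simp
      then have "norm (1 - ?W (p0, p1)) \<le> CW * norm ((p0, p1) - (c0, c1))"
        using CW(2)[rule_format, OF n2(1) n2(3)] by (simp add: norm_minus_commute)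
      also have "\<dots> \<le> C * (norm (p0 - c0) + norm (p1 - c1))"
        by (intro mult_mono d2 C) (use C in auto)
      finally show ?thesis .
    qed
    have W2: "norm (z' * (?W (p0, p1) - ?W (p0', p1'))) \<le> \<bar>B\<bar> * (CW * (norm (p0 - p0') + norm (p1 - p1')))"
    proof (rule order_trans[OF norm_mult_ineq mult_mono])
      have "CW * norm ((p0, p1) - (p0', p1')) \<le> CW * (norm (p0 - p0') + norm (p1 - p1'))"
        by (intro mult_left_mono d2 CW)
      then show "norm (?W (p0, p1) - ?W (p0', p1')) \<le> CW * (norm (p0 - p0') + norm (p1 - p1'))"
        using CW(2)[rule_format, OF n2(1,2)] by linarith
    qed (use b in auto)
    let ?X = "(z + zs * (1 - z * (p0 + (1/4) *\<^sub>R (k0 * p1 * (k0 * p1)))))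
          - (z' + zs * (1 - z' * (p0' + (1/4) *\<^sub>R (k0 * p1' * (k0 * p1')))))"
    have "norm ?X \<le> norm (1 - ?W (p0, p1)) * norm (z - z') + \<bar>B\<bar> * (CW * (norm (p0 - p0') + norm (p1 - p1')))"
      using W2 unfolding fst_conv snd_conv by (intro order_trans[OF norm_newton_inverse_diff] add_left_mono)
    also have "\<dots> \<le> C * (norm (p0 - c0) + norm (p1 - c1)) * norm (z - z') + C * (norm (p0 - p0') + norm (p1 - p1'))"
    proof (rule add_mono)
      show "norm (1 - ?W (p0, p1)) * norm (z - z') \<le> C * (norm (p0 - c0) + norm (p1 - c1)) * norm (z - z')"
        by (rule mult_right_mono[OF W1]) simp
      have "\<bar>B\<bar> * CW * (norm (p0 - p0') + norm (p1 - p1')) \<le> C * (norm (p0 - p0') + norm (p1 - p1'))"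
        by (rule mult_right_mono[OF C(7)]) simp
      then show "\<bar>B\<bar> * (CW * (norm (p0 - p0') + norm (p1 - p1'))) \<le> C * (norm (p0 - p0') + norm (p1 - p1'))"
        by (simp add: mult.assoc)
    qed
    finally show "norm ?X \<le> C * (norm (p0 - c0) + norm (p1 - c1)) * norm (z - z') + C * (norm (p0 - p0') + norm (p1 - p1'))" .
    let ?Y = "(r + (1/2) *\<^sub>R (qs * (p0 - r * r))) - (r' + (1/2) *\<^sub>R (qs * (p0' - r' * r')))"
    \<comment> \<open>Since \<open>qs * cr = 1\<close>, the difference \<open>r - r'\<close> is
      twice \<open>(1/2) *\<^sub>R (qs * cr * (r - r'))\<close>. In this form it cancels the
      linearization of the square at \<open>cr\<close>, and only the deviations of \<open>r\<close>
      and \<open>r'\<close> from \<open>cr\<close> remain as a factor.\<close>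
    have "(1/2) *\<^sub>R (qs * cr * (r - r')) + (1/2) *\<^sub>R (qs * cr * (r - r')) = r - r'"
      unfolding \<open>qs * cr = 1\<close> by (simp add: scaleR_left.add[symmetric])
    then have "?Y = (1/2) *\<^sub>R (qs * cr * (r - r')) + (1/2) *\<^sub>R (qs * cr * (r - r'))
        + (1/2) *\<^sub>R (qs * (p0 - r * r)) - (1/2) *\<^sub>R (qs * (p0' - r' * r'))"
      by (simp add: algebra_simps)
    also have "\<dots> = (1/2) *\<^sub>R (qs * (p0 - p0') - qs * ((r - cr) + (r' - cr)) * (r - r'))"
      by (simp add: algebra_simps)
    finally have "norm ?Y \<le> (1/2) * norm (qs * (p0 - p0') - qs * ((r - cr) + (r' - cr)) * (r - r'))"
      by simp
    also have "\<dots> \<le> norm (qs * (p0 - p0') - qs * ((r - cr) + (r' - cr)) * (r - r'))" by simp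
    also have "\<dots> \<le> norm (qs * (p0 - p0')) + norm (qs * ((r - cr) + (r' - cr)) * (r - r'))"
      by (rule norm_triangle_ineq4)
    finally have Y: "norm ?Y \<le> norm (qs * (p0 - p0')) + norm (qs * ((r - cr) + (r' - cr)) * (r - r'))" .
    have Y1: "norm (qs * (p0 - p0')) \<le> C * norm (p0 - p0')"
      by (rule order_trans[OF norm_mult_ineq mult_right_mono[OF C(8)]]) simp
    have Y2: "norm (qs * ((r - cr) + (r' - cr)) * (r - r')) \<le> C * (norm (r - cr) + norm (r' - cr)) * norm (r - r')"
    proof (rule order_trans[OF norm_mult_ineq mult_right_mono])
      show "norm (qs * ((r - cr) + (r' - cr))) \<le> C * (norm (r - cr) + norm (r' - cr))"
        by (rule order_trans[OF norm_mult_ineq mult_mono[OF C(8) norm_triangle_ineq]]) (use C in auto)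
    qed simp
    show "norm ?Y \<le> C * (norm (r - cr) + norm (r' - cr)) * norm (r - r') + C * norm (p0 - p0')"
      using order_trans[OF Y add_mono[OF Y1 Y2]] by (simp only: add.commute)
  qed
qed

text \<open>The constants have to be found before the time step is chosen: \<open>L\<close>,
  \<open>\<zeta>\<close>, \<open>l\<close> and \<open>m\<close> stay quantified, so the same
  constants serve every small \<open>T\<close>. The source \<open>\<zeta>\<close> cancels in
  differences. \<open>L 4\<close> is only bounded, not small.\<close>

definition step_contracts :: "real \<Rightarrow> 'a::{real_normed_algebra_1} \<Rightarrow> 'a \<Rightarrow> 'a \<Rightarrow> 'a \<Rightarrow> 'a \<Rightarrow> 'a state \<Rightarrow> real \<Rightarrow> real \<Rightarrow> real \<Rightarrow> bool" where
  "step_contracts a k0 k1 k2 zs qs c w \<delta> \<theta> \<longleftrightarrow>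
     (\<forall>L \<zeta> l m p q. (\<forall>j\<le>4. linear (L j)) \<longrightarrow> (\<forall>j<4. \<forall>x. norm (L j x) \<le> \<theta> * norm x) \<longrightarrow>
      (\<forall>x. norm (L 4 x) \<le> norm x / a) \<longrightarrow> norm l \<le> \<theta> \<longrightarrow> norm m \<le> \<theta> \<longrightarrow>
      wnorm w (p - c) \<le> \<delta> \<longrightarrow> wnorm w (q - c) \<le> \<delta> \<longrightarrow>
      wnorm w (step a k0 k1 k2 zs qs L \<zeta> l m p - step a k0 k1 k2 zs qs L \<zeta> l m q) \<le> wnorm w (p - q) / 2)"

text \<open>Contributions that carry an operator \<open>L j\<close> with \<open>j < 4\<close> are
  made small by \<open>\<theta>\<close>, the self-interactions of \<open>p2\<close>,
  \<open>z\<close> and \<open>r\<close> by \<open>\<delta>\<close>, and the remaining one-way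
  couplings by the weights in \<open>wnorm\<close>.\<close>

lemma step_contraction:
  fixes k0 k1 k2 zs qs c0 c1 c2 cr :: "'a::{real_normed_algebra_1, comm_ring_1}" and a :: real
  assumes a: "a > 0" and lead: "k0 * k0 * (c0 * c0 * zs * zs * (k0 * k0)) = a *\<^sub>R 1"
    and inv: "zs * (c0 + (1/4) *\<^sub>R (k0 * c1 * (k0 * c1))) = 1" and root: "qs * cr = 1"
  shows "\<exists>w\<ge>1. \<exists>\<delta>>0. \<exists>\<theta>>0. \<theta> \<le> 1 \<and> step_contracts a k0 k1 k2 zs qs (c0, c1, c2, zs, cr) w \<delta> \<theta>"
proof -
  define B where "B = norm (c0, c1, c2, zs, cr) + 1"
  obtain C where C1: "C \<ge> 1" and C: "step_lipschitz a k0 k1 k2 zs qs c0 c1 cr B C"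
    using step_lipschitz_constants[OF lead inv root, where ?k2.0=k2 and B=B] by blast
  \<comment> \<open>\<open>w\<close> makes the coupling constants \<open>C\<close> and
    \<open>C / a\<close> at most one eighth of the ratios of the weights concerned.
    \<open>\<delta>\<close> bounds the factors \<open>2 * C * \<delta>\<close> and
    \<open>3 * C * \<delta> / a\<close> by 1/8 and 3/16. In \<open>\<theta>\<close> the number 192
    is 8 times 24: the terms with small operators amount to at most
    \<open>8 * w\<^sup>2 * E\<close>, which is to cost a share of 1/24.\<close>
  define w where "w = 8 * C + 8 * (C / a) + 8"
  define \<delta> where "\<delta> = min 1 (min (1 / (16 * C)) (a / (16 * C)))"
  define \<theta> where "\<theta> = min \<delta> (1 / (192 * w\<^sup>2 * C))"
  have Ca: "C / a > 0" "C > 0" using C1 a by simp_all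
  have w: "w \<ge> 1" "w \<ge> 8 * C" "w \<ge> 8 * (C / a)" using Ca C1 by (simp_all add: w_def)
  have w2: "w\<^sup>2 \<ge> 1" "w\<^sup>2 \<ge> w" using w(1) mult_left_mono[of 1 w w] by (auto simp: one_le_power power2_eq_square[symmetric])
  have \<delta>: "\<delta> > 0" "\<delta> \<le> 1" "C * \<delta> \<le> 1 / 16" "C * \<delta> \<le> a / 16"
  proof -
    show "\<delta> > 0" "\<delta> \<le> 1" using Ca a by (auto simp: \<delta>_def)
    have "C * \<delta> \<le> C * (1 / (16 * C))" "C * \<delta> \<le> C * (a / (16 * C))"
      using Ca by (intro mult_left_mono; simp add: \<delta>_def)+
    then show "C * \<delta> \<le> 1 / 16" "C * \<delta> \<le> a / 16" using Ca by simp_all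
  qed
  have \<theta>: "\<theta> > 0" "\<theta> \<le> \<delta>" "192 * w\<^sup>2 * (\<theta> * C) \<le> 1"
  proof -
    show "\<theta> > 0" "\<theta> \<le> \<delta>" using \<delta> w(1) Ca by (auto simp: \<theta>_def intro!: mult_pos_pos)
    have "\<theta> * (192 * w\<^sup>2 * C) \<le> (1 / (192 * w\<^sup>2 * C)) * (192 * w\<^sup>2 * C)"
      using Ca by (intro mult_right_mono; simp add: \<theta>_def)+
    then show "192 * w\<^sup>2 * (\<theta> * C) \<le> 1" using w(1) Ca by (auto simp: mult_ac split: if_splits)
  qed
  have main: "wnorm w (step a k0 k1 k2 zs qs L \<zeta> l m p - step a k0 k1 k2 zs qs L \<zeta> l m q) \<le> wnorm w (p - q) / 2"
    if lin: "\<forall>j\<le>4. linear (L j)" and L: "\<forall>j<4. \<forall>x. norm (L j x) \<le> \<theta> * norm x" and L4: "\<forall>x. norm (L 4 x) \<le> norm x / a"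
      and l: "norm l \<le> \<theta>" and m: "norm m \<le> \<theta>"
      and p: "wnorm w (p - (c0, c1, c2, zs, cr)) \<le> \<delta>" and q: "wnorm w (q - (c0, c1, c2, zs, cr)) \<le> \<delta>"
    for L \<zeta> l m p q
  proof -
    obtain p0 p1 p2 z r where pe: "p = (p0, p1, p2, z, r)" by (cases p)
    obtain p0' p1' p2' z' r' where qe: "q = (p0', p1', p2', z', r')" by (cases q)
    have near: "norm x \<le> \<delta>" if "wnorm w x \<le> \<delta>" for x :: "'a state" using norm_le_wnorm[OF w(1), of x] that by simp
    have comp: "norm x0 \<le> norm (x0, x1, x2, x3, x4)" "norm x1 \<le> norm (x0, x1, x2, x3, x4)" "norm x2 \<le> norm (x0, x1, x2, x3, x4)"
      "norm x3 \<le> norm (x0, x1, x2, x3, x4)" "norm x4 \<le> norm (x0, x1, x2, x3, x4)" for x0 x1 x2 x3 x4 :: 'a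
      using norm_component_le[where a=x0 and b="(x1, x2, x3, x4)"] norm_component_le[where a=x1 and b="(x2, x3, x4)"]
        norm_component_le[where a=x2 and b="(x3, x4)"] norm_component_le[where a=x3 and b=x4] by - linarith+
    have np: "norm (p - (c0, c1, c2, zs, cr)) \<le> \<delta>" and nq: "norm (q - (c0, c1, c2, zs, cr)) \<le> \<delta>"
      using near p q by blast+
    have dp: "norm (p0 - c0) \<le> \<delta>" "norm (p1 - c1) \<le> \<delta>" "norm (z - zs) \<le> \<delta>" "norm (r - cr) \<le> \<delta>" "norm (r' - cr) \<le> \<delta>"
      using comp[where ?x0.0="p0 - c0" and ?x1.0="p1 - c1" and ?x2.0="p2 - c2" and ?x3.0="z - zs" and ?x4.0="r - cr"]
       comp[where ?x0.0="p0' - c0" and ?x1.0="p1' - c1" and ?x2.0="p2' - c2" and ?x3.0="z' - zs" and ?x4.0="r' - cr"] np nq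
      unfolding pe qe diff_Pair by - linarith+
    have "norm p \<le> B" "norm q \<le> B"
      using norm_triangle_sub[of p "(c0, c1, c2, zs, cr)"] norm_triangle_sub[of q "(c0, c1, c2, zs, cr)"] np nq \<delta>(2)
      unfolding B_def by - linarith+
    moreover have "norm (c0, c1, c2, zs, cr) \<le> B" by (simp add: B_def)
    ultimately have b: "norm p0 \<le> B" "norm p1 \<le> B" "norm p2 \<le> B" "norm z \<le> B" "norm r \<le> B"
      "norm p0' \<le> B" "norm p1' \<le> B" "norm p2' \<le> B" "norm z' \<le> B" "norm r' \<le> B"
      "norm c0 \<le> B" "norm c1 \<le> B" "norm zs \<le> B" "norm cr \<le> B"
      unfolding pe qe by (blast intro: order_trans[OF comp(1)] order_trans[OF comp(2)] order_trans[OF comp(3)]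
        order_trans[OF comp(4)] order_trans[OF comp(5)])+
    have lm: "norm l \<le> 1" "norm m \<le> 1" using l m \<theta> \<delta> by linarith+
    define x where "x = norm (p0 - p0') + norm (p1 - p1')"
    define y where "y = norm (p2 - p2')"
    define v where "v = norm (z - z')"
    define u where "u = norm (r - r')"
    have nn: "x \<ge> 0" "y \<ge> 0" "v \<ge> 0" "u \<ge> 0" by (simp_all add: x_def y_def v_def u_def)
    define G2 where "G2 = rhs2 a k0 k1 l p0 p1 p2 z - rhs2 a k0 k1 l p0' p1' p2' z'"
    define G1 where "G1 = rhs1 k0 k1 l p0 p1 p2 z - rhs1 k0 k1 l p0' p1' p2' z'"
    define G0 where "G0 = rhs0 k0 k1 k2 l m p0 p1 p2 z - rhs0 k0 k1 k2 l m p0' p1' p2' z'"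
    note CC = C[unfolded step_lipschitz_def, rule_format, OF lm b]
    have G1: "norm G1 \<le> C * (x + y + v)" and G0: "norm G0 \<le> C * (x + y + v)"
      using CC unfolding G1_def G0_def x_def y_def v_def by (simp_all add: algebra_simps)
    have G2: "norm G2 \<le> 3 * (C * \<delta>) * y + C * (x + v)"
    proof -
      have "norm G2 \<le> C * (norm l + norm (p0 - c0) + norm (z - zs)) * y + C * (x + v)"
        using CC unfolding G2_def x_def y_def v_def by simp
      moreover have "C * (norm l + norm (p0 - c0) + norm (z - zs)) * y \<le> C * (3 * \<delta>) * y"
        using l \<theta> dp Ca nn by (intro mult_right_mono mult_left_mono) auto
      ultimately show ?thesis by (simp add: mult_ac)
    qed
    have G2': "norm G2 \<le> C * (x + y + v)"
    proof -
      have "3 * (C * \<delta>) \<le> C" using \<delta>(3) C1 by linarith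
      then have "3 * (C * \<delta>) * y \<le> C * y" using nn by (intro mult_right_mono)
      then show ?thesis using G2 by (simp add: algebra_simps)
    qed
    have Z: "norm ((z + zs * (1 - z * (p0 + (1/4) *\<^sub>R (k0 * p1 * (k0 * p1)))))
          - (z' + zs * (1 - z' * (p0' + (1/4) *\<^sub>R (k0 * p1' * (k0 * p1')))))) \<le> (1/8) * v + C * x"
    proof -
      have "C * (norm (p0 - c0) + norm (p1 - c1)) * v \<le> C * (2 * \<delta>) * v"
        using dp Ca nn by (intro mult_right_mono mult_left_mono) auto
      also have "\<dots> \<le> (1/8) * v" using \<delta> nn by (intro mult_right_mono) auto
      finally show ?thesis using CC unfolding x_def v_def by simp
    qed
    have R: "norm ((r + (1/2) *\<^sub>R (qs * (p0 - r * r))) - (r' + (1/2) *\<^sub>R (qs * (p0' - r' * r')))) \<le> (1/8) * u + C * x"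
    proof -
      have "C * (norm (r - cr) + norm (r' - cr)) * u \<le> C * (2 * \<delta>) * u"
        using dp Ca nn by (intro mult_right_mono mult_left_mono) auto
      also have "\<dots> \<le> (1/8) * u" using \<delta> nn by (intro mult_right_mono) auto
      finally have "C * (norm (r - cr) + norm (r' - cr)) * u \<le> (1/8) * u" .
      moreover have "C * norm (p0 - p0') \<le> C * x" using Ca by (intro mult_left_mono) (auto simp: x_def)
      ultimately show ?thesis using CC unfolding u_def by linarith
    qed
    define E where "E = \<theta> * (C * (x + y + v))"
    have LE: "norm (L j G) \<le> E" if "j < 4" "norm G \<le> C * (x + y + v)" for j G
      using L that \<theta>(1) mult_left_mono[OF that(2), of \<theta>] unfolding E_def by (meson less_imp_le order_trans)
    have LD: "(\<zeta> j + L (j + 2) (rhs2 a k0 k1 l p0 p1 p2 z) + L (j + 1) (rhs1 k0 k1 l p0 p1 p2 z) + L j (rhs0 k0 k1 k2 l m p0 p1 p2 z))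
       - (\<zeta> j + L (j + 2) (rhs2 a k0 k1 l p0' p1' p2' z') + L (j + 1) (rhs1 k0 k1 l p0' p1' p2' z') + L j (rhs0 k0 k1 k2 l m p0' p1' p2' z'))
       = L (j + 2) G2 + L (j + 1) G1 + L j G0" if "j \<le> 2" for j
      using that lin by (simp add: G2_def G1_def G0_def linear_diff)
    have tri: "norm (A + A' + A'') \<le> norm A + norm A' + norm A''" for A A' A'' :: 'a
      by (meson add_right_mono norm_triangle_ineq order_trans)
    have P0: "norm (L 2 G2 + L 1 G1 + L 0 G0) \<le> 3 * E"
      using tri[of "L 2 G2" "L 1 G1" "L 0 G0"] LE[of 2 G2] LE[of 1 G1] LE[of 0 G0] G1 G0 G2' by simp
    have P1: "norm (L 3 G2 + L 2 G1 + L 1 G0) \<le> 3 * E"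
      using tri[of "L 3 G2" "L 2 G1" "L 1 G0"] LE[of 3 G2] LE[of 2 G1] LE[of 1 G0] G1 G0 G2' by simp
    have P2: "norm (L 4 G2 + L 3 G1 + L 2 G0) \<le> (3/16) * y + (C / a) * (x + v) + 2 * E"
    proof -
      have "norm (L 4 G2) \<le> norm G2 / a" using L4 by blast
      also have "\<dots> \<le> (3 * (C * \<delta>) * y + C * (x + v)) / a" using G2 a by (intro divide_right_mono) auto
      also have "\<dots> = (3 * (C * \<delta>) / a) * y + (C / a) * (x + v)" by (simp add: add_divide_distrib)
      also have "(3 * (C * \<delta>) / a) * y \<le> (3/16) * y"
        using \<delta>(4) a nn by (intro mult_right_mono) (auto simp: divide_simps)
      finally show ?thesis
        using tri[of "L 4 G2" "L 3 G1" "L 2 G0"] LE[of 3 G1] LE[of 2 G0] G1 G0 by simp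
    qed
    have "wnorm w (step a k0 k1 k2 zs qs L \<zeta> l m p - step a k0 k1 k2 zs qs L \<zeta> l m q) \<le>
        w\<^sup>2 * (3 * E + 3 * E) + w * ((1/8) * v + C * x) + ((3/16) * y + (C / a) * (x + v) + 2 * E) + ((1/8) * u + C * x)"
      using LD[of 0] LD[of 1] LD[of 2] P0 P1 P2 Z R w w2
      unfolding pe qe step_def wnorm_def Let_def diff_Pair split
      by (intro add_mono mult_left_mono) (simp_all add: numeral_2_eq_2 numeral_3_eq_3 numeral_eq_Suc)
    also have "\<dots> \<le> (w\<^sup>2 * x + w * v + y + u) / 2"
    proof -
      have E0: "E \<ge> 0" using \<theta>(1) Ca nn by (simp add: E_def)
      have "8 * w\<^sup>2 * E = (192 * w\<^sup>2 * (\<theta> * C)) * ((x + y + v) / 24)" by (simp add: E_def)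
      also have "\<dots> \<le> 1 * ((x + y + v) / 24)" using nn \<theta>(3) by (intro mult_right_mono) auto
      finally have e1: "8 * w\<^sup>2 * E \<le> (x + y + v) / 24" by simp
      have e2: "2 * E \<le> 2 * w\<^sup>2 * E" using mult_right_mono[OF w2(1) E0] by simp
      have e3: "w * (C * x) \<le> w\<^sup>2 * x / 8"
      proof -
        have "w * (C * x) \<le> w * (w / 8 * x)" using w nn by (intro mult_left_mono mult_right_mono) auto
        then show ?thesis by (simp add: power2_eq_square)
      qed
      have e4: "(C / a) * (x + v) \<le> w\<^sup>2 * x / 8 + w * v / 8"
      proof -
        have "C / a \<le> w\<^sup>2 / 8" "C / a \<le> w / 8" using w(3) w2(2) by linarith+
        then have "(C / a) * x \<le> w\<^sup>2 / 8 * x" "(C / a) * v \<le> w / 8 * v" using nn by (simp_all only: mult_right_mono)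
        then have "(C / a) * x + (C / a) * v \<le> w\<^sup>2 / 8 * x + w / 8 * v" by (rule add_mono)
        then show ?thesis unfolding distrib_left by (simp only: times_divide_eq_left)
      qed
      have e5: "C * x \<le> w\<^sup>2 * x / 8"
      proof -
        have "C \<le> w\<^sup>2 / 8" using w(2) w2(2) by linarith
        then have "C * x \<le> w\<^sup>2 / 8 * x" using nn by (simp only: mult_right_mono)
        then show ?thesis by simp
      qed
      have e6: "x \<le> w\<^sup>2 * x" "v \<le> w * v" using mult_right_mono[OF w2(1) nn(1)] mult_right_mono[OF w(1) nn(3)] by simp_all
      have "w\<^sup>2 * (3 * E + 3 * E) + w * ((1/8) * v + C * x) + ((3/16) * y + (C / a) * (x + v) + 2 * E) + ((1/8) * u + C * x)
        = 6 * w\<^sup>2 * E + w * v / 8 + w * (C * x) + (3/16) * y + (C / a) * (x + v) + 2 * E + u / 8 + C * x"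
        by (simp add: algebra_simps)
      also have "\<dots> \<le> 8 * w\<^sup>2 * E + w * v / 8 + w * (C * x) + (3/16) * y + (C / a) * (x + v) + u / 8 + C * x"
        using e2 by (simp add: mult_ac)
      also have "\<dots> \<le> (x + y + v) / 24 + w * v / 8 + w\<^sup>2 * x / 8 + (3/16) * y + (w\<^sup>2 * x / 8 + w * v / 8) + u / 8 + w\<^sup>2 * x / 8"
        by (intro add_mono e1 e3 e4 e5 order_refl)
      also have "\<dots> \<le> (w\<^sup>2 * x + w * v + y + u) / 2" using e6 nn by (simp add: field_simps)
      finally show ?thesis .
    qed
    also have "w\<^sup>2 * x + w * v + y + u = wnorm w (p - q)"
      by (simp add: pe qe wnorm_def x_def y_def v_def u_def)
    finally show ?thesis .
  qed
  show ?thesis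
    unfolding step_contracts_def using w(1) \<delta> \<theta> main
    by (intro exI[of _ w] conjI exI[of _ \<delta>] exI[of _ \<theta>]) auto
qed

text \<open>Banach's theorem is applied in the metric of the product type, in which \<open>F\<close>
  itself need not contract. That norm and \<open>wnorm\<close> are equivalent up to the factor
  \<open>5 * w\<^sup>2\<close>, so an iterate \<open>F ^^ n\<close> with
  \<open>2 ^ n > 10 * w\<^sup>2\<close> halves distances; its unique fixed point is also fixed by
  \<open>F\<close>, because \<open>F\<close> commutes with its iterates. The ball of radius
  \<open>\<delta> / 2\<close> about \<open>v\<close> is invariant: half of its radius plus the
  defect \<open>\<delta> / 4\<close> of \<open>v\<close> is again
  \<open>\<delta> / 2\<close>.\<close>

lemma wnorm_fixed_point:
  fixes F :: "'a::banach state \<Rightarrow> 'a state"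
  assumes w: "w \<ge> 1" and \<delta>: "\<delta> \<ge> 0"
    and contr: "\<And>p q. wnorm w (p - c) \<le> \<delta> \<Longrightarrow> wnorm w (q - c) \<le> \<delta> \<Longrightarrow> wnorm w (F p - F q) \<le> wnorm w (p - q) / 2"
    and start: "wnorm w (v - c) \<le> \<delta> / 2" and small: "wnorm w (F v - v) \<le> \<delta> / 4"
  shows "\<exists>p. wnorm w (p - c) \<le> \<delta> \<and> F p = p"
proof -
  let ?N = "wnorm w"
  define S where "S = {p. ?N (p - v) \<le> \<delta> / 2}"
  have tri: "?N (x - y) \<le> ?N (x - z) + ?N (z - y)" for x y z :: "'a state"
    using wnorm_triangle[of w "x - z" "z - y"] w by simp
  have Sc: "?N (p - c) \<le> \<delta>" if "p \<in> S" for p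
    using tri[of p c v] that start by (simp add: S_def)
  have inS: "F p \<in> S" if "p \<in> S" for p
  proof -
    have "?N (F p - F v) \<le> ?N (p - v) / 2" using contr[OF Sc[OF that]] start \<delta> by simp
    then show ?thesis using tri[of "F p" v "F v"] that small by (simp add: S_def)
  qed
  have cont: "continuous_on UNIV (\<lambda>p :: 'a state. ?N (p - v))"
    unfolding wnorm_def case_prod_unfold by (intro continuous_intros)
  have "closed S"
    using continuous_closed_vimage[of "{..\<delta> / 2}" "\<lambda>p. ?N (p - v)"] cont
    unfolding S_def by (auto simp: vimage_def continuous_on_eq_continuous_at)
  then have S: "complete S" by (simp add: complete_eq_closed)
  have "?N (0 :: 'a state) = 0" by (simp add: wnorm_def zero_prod_def)
  then have vS: "v \<in> S" using \<delta> by (simp add: S_def)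
  have iter: "(F ^^ n) p \<in> S" if "p \<in> S" for n p by (induction n) (use that inS in auto)
  have iterN: "?N ((F ^^ n) p - (F ^^ n) q) \<le> ?N (p - q) / 2 ^ n" if "p \<in> S" "q \<in> S" for n p q
  proof (induction n)
    case (Suc n)
    then show ?case
      using contr[OF Sc[OF iter[OF that(1), of n]] Sc[OF iter[OF that(2), of n]]] by simp
  qed simp
  obtain n where n: "5 * w\<^sup>2 * 2 < (2 :: real) ^ n"
    using real_arch_pow[of 2 "5 * w\<^sup>2 * 2"] by auto
  have "dist ((F ^^ n) p) ((F ^^ n) q) \<le> (1/2) * dist p q" if "p \<in> S" "q \<in> S" for p q
  proof -
    have "dist ((F ^^ n) p) ((F ^^ n) q) \<le> ?N (p - q) / 2 ^ n"
      unfolding dist_norm by (rule order_trans[OF norm_le_wnorm[OF w] iterN[OF that]])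
    also have "\<dots> \<le> (5 * w\<^sup>2 * dist p q) / 2 ^ n"
      unfolding dist_norm by (rule divide_right_mono[OF wnorm_le_norm[OF w]]) simp
    also have "\<dots> \<le> (1/2) * dist p q"
    proof -
      have "(5 * w\<^sup>2 * 2) * dist p q \<le> 2 ^ n * dist p q" using n by (intro mult_right_mono) auto
      then show ?thesis by (simp add: field_simps)
    qed
    finally show ?thesis .
  qed
  then have ex1: "\<exists>!p\<in>S. (F ^^ n) p = p"
    using vS iter by (intro Banach_fix[OF S, where c="1/2"]) (simp_all add: image_subset_iff, blast)
  then obtain p where p: "p \<in> S" "(F ^^ n) p = p" by blast
  then have uniq: "q = p" if "q \<in> S" "(F ^^ n) q = q" for q using ex1 that by blast
  have "(F ^^ n) (F p) = F p" using p(2) funpow_swap1[of F n p] by simp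
  then have "F p = p" using uniq inS p by blast
  then show ?thesis using Sc p(1) by blast
qed

section \<open>Time integration of Fourier modes\<close>

text \<open>Continuous functions on the time interval \<open>[0, 1]\<close> are represented by bounded continuous
  functions on the real line, evaluated at clamped times.\<close>

definition clamp01 :: "real \<Rightarrow> real" where "clamp01 t = max 0 (min t 1)"

lemma clamp01 [simp]: "0 \<le> clamp01 t" "clamp01 t \<le> 1" "clamp01 t \<in> {0..1}"
  and clamp01_id: "0 \<le> t \<Longrightarrow> t \<le> 1 \<Longrightarrow> clamp01 t = t"
  by (auto simp: clamp01_def)

lemma continuous_on_clamp01: "continuous_on A clamp01"
  unfolding clamp01_def by (intro continuous_intros)

text \<open>Variation of constants: the solution of \<open>u' = g - b * u\<close> on [0, 1] with
  \<open>u 0 = 0\<close>, continued by constants outside this interval.\<close>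

definition duhamel :: "real \<Rightarrow> (real \<Rightarrow> complex) \<Rightarrow> real \<Rightarrow> complex" where
  "duhamel b g t = integral {0..clamp01 t} (\<lambda>s. exp (- b * (clamp01 t - s)) *\<^sub>R g s)"

lemma continuous_on_duhamel:
  assumes "continuous_on UNIV g"
  shows "continuous_on A (duhamel b g)"
proof -
  have "continuous_on {0..1} (\<lambda>t. integral {0..t} (\<lambda>s. exp (b * s) *\<^sub>R g s))"
    by (intro indefinite_integral_continuous_1 integrable_continuous_real continuous_intros
        continuous_on_subset[OF assms]) auto
  then have "continuous_on A (\<lambda>t. integral {0..clamp01 t} (\<lambda>s. exp (b * s) *\<^sub>R g s))"
    by (rule continuous_on_compose2[OF _ continuous_on_clamp01]) auto
  then have "continuous_on A (\<lambda>t. exp (- b * clamp01 t) *\<^sub>R integral {0..clamp01 t} (\<lambda>s. exp (b * s) *\<^sub>R g s))"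
    by (intro continuous_intros continuous_on_clamp01)
  also have "(\<lambda>t. exp (- b * clamp01 t) *\<^sub>R integral {0..clamp01 t} (\<lambda>s. exp (b * s) *\<^sub>R g s)) = duhamel b g"
    unfolding duhamel_def fun_eq_iff integral_cmul[symmetric]
    by (simp add: mult_exp_exp algebra_simps)
  finally show ?thesis .
qed

lemma duhamel_integrable:
  fixes g :: "real \<Rightarrow> complex"
  assumes "continuous_on UNIV g"
  shows "(\<lambda>s. exp (- b * (t - s)) *\<^sub>R g s) integrable_on {0..t}"
  by (intro integrable_continuous_real continuous_intros continuous_on_subset[OF assms]) auto

text \<open>The first bound holds because the kernel is at most one on an interval of length at most
  one, the second because its integral is at most \<open>1 / b\<close>. The second one is the source
  of maximal regularity: with \<open>b = a * T * k ^ 4\<close> it absorbs four derivatives and the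
  factor \<open>T\<close>.\<close>

lemma norm_duhamel_le:
  assumes g: "continuous_on UNIV g" and M: "\<And>s. norm (g s) \<le> M" and b: "b \<ge> 0"
  shows "norm (duhamel b g t) \<le> M" "b > 0 \<Longrightarrow> norm (duhamel b g t) \<le> M / b"
proof -
  let ?t = "clamp01 t"
  have M0: "M \<ge> 0" using M[of 0] norm_ge_zero[of "g 0"] by linarith
  have le: "norm (exp (- b * (?t - s)) *\<^sub>R g s) \<le> exp (- b * (?t - s)) * M" for s
    using M[of s] by (simp add: mult_left_mono)
  have i: "(\<lambda>s. exp (- b * (?t - s)) * M) integrable_on {0..?t}"
    by (intro integrable_continuous_real continuous_intros)
  have "norm (duhamel b g t) \<le> integral {0..?t} (\<lambda>s. exp (- b * (?t - s)) * M)"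
    unfolding duhamel_def by (rule integral_norm_bound_integral[OF duhamel_integrable[OF g] i]) (rule le)
  note n = this
  have "integral {0..?t} (\<lambda>s. exp (- b * (?t - s)) * M) \<le> integral {0..?t} (\<lambda>s. M)"
  proof (rule integral_le[OF i])
    fix s assume "s \<in> {0..?t}"
    then have "exp (- b * (?t - s)) \<le> 1" using b by (simp add: mult_nonneg_nonneg)
    then show "exp (- b * (?t - s)) * M \<le> M" using M0 mult_right_mono[of _ 1 M] by fastforce
  qed auto
  also have "\<dots> \<le> M" using M0 mult_right_mono[of ?t 1 M] by simp
  finally show "norm (duhamel b g t) \<le> M" using n by linarith
  assume b: "b > 0"
  have "((\<lambda>s. exp (- b * (?t - s)) * M) has_integral (exp (- b * (?t - ?t)) * M / b - exp (- b * (?t - 0)) * M / b)) {0..?t}"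
    using b by (intro fundamental_theorem_of_calculus)
      (auto intro!: derivative_eq_intros simp: has_real_derivative_iff_has_vector_derivative[symmetric])
  then have "integral {0..?t} (\<lambda>s. exp (- b * (?t - s)) * M) = M / b - exp (- b * (?t - 0)) * M / b"
    unfolding integral_unique[OF \<open>(_ has_integral _) _\<close>] by simp
  also have "\<dots> \<le> M / b" using M0 b by simp
  finally show "norm (duhamel b g t) \<le> M / b" using n by linarith
qed

text \<open>The factor \<open>T\<close> comes from the rescaling of time, and
  \<open>(\<i> * k) ^ j\<close> is the symbol of the \<open>j\<close>-th space derivative.\<close>

definition Lop :: "real \<Rightarrow> real \<Rightarrow> nat \<Rightarrow> int \<Rightarrow> (real \<Rightarrow>\<^sub>C complex) \<Rightarrow> (real \<Rightarrow>\<^sub>C complex)" where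
  "Lop a T j k g = Bcontfun (\<lambda>t. of_real T * (\<i> * of_int k) ^ j * duhamel (a * T * of_int k ^ 4) (apply_bcontfun g) t)"

lemma apply_Lop:
  assumes "a > 0" "T \<ge> 0"
  shows "apply_bcontfun (Lop a T j k g) t = of_real T * (\<i> * of_int k) ^ j * duhamel (a * T * of_int k ^ 4) (apply_bcontfun g) t"
proof -
  let ?f = "\<lambda>t. of_real T * (\<i> * of_int k) ^ j * duhamel (a * T * of_int k ^ 4) (apply_bcontfun g) t"
  have "norm (?f t) \<le> norm (of_real T * (\<i> * of_int k) ^ j) * norm g" for t
    unfolding norm_mult[of _ "duhamel _ _ _"]
    by (intro mult_left_mono norm_duhamel_le norm_bounded continuous_on_apply_bcontfun) (use assms in auto)
  then have "?f \<in> bcontfun"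
    by (intro bcontfun_normI continuous_intros continuous_on_duhamel) auto
  then show ?thesis by (simp add: Lop_def Bcontfun_inverse)
qed

lemma linear_Lop:
  assumes "a > 0" "T \<ge> 0" shows "linear (Lop a T j k)"
proof (rule linearI; rule bcontfun_eqI)
  fix f g :: "real \<Rightarrow>\<^sub>C complex" and c t
  have "duhamel b (\<lambda>s. apply_bcontfun f s + apply_bcontfun g s) t
      = duhamel b (apply_bcontfun f) t + duhamel b (apply_bcontfun g) t" for b
    unfolding duhamel_def scaleR_right_distrib
    by (rule integral_add) (rule duhamel_integrable[OF continuous_on_apply_bcontfun])+
  then show "apply_bcontfun (Lop a T j k (f + g)) t = apply_bcontfun (Lop a T j k f + Lop a T j k g) t"
    by (simp add: apply_Lop[OF assms] distrib_left)
  have cm: "duhamel b (\<lambda>s. c *\<^sub>R apply_bcontfun g s) t = c *\<^sub>R duhamel b (apply_bcontfun g) t" for b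
    unfolding duhamel_def scaleR_left_commute[of _ c] by (rule integral_cmul)
  show "apply_bcontfun (Lop a T j k (c *\<^sub>R g)) t = apply_bcontfun (c *\<^sub>R Lop a T j k g) t"
    using cm by (simp add: apply_Lop[OF assms])
qed

lemma norm_Lop_le:
  assumes "a > 0" "T \<ge> 0"
  shows "norm (Lop a T j k g) \<le> T * \<bar>of_int k\<bar> ^ j * norm g"
    "k \<noteq> 0 \<Longrightarrow> norm (Lop a T j k g) \<le> \<bar>of_int k\<bar> ^ j / (a * of_int k ^ 4) * norm g"
proof -
  let ?b = "a * T * of_int k ^ 4"
  have n: "norm (apply_bcontfun (Lop a T j k g) t) = T * \<bar>of_int k\<bar> ^ j * norm (duhamel ?b (apply_bcontfun g) t)" for t
    using assms by (simp add: apply_Lop norm_mult norm_power)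
  have b: "?b \<ge> 0" using assms by simp
  show "norm (Lop a T j k g) \<le> T * \<bar>of_int k\<bar> ^ j * norm g"
    by (rule norm_bound, unfold n)
      (intro mult_left_mono norm_duhamel_le norm_bounded continuous_on_apply_bcontfun b, use assms in auto)
  assume k: "k \<noteq> 0"
  show "norm (Lop a T j k g) \<le> \<bar>of_int k\<bar> ^ j / (a * of_int k ^ 4) * norm g"
  proof (rule norm_bound, unfold n)
    fix t
    show "T * \<bar>real_of_int k\<bar> ^ j * norm (duhamel ?b (apply_bcontfun g) t) \<le> \<bar>real_of_int k\<bar> ^ j / (a * of_int k ^ 4) * norm g"
    proof (cases "T = 0")
      case False
      then have b: "?b > 0" using assms k by (simp add: zero_less_power_eq)
      have "T * \<bar>real_of_int k\<bar> ^ j * norm (duhamel ?b (apply_bcontfun g) t) \<le> T * \<bar>real_of_int k\<bar> ^ j * (norm g / ?b)"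
        by (intro mult_left_mono norm_duhamel_le norm_bounded continuous_on_apply_bcontfun) (use assms b in auto)
      also have "\<dots> = \<bar>real_of_int k\<bar> ^ j / (a * of_int k ^ 4) * norm g"
        using False assms k by (simp add: field_simps)
      finally show ?thesis .
    qed (use assms in auto)
  qed
qed

lemma norm_Lop4_le:
  assumes "a > 0" "T \<ge> 0"
  shows "norm (Lop a T 4 k g) \<le> norm g / a"
proof (cases "k = 0")
  case True
  then show ?thesis using norm_Lop_le(1)[OF assms, of 4 k g] assms by simp
next
  case False
  then show ?thesis using norm_Lop_le(2)[OF assms False, of 4 g] assms by simp
qed

text \<open>Modes with \<open>\<bar>k\<bar> \<le> K\<close> are small through the factor
  \<open>T\<close>; the others through the surplus power in \<open>\<bar>k\<bar> ^ j / (a * k ^ 4)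
  \<le> 1 / (a * \<bar>k\<bar>)\<close>, available because \<open>j < 4\<close>. This dictates
  \<open>K \<ge> 1 / (a * \<theta>)\<close> and then \<open>T0 = \<theta> / K ^ 3\<close>.\<close>

lemma norm_Lop_small:
  assumes a: "a > 0" and th: "\<theta> > 0"
  shows "\<exists>T0>0. \<forall>T. 0 \<le> T \<longrightarrow> T \<le> T0 \<longrightarrow> (\<forall>j<4. \<forall>k g. norm (Lop a T j k g) \<le> \<theta> * norm g)"
proof -
  define K where "K = max 1 (1 / (a * \<theta>))"
  have K: "K \<ge> 1" "1 / (a * \<theta>) \<le> K" by (auto simp: K_def)
  define T0 where "T0 = \<theta> / K ^ 3"
  have "norm (Lop a T j k g) \<le> \<theta> * norm g" if T: "0 \<le> T" "T \<le> T0" and j: "j < 4" for T j k g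
  proof (cases "\<bar>real_of_int k\<bar> \<le> K")
    case True
    have "\<bar>real_of_int k\<bar> ^ j \<le> K ^ j" using True by (intro power_mono) auto
    also have "\<dots> \<le> K ^ 3" using K j by (intro power_increasing) auto
    finally have "T * \<bar>real_of_int k\<bar> ^ j \<le> T0 * K ^ 3" using T K by (intro mult_mono) auto
    also have "\<dots> = \<theta>" using K by (simp add: T0_def)
    finally show ?thesis
      using norm_Lop_le(1)[OF a T(1), of j k g] mult_right_mono[of _ \<theta> "norm g"] by (meson norm_ge_zero order_trans)
  next
    case False
    then have k: "\<bar>real_of_int k\<bar> > K" "\<bar>real_of_int k\<bar> \<ge> 1" using K by linarith+
    then have k0: "k \<noteq> 0" by auto
    have "\<bar>real_of_int k\<bar> ^ j \<le> \<bar>real_of_int k\<bar> ^ 3" using k j by (intro power_increasing) auto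
    then have "\<bar>real_of_int k\<bar> ^ j / (a * of_int k ^ 4) \<le> \<bar>real_of_int k\<bar> ^ 3 / (a * of_int k ^ 4)"
      using a by (intro divide_right_mono) auto
    also have "\<dots> = 1 / (a * \<bar>real_of_int k\<bar>)"
    proof -
      have "real_of_int k ^ 4 = \<bar>real_of_int k\<bar> ^ 3 * \<bar>real_of_int k\<bar>"
        by (simp add: power_even_abs flip: power_Suc2)
      then show ?thesis using k0 a by (simp add: field_simps)
    qed
    also have "\<dots> \<le> \<theta>"
    proof -
      have "1 / (a * \<theta>) \<le> \<bar>real_of_int k\<bar>" using K k by linarith
      then show ?thesis using a th k by (simp add: field_simps)
    qed
    finally show ?thesis
      using norm_Lop_le(2)[OF a T(1) k0, of j g] mult_right_mono[of _ \<theta> "norm g"] by (meson norm_ge_zero order_trans)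
  qed
  moreover have "T0 > 0" using th K by (simp add: T0_def)
  ultimately show ?thesis by blast
qed

section \<open>Analytic dependence on parameters\<close>

lemma nhom_flux:
  assumes "nhom h"
  shows "h (flux2 k0 k1 p0 p1 p2 z) = flux2 (h k0) (h k1) (h p0) (h p1) (h p2) (h z)"
    "h (flux1 k0 k1 p0 p1 p2 z) = flux1 (h k0) (h k1) (h p0) (h p1) (h p2) (h z)"
    "h (rhs2 a k0 k1 l p0 p1 p2 z) = rhs2 a (h k0) (h k1) (h l) (h p0) (h p1) (h p2) (h z)"
    "h (rhs1 k0 k1 l p0 p1 p2 z) = rhs1 (h k0) (h k1) (h l) (h p0) (h p1) (h p2) (h z)"
    "h (rhs0 k0 k1 k2 l m p0 p1 p2 z) = rhs0 (h k0) (h k1) (h k2) (h l) (h m) (h p0) (h p1) (h p2) (h z)"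
  by (simp_all only: flux2_def flux1_def rhs2_def rhs1_def rhs0_def nhomD[OF assms])

definition map_state :: "('a \<Rightarrow> 'b) \<Rightarrow> 'a state \<Rightarrow> 'b state" where
  "map_state h = (\<lambda>(p0, p1, p2, z, r). (h p0, h p1, h p2, h z, h r))"

text \<open>The step is built from ring operations, scalar multiples and the \<open>L j\<close>, so
  a homomorphism that intertwines two families of operators intertwines the steps and maps fixed
  points to fixed points.\<close>

lemma nhom_step:
  assumes h: "nhom h" and L: "\<And>j x. h (L j x) = L' j (h x)"
  shows "map_state h (step a k0 k1 k2 zs qs L \<zeta> l m p)
    = step a (h k0) (h k1) (h k2) (h zs) (h qs) L' (\<lambda>j. h (\<zeta> j)) (h l) (h m) (map_state h p)"
  by (cases p) (simp only: map_state_def step_def Let_def split L nhomD(2-7)[OF h] nhom_flux[OF h])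

lemma wnorm_map_state_le:
  assumes h: "nhom h" and w: "w \<ge> 0"
  shows "wnorm w (map_state h p - map_state h q) \<le> wnorm w (p - q)"
proof -
  obtain p0 p1 p2 z r where p: "p = (p0, p1, p2, z, r)" by (cases p)
  obtain q0 q1 q2 z' r' where q: "q = (q0, q1, q2, z', r')" by (cases q)
  show ?thesis
    unfolding p q map_state_def wnorm_def diff_Pair split nhomD(6)[OF h, symmetric]
    by (intro add_mono mult_left_mono nhomD(4)[OF h]) (use w in auto)
qed

text \<open>The supremum over time sits inside the sum over the modes. In this space the operator \<open>L 4\<close> is bounded
  by \<open>1 / a\<close>, mode by mode: maximal regularity is trivial. In \<open>formal\<close> the coefficients are
  in addition absolutely convergent power series in the parameters \<open>l\<close> and \<open>m\<close>.\<close>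

type_synonym fourier = "(int, real \<Rightarrow>\<^sub>C complex) l1"
type_synonym coefficient = "(nat \<times> nat, real \<Rightarrow>\<^sub>C complex) l1"
type_synonym formal = "(int, coefficient) l1"

definition LA :: "real \<Rightarrow> real \<Rightarrow> nat \<Rightarrow> fourier \<Rightarrow> fourier" where
  "LA a T j = l1_diag (\<lambda>k. Lop a T j k)"

definition LF :: "real \<Rightarrow> real \<Rightarrow> nat \<Rightarrow> formal \<Rightarrow> formal" where
  "LF a T j = l1_diag (\<lambda>k. l1_diag (\<lambda>_. Lop a T j k))"

definition ev_weight :: "real \<Rightarrow> real \<Rightarrow> nat \<times> nat \<Rightarrow> (real \<Rightarrow>\<^sub>C complex)" where
  "ev_weight l m = (\<lambda>(i, j). of_real (l ^ i * m ^ j))"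

definition ev_coefficient :: "real \<Rightarrow> real \<Rightarrow> coefficient \<Rightarrow> (real \<Rightarrow>\<^sub>C complex)" where
  "ev_coefficient l m = l1_eval (\<lambda>x. x) (ev_weight l m)"

definition ev_formal :: "real \<Rightarrow> real \<Rightarrow> formal \<Rightarrow> fourier" where
  "ev_formal l m = l1_diag (\<lambda>_. ev_coefficient l m)"

definition emb_formal :: "fourier \<Rightarrow> formal" where
  "emb_formal = l1_diag (\<lambda>_. monom_l1 0)"

lemma Lop_bound_ex:
  assumes "a > 0" "T \<ge> 0" "j \<le> 4"
  shows "\<exists>B. \<forall>k g. norm (Lop a T j k g) \<le> B * norm g"
proof -
  have "norm (Lop a T j k g) \<le> (T + 1 / a) * norm g" for k g
  proof (cases "k = 0")
    case True
    have "norm (Lop a T j k g) \<le> T * norm g"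
      using norm_Lop_le(1)[OF assms(1,2), of j k g] True assms by (cases j) auto
    also have "\<dots> \<le> (T + 1 / a) * norm g" using assms by (intro mult_right_mono) auto
    finally show ?thesis .
  next
    case False
    then have k: "\<bar>real_of_int k\<bar> \<ge> 1" by linarith
    have "\<bar>real_of_int k\<bar> ^ j / (a * of_int k ^ 4) \<le> \<bar>real_of_int k\<bar> ^ 4 / (a * of_int k ^ 4)"
      using k assms by (intro divide_right_mono power_increasing) auto
    also have "\<dots> = 1 / a" using False by (simp add: power_even_abs)
    finally have "\<bar>real_of_int k\<bar> ^ j / (a * of_int k ^ 4) * norm g \<le> (T + 1 / a) * norm g"
      using assms by (intro mult_right_mono) auto
    then show ?thesis using norm_Lop_le(2)[OF assms(1,2) False, of j g] by linarith
  qed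
  then show ?thesis by blast
qed

lemma LA_props:
  assumes a: "a > 0" "T \<ge> 0" and j: "j \<le> 4"
  shows "linear (LA a T j)" "lcoeff (LA a T j F) k = Lop a T j k (lcoeff F k)"
    "linear (LF a T j)" "lcoeff (LF a T j G) k = l1_diag (\<lambda>_. Lop a T j k) (lcoeff G k)"
    "lcoeff (lcoeff (LF a T j G) k) i = Lop a T j k (lcoeff (lcoeff G k) i)"
proof -
  obtain B where B: "\<And>k g. norm (Lop a T j k g) \<le> B * norm g" using Lop_bound_ex[OF a j] by blast
  note lin = linear_Lop[OF a, of j]
  show "linear (LA a T j)" "lcoeff (LA a T j F) k = Lop a T j k (lcoeff F k)"
    unfolding LA_def by (rule l1_diag_bounds[OF lin B])+
  note d = l1_diag_bounds[where H="\<lambda>_. Lop a T j k" for k, OF lin B]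
  show "linear (LF a T j)" unfolding LF_def by (rule l1_diag_bounds(2)[OF d(2) d(3)])
  show e: "lcoeff (LF a T j G) k = l1_diag (\<lambda>_. Lop a T j k) (lcoeff G k)"
    unfolding LF_def by (rule l1_diag_bounds(1)[OF d(2) d(3)])
  show "lcoeff (lcoeff (LF a T j G) k) i = Lop a T j k (lcoeff (lcoeff G k) i)"
    unfolding e by (rule d(1))
qed

lemma LA_norm:
  assumes a: "a > 0" "T \<ge> 0" and B: "\<And>k g. norm (Lop a T j k g) \<le> B * norm g"
  shows "norm (LA a T j F) \<le> B * norm F" "norm (LF a T j G) \<le> B * norm G"
proof -
  note lin = linear_Lop[OF a, of j]
  show "norm (LA a T j F) \<le> B * norm F" unfolding LA_def by (rule l1_diag_bounds(3)[OF lin B])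
  note d = l1_diag_bounds[where H="\<lambda>_. Lop a T j k" for k, OF lin B]
  show "norm (LF a T j G) \<le> B * norm G" unfolding LF_def by (rule l1_diag_bounds(3)[OF d(2) d(3)])
qed

lemma nhom_id: "nhom (\<lambda>x :: 'a::real_normed_algebra_1. x)"
  by (simp add: nhom_def linear_id[unfolded id_def])

lemma norm_ev_weight_le: "\<bar>l\<bar> \<le> 1 \<Longrightarrow> \<bar>m\<bar> \<le> 1 \<Longrightarrow> norm (ev_weight l m i) \<le> 1"
proof (cases i)
  case (Pair a b)
  assume "\<bar>l\<bar> \<le> 1" "\<bar>m\<bar> \<le> 1"
  then have "\<bar>l\<bar> ^ a * \<bar>m\<bar> ^ b \<le> 1"
    using mult_mono[OF power_le_one[of "\<bar>l\<bar>" a] power_le_one[of "\<bar>m\<bar>" b]] by simp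
  then show ?thesis by (simp add: Pair ev_weight_def abs_mult power_abs del: of_real_mult of_real_power)
qed

lemma nhom_ev_coefficient:
  assumes "\<bar>l\<bar> \<le> 1" "\<bar>m\<bar> \<le> 1"
  shows "nhom (ev_coefficient l m)"
  unfolding ev_coefficient_def
proof (rule nhom_l1_eval[OF nhom_id])
  show "norm (ev_weight l m i) \<le> 1" for i by (rule norm_ev_weight_le[OF assms])
  show "ev_weight l m 0 = 1" by (simp add: ev_weight_def zero_prod_def)
  show "ev_weight l m (i + j) = ev_weight l m i * ev_weight l m j" for i j
    by (cases i; cases j) (simp add: ev_weight_def power_add mult_ac)
qed

text \<open>The weights \<open>l ^ i * m ^ j\<close> are real and constant in time, so the
  real-linear operator \<open>Lop\<close> passes through the evaluation of a monomial; density
  extends this to series.\<close>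

lemma ev_coefficient_Lop:
  assumes a: "a > 0" "T \<ge> 0" and j: "j \<le> 4" and lm: "\<bar>l\<bar> \<le> 1" "\<bar>m\<bar> \<le> 1"
  shows "ev_coefficient l m (l1_diag (\<lambda>_. Lop a T j k) F) = Lop a T j k (ev_coefficient l m F)"
proof -
  obtain B where B: "\<And>k g. norm (Lop a T j k g) \<le> B * norm g" using Lop_bound_ex[OF a j] by blast
  note lin = linear_Lop[OF a, of j]
  have bL: "bounded_linear (Lop a T j k)"
    using lin[of k] B[of k] by (intro bounded_linear_intro[where K=B]) (auto simp: linear_add linear_scale mult.commute)
  note d = l1_diag_bounds[where H="\<lambda>_. Lop a T j k", OF lin B]
  have bD: "bounded_linear (l1_diag (\<lambda>_ :: nat \<times> nat. Lop a T j k))"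
    by (intro bounded_linear_intro[where K=B])
      (auto simp: linear_add[OF d(2)] linear_scale[OF d(2)] mult.commute[of _ B] d(3))
  have bE: "bounded_linear (ev_coefficient l m)" by (rule nhomD(9)[OF nhom_ev_coefficient[OF lm]])
  have mon: "l1_diag (\<lambda>_ :: nat \<times> nat. Lop a T j k) (monom_l1 i c) = monom_l1 i (Lop a T j k c)" for i c
    by (rule l1_eqI) (simp add: d(1) linear_0[OF lin])
  have evm: "ev_coefficient l m (monom_l1 (i, i') c) = (l ^ i * m ^ i') *\<^sub>R c" for i i' c
    unfolding ev_coefficient_def by (subst l1_eval_monom)
      (auto simp: ev_weight_def linear_id[unfolded id_def] mult.commute[of c] scaleR_conv_of_real)
  show ?thesis
    by (rule bounded_linear_eq_l1[OF bounded_linear_compose[OF bE bD] bounded_linear_compose[OF bL bE]])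
      (auto simp: mon evm linear_scale[OF lin])
qed

lemma nhom_ev_formal:
  assumes "\<bar>l\<bar> \<le> 1" "\<bar>m\<bar> \<le> 1"
  shows "nhom (ev_formal l m)" "lcoeff (ev_formal l m F) k = ev_coefficient l m (lcoeff F k)"
  unfolding ev_formal_def by (rule nhom_l1_diag[OF nhom_ev_coefficient[OF assms]])+

lemma nhom_emb_formal: "nhom emb_formal" "lcoeff (emb_formal F) k = monom_l1 0 (lcoeff F k)"
  unfolding emb_formal_def by (rule nhom_l1_diag[OF nhom_monom_0])+

lemma ev_formal_LF:
  assumes a: "a > 0" "T \<ge> 0" and j: "j \<le> 4" and lm: "\<bar>l\<bar> \<le> 1" "\<bar>m\<bar> \<le> 1"
  shows "ev_formal l m (LF a T j F) = LA a T j (ev_formal l m F)"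
  by (rule l1_eqI) (simp add: nhom_ev_formal[OF lm] LA_props[OF a j] ev_coefficient_Lop[OF a j lm])

lemma emb_formal_LA:
  assumes a: "a > 0" "T \<ge> 0" and j: "j \<le> 4"
  shows "emb_formal (LA a T j F) = LF a T j (emb_formal F)"
proof (intro l1_eqI)
  fix k i
  show "lcoeff (lcoeff (emb_formal (LA a T j F)) k) i = lcoeff (lcoeff (LF a T j (emb_formal F)) k) i"
    using linear_0[OF linear_Lop[OF a, of j k]] by (simp add: nhom_emb_formal LA_props(2,5)[OF a j])
qed

lemma ev_emb_formal:
  assumes "\<bar>l\<bar> \<le> 1" "\<bar>m\<bar> \<le> 1" shows "ev_formal l m (emb_formal F) = F"
  by (rule l1_eqI) (simp add: nhom_ev_formal[OF assms] nhom_emb_formal ev_coefficient_def ev_weight_def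
      linear_id[unfolded id_def] zero_prod_def)

text \<open>Existence and uniqueness are taken from different algebras. In \<open>formal\<close>,
  with the parameters as indeterminates, the contraction yields one fixed point \<open>Q\<close>.
  Its evaluations are fixed points in \<open>fourier\<close> near the centre, one for each pair of
  parameter values, and there the contraction property identifies them with \<open>P\<close>. The
  family \<open>P\<close> is given in advance, with no regularity in \<open>l\<close> and
  \<open>m\<close>.\<close>

theorem analytic_dependence:
  fixes k0 k1 k2 zs qs c0 c1 c2 cr :: fourier
  assumes a: "a > 0" and lead: "k0 * k0 * (c0 * c0 * zs * zs * (k0 * k0)) = a *\<^sub>R 1"
    and inv: "zs * (c0 + (1/4) *\<^sub>R (k0 * c1 * (k0 * c1))) = 1" and root: "qs * cr = 1"
  shows "\<exists>\<delta>>0. \<exists>T0>0. \<forall>T \<zeta> P. 0 < T \<longrightarrow> T \<le> T0 \<longrightarrow>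
    (\<forall>l m. \<bar>l\<bar> \<le> 1 \<longrightarrow> \<bar>m\<bar> \<le> 1 \<longrightarrow> norm (P l m - (c0, c1, c2, zs, cr)) \<le> \<delta>) \<longrightarrow>
    (\<forall>l m. \<bar>l\<bar> \<le> 1 \<longrightarrow> \<bar>m\<bar> \<le> 1 \<longrightarrow>
      step a k0 k1 k2 zs qs (LA a T) \<zeta> (l *\<^sub>R 1) (m *\<^sub>R 1) (P l m) = P l m) \<longrightarrow>
    (\<exists>\<rho>>0. \<rho> \<le> 1 \<and> (\<exists>Q. \<forall>l m. \<bar>l\<bar> \<le> 1 \<longrightarrow> \<bar>m\<bar> \<le> 1 \<longrightarrow> P (\<rho> * l) (\<rho> * m) = map_state (ev_formal l m) Q))"
proof -
  let ?e = emb_formal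
  let ?c = "(c0, c1, c2, zs, cr)"
  note e = nhom_emb_formal(1) and eD = nhomD[OF nhom_emb_formal(1)]
  have ec: "map_state ?e ?c = (?e c0, ?e c1, ?e c2, ?e zs, ?e cr)" by (simp add: map_state_def)
  obtain w1 \<delta>1 \<theta>1 where 1: "w1 \<ge> 1" "\<delta>1 > 0" "\<theta>1 > 0" "\<theta>1 \<le> 1"
    and con1: "step_contracts a k0 k1 k2 zs qs ?c w1 \<delta>1 \<theta>1"
    using step_contraction[OF a lead inv root, where ?k1.0=k1 and ?k2.0=k2 and ?c2.0=c2] by blast
  have lead': "?e k0 * ?e k0 * (?e c0 * ?e c0 * ?e zs * ?e zs * (?e k0 * ?e k0)) = a *\<^sub>R 1"
    using arg_cong[OF lead, of ?e] by (simp only: eD)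
  have inv': "?e zs * (?e c0 + (1/4) *\<^sub>R (?e k0 * ?e c1 * (?e k0 * ?e c1))) = 1"
    using arg_cong[OF inv, of ?e] by (simp only: eD)
  have root': "?e qs * ?e cr = 1" using arg_cong[OF root, of ?e] by (simp only: eD)
  obtain w2 \<delta>2 \<theta>2 where 2: "w2 \<ge> 1" "\<delta>2 > 0" "\<theta>2 > 0" "\<theta>2 \<le> 1"
    and con2: "step_contracts a (?e k0) (?e k1) (?e k2) (?e zs) (?e qs) (map_state ?e ?c) w2 \<delta>2 \<theta>2"
    using step_contraction[OF a lead' inv' root', where ?k1.0="?e k1" and ?k2.0="?e k2" and ?c2.0="?e c2"]
    unfolding ec by blast
  \<comment> \<open>The radius of the ball around the embedded centre: the contraction in
    \<open>formal\<close> holds on it, and evaluation maps it into the \<open>\<delta>1\<close>-ball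
    of \<open>fourier\<close>. The passage from \<open>wnorm w2\<close> through the plain norm to
    \<open>wnorm w1\<close> costs the factor \<open>5 * w1\<^sup>2\<close>.\<close>
  define r where "r = min \<delta>2 (\<delta>1 / (5 * w1\<^sup>2))"
  have r: "r > 0" "r \<le> \<delta>2" "5 * w1\<^sup>2 * r \<le> \<delta>1"
  proof -
    show "r > 0" "r \<le> \<delta>2" using 1 2 by (auto simp: r_def)
    have "5 * w1\<^sup>2 * r \<le> 5 * w1\<^sup>2 * (\<delta>1 / (5 * w1\<^sup>2))" by (intro mult_left_mono) (auto simp: r_def)
    then show "5 * w1\<^sup>2 * r \<le> \<delta>1" using 1 by simp
  qed
  \<comment> \<open>The first entry puts \<open>P\<close> into the ball of uniqueness. The second
    puts the embedded \<open>P 0 0\<close> within \<open>r / 2\<close> of the centre, as required of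
    the starting point of the iteration.\<close>
  define \<delta> where "\<delta> = min (\<delta>1 / (5 * w1\<^sup>2)) (r / (10 * w2\<^sup>2))"
  have \<delta>: "\<delta> > 0" "5 * w1\<^sup>2 * \<delta> \<le> \<delta>1" "5 * w2\<^sup>2 * \<delta> \<le> r / 2"
  proof -
    show "\<delta> > 0" using 1 2 r by (auto simp: \<delta>_def)
    have "5 * w1\<^sup>2 * \<delta> \<le> 5 * w1\<^sup>2 * (\<delta>1 / (5 * w1\<^sup>2))" "5 * w2\<^sup>2 * \<delta> \<le> 5 * w2\<^sup>2 * (r / (10 * w2\<^sup>2))"
      by (intro mult_left_mono; simp add: \<delta>_def)+
    then show "5 * w1\<^sup>2 * \<delta> \<le> \<delta>1" "5 * w2\<^sup>2 * \<delta> \<le> r / 2" using 1 2 by simp_all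
  qed
  define \<theta> where "\<theta> = min \<theta>1 \<theta>2"
  have \<theta>: "\<theta> > 0" "\<theta> \<le> \<theta>1" "\<theta> \<le> \<theta>2" "\<theta> \<le> 1" using 1 2 by (auto simp: \<theta>_def)
  obtain T0 where T0: "T0 > 0" "\<forall>T. 0 \<le> T \<longrightarrow> T \<le> T0 \<longrightarrow> (\<forall>j<4. \<forall>k g. norm (Lop a T j k g) \<le> \<theta> * norm g)"
    using norm_Lop_small[OF a \<theta>(1)] by blast
  have main: "\<exists>\<rho>>0. \<rho> \<le> 1 \<and> (\<exists>Q. \<forall>l m. \<bar>l\<bar> \<le> 1 \<longrightarrow> \<bar>m\<bar> \<le> 1 \<longrightarrow> P (\<rho> * l) (\<rho> * m) = map_state (ev_formal l m) Q)"
    if T: "0 < T" "T \<le> T0"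
      and near: "\<forall>l m. \<bar>l\<bar> \<le> 1 \<longrightarrow> \<bar>m\<bar> \<le> 1 \<longrightarrow> norm (P l m - ?c) \<le> \<delta>"
      and fp: "\<forall>l m. \<bar>l\<bar> \<le> 1 \<longrightarrow> \<bar>m\<bar> \<le> 1 \<longrightarrow>
        step a k0 k1 k2 zs qs (LA a T) \<zeta> (l *\<^sub>R 1) (m *\<^sub>R 1) (P l m) = P l m"
    for T \<zeta> and P :: "real \<Rightarrow> real \<Rightarrow> fourier state"
  proof -
    note near = near[rule_format] and fixp = fp[rule_format]
    have aT: "a > 0" "T \<ge> 0" using a T by auto
    have Ls: "norm (Lop a T j k g) \<le> \<theta> * norm g" if "j < 4" for j k g using T0 T that by simp
    have L4: "norm (Lop a T 4 k g) \<le> (1 / a) * norm g" for k g using norm_Lop4_le[OF aT, of k g] by simp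
    have linA: "\<forall>j\<le>4. linear (LA a T j)" and linF: "\<forall>j\<le>4. linear (LF a T j)" using LA_props[OF aT] by auto
    have nA: "\<forall>j<4. \<forall>x. norm (LA a T j x) \<le> \<theta>1 * norm x" and nF: "\<forall>j<4. \<forall>x. norm (LF a T j x) \<le> \<theta>2 * norm x"
      using LA_norm[OF aT, of _ \<theta>1] LA_norm[OF aT, of _ \<theta>2] Ls mult_right_mono[OF \<theta>(2)] mult_right_mono[OF \<theta>(3)]
      by (meson norm_ge_zero order_trans)+
    have nA4: "\<forall>x. norm (LA a T 4 x) \<le> norm x / a" and nF4: "\<forall>x. norm (LF a T 4 x) \<le> norm x / a"
      using LA_norm[OF aT L4] by simp_all
    \<comment> \<open>the parameters as formal variables; a fixed point there specializes to one for all values\<close>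
    define X1 :: formal where "X1 = monom_l1 0 (monom_l1 (1, 0) 1)"
    define X2 :: formal where "X2 = monom_l1 0 (monom_l1 (0, 1) 1)"
    have X: "norm X1 = 1" "norm X2 = 1" by (simp_all add: X1_def X2_def)
    let ?S = "\<lambda>\<rho>. step a (?e k0) (?e k1) (?e k2) (?e zs) (?e qs) (LF a T) (\<lambda>j. ?e (\<zeta> j)) (\<rho> *\<^sub>R X1) (\<rho> *\<^sub>R X2)"
    define v where "v = map_state ?e (P 0 0)"
    have S0: "?S 0 v = v"
    proof -
      \<comment> \<open>The intertwining rule speaks of every \<open>j\<close>, while the embedding
        is known to commute with the operators for \<open>j \<le> 4\<close>. Beyond that a
        conjugated operator serves as filler; \<open>step\<close> never applies it.\<close>
      have "map_state ?e (step a k0 k1 k2 zs qs (LA a T) \<zeta> 0 0 (P 0 0)) = step a (?e k0) (?e k1) (?e k2) (?e zs) (?e qs) (\<lambda>j. if j \<le> 4 then LF a T j else ?e \<circ> LA a T j \<circ> inv ?e) (\<lambda>j. ?e (\<zeta> j)) (?e 0) (?e 0) (map_state ?e (P 0 0))"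
      proof (rule nhom_step[OF e])
        have "inj ?e" using ev_emb_formal[of 0 0] by (metis abs_zero injI zero_le_one)
        then show "?e (LA a T j x) = (if j \<le> 4 then LF a T j else ?e \<circ> LA a T j \<circ> inv ?e) (?e x)" for j x
          by (simp add: emb_formal_LA[OF aT])
      qed
      also have "\<dots> = ?S 0 v" by (cases "P 0 0") (simp add: step_def Let_def v_def map_state_def eD(8))
      finally show ?thesis using fixp[of 0 0] by (simp add: v_def)
    qed
    have vc: "wnorm w2 (v - map_state ?e ?c) \<le> r / 2"
    proof -
      have "wnorm w2 (v - map_state ?e ?c) \<le> wnorm w2 (P 0 0 - ?c)"
        unfolding v_def by (rule wnorm_map_state_le[OF e]) (use 2 in simp)
      also have "\<dots> \<le> 5 * w2\<^sup>2 * norm (P 0 0 - ?c)" by (rule wnorm_le_norm[OF 2(1)])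
      also have "\<dots> \<le> 5 * w2\<^sup>2 * \<delta>" using near[of 0 0] by (intro mult_left_mono) auto
      finally show ?thesis using \<delta>(3) by linarith
    qed
    \<comment> \<open>At \<open>\<rho> = 0\<close> the embedded \<open>P 0 0\<close> is an exact
      fixed point, so by continuity its defect is at most \<open>r / 4\<close> for some positive
      \<open>\<rho>\<close>. The indeterminates enter scaled by \<open>\<rho>\<close>, which is why
      the conclusion concerns \<open>P (\<rho> * l) (\<rho> * m)\<close>.\<close>
    have "\<exists>\<rho>>0. \<rho> \<le> \<theta> \<and> wnorm w2 (?S \<rho> v - v) \<le> r / 4"
    proof -
      obtain v0 v1 v2 vz vr where v: "v = (v0, v1, v2, vz, vr)" by (cases v)
      have bL: "bounded_linear (LF a T j)" if "j \<le> 4" for j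
      proof -
        obtain B where "\<And>k g. norm (Lop a T j k g) \<le> B * norm g" using Lop_bound_ex[OF aT \<open>j \<le> 4\<close>] by blast
        then show ?thesis using linF that LA_norm(2)[OF aT]
          by (intro bounded_linear_intro[where K=B]) (auto simp: linear_add linear_scale mult.commute[of _ B])
      qed
      have "continuous_on UNIV (\<lambda>\<rho>. wnorm w2 (?S \<rho> v - v))"
        unfolding v step_def Let_def split wnorm_def diff_Pair rhs2_def rhs1_def rhs0_def
        by (intro continuous_intros bounded_linear.continuous_on[OF bL]) simp_all
      then have "isCont (\<lambda>\<rho>. wnorm w2 (?S \<rho> v - v)) 0" by (simp add: continuous_on_eq_continuous_at)
      moreover have "wnorm w2 (?S 0 v - v) = 0" unfolding S0 by (simp add: wnorm_def zero_prod_def)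
      ultimately have "((\<lambda>\<rho>. wnorm w2 (?S \<rho> v - v)) \<longlongrightarrow> 0) (at 0)" by (simp add: isCont_def)
      then have "\<forall>\<^sub>F \<rho> in at 0. wnorm w2 (?S \<rho> v - v) < r / 4" by (rule order_tendstoD) (use r in simp)
      then obtain d where d: "d > 0" "\<And>\<rho>. \<rho> \<noteq> 0 \<Longrightarrow> dist \<rho> 0 < d \<Longrightarrow> wnorm w2 (?S \<rho> v - v) < r / 4"
        unfolding eventually_at by blast
      have "wnorm w2 (?S (min \<theta> (d / 2)) v - v) < r / 4"
        by (rule d(2)) (use d(1) \<theta>(1) in \<open>auto simp: dist_real_def\<close>)
      then show ?thesis using d(1) \<theta>(1) by (intro exI[of _ "min \<theta> (d / 2)"]) auto
    qed
    then obtain \<rho> where \<rho>: "\<rho> > 0" "\<rho> \<le> \<theta>" "wnorm w2 (?S \<rho> v - v) \<le> r / 4" by blast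
    have nX: "norm (\<rho> *\<^sub>R X1) \<le> \<theta>2" "norm (\<rho> *\<^sub>R X2) \<le> \<theta>2" using \<rho> X \<theta> by auto
    have "\<exists>Q. wnorm w2 (Q - map_state ?e ?c) \<le> r \<and> ?S \<rho> Q = Q"
    proof (rule wnorm_fixed_point[where F="?S \<rho>" and v=v, OF 2(1) _ _ vc \<rho>(3)])
      fix p q
      assume "wnorm w2 (p - map_state ?e ?c) \<le> r" "wnorm w2 (q - map_state ?e ?c) \<le> r"
      then show "wnorm w2 (?S \<rho> p - ?S \<rho> q) \<le> wnorm w2 (p - q) / 2"
        using con2[unfolded step_contracts_def, rule_format, OF _ _ _ nX, of "LF a T" p q "\<lambda>j. ?e (\<zeta> j)"] linF nF nF4 r(2) by simp
    qed (use r in simp)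
    then obtain Q where Q: "wnorm w2 (Q - map_state ?e ?c) \<le> r" "?S \<rho> Q = Q" by blast
    have "P (\<rho> * l) (\<rho> * m) = map_state (ev_formal l m) Q" if lm: "\<bar>l\<bar> \<le> 1" "\<bar>m\<bar> \<le> 1" for l m
    proof -
      let ?h = "ev_formal l m"
      note h = nhom_ev_formal(1)[OF lm]
      have mon: "ev_coefficient l m (monom_l1 (i, i') 1) = (l ^ i * m ^ i') *\<^sub>R 1" for i i'
        unfolding ev_coefficient_def by (subst l1_eval_monom)
          (auto simp: ev_weight_def linear_id[unfolded id_def] scaleR_conv_of_real)
      have hX: "?h X1 = l *\<^sub>R 1" "?h X2 = m *\<^sub>R 1"
        by (rule l1_eqI; simp add: X1_def X2_def nhom_ev_formal[OF lm] mon one_l1_def nhomD(8)[OF nhom_ev_coefficient[OF lm]])+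
      have hc: "map_state ?h (map_state ?e ?c) = ?c" by (simp add: map_state_def ev_emb_formal[OF lm])
      have hQ: "map_state ?h Q = step a k0 k1 k2 zs qs (LA a T) \<zeta> ((\<rho> * l) *\<^sub>R 1) ((\<rho> * m) *\<^sub>R 1) (map_state ?h Q)"
      proof -
        \<comment> \<open>Cut off above \<open>j = 4\<close>, so that evaluation intertwines the
          operators for every \<open>j\<close>.\<close>
        define L' where "L' = (\<lambda>j. if j \<le> 4 then LF a T j else (\<lambda>_. 0))"
        define L'' where "L'' = (\<lambda>j. if j \<le> 4 then LA a T j else (\<lambda>_. 0))"
        have "?S \<rho> Q = step a (?e k0) (?e k1) (?e k2) (?e zs) (?e qs) L' (\<lambda>j. ?e (\<zeta> j)) (\<rho> *\<^sub>R X1) (\<rho> *\<^sub>R X2) Q"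
          by (cases Q) (simp add: step_def L'_def)
        then have "map_state ?h Q = map_state ?h (step a (?e k0) (?e k1) (?e k2) (?e zs) (?e qs) L' (\<lambda>j. ?e (\<zeta> j)) (\<rho> *\<^sub>R X1) (\<rho> *\<^sub>R X2) Q)"
          using Q(2) by simp
        also have "\<dots> = step a (?h (?e k0)) (?h (?e k1)) (?h (?e k2)) (?h (?e zs)) (?h (?e qs)) L'' (\<lambda>j. ?h (?e (\<zeta> j))) (?h (\<rho> *\<^sub>R X1)) (?h (\<rho> *\<^sub>R X2)) (map_state ?h Q)"
          by (rule nhom_step[OF h]) (simp add: L'_def L''_def ev_formal_LF[OF aT _ lm] nhomD(8)[OF h])
        also have "\<dots> = step a k0 k1 k2 zs qs (LA a T) \<zeta> ((\<rho> * l) *\<^sub>R 1) ((\<rho> * m) *\<^sub>R 1) (map_state ?h Q)"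
          by (cases "map_state ?h Q") (simp add: step_def L''_def ev_emb_formal[OF lm] nhomD(7)[OF h] hX)
        finally show ?thesis .
      qed
      have \<rho>lm: "\<bar>\<rho> * l\<bar> \<le> \<rho>" "\<bar>\<rho> * m\<bar> \<le> \<rho>" using lm \<rho> by (simp_all add: abs_mult mult_left_le)
      then have \<rho>1: "\<bar>\<rho> * l\<bar> \<le> 1" "\<bar>\<rho> * m\<bar> \<le> 1" using \<rho> \<theta> by linarith+
      have n1: "norm ((\<rho> * l) *\<^sub>R (1 :: fourier)) \<le> \<theta>1" "norm ((\<rho> * m) *\<^sub>R (1 :: fourier)) \<le> \<theta>1"
        using \<rho>lm \<rho> \<theta> by simp_all
      have b1: "wnorm w1 (map_state ?h Q - ?c) \<le> \<delta>1"
      proof -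
        have "wnorm w1 (map_state ?h Q - ?c) \<le> wnorm w1 (Q - map_state ?e ?c)"
          using wnorm_map_state_le[OF h, of w1 Q "map_state ?e ?c"] 1 unfolding hc by simp
        also have "\<dots> \<le> 5 * w1\<^sup>2 * norm (Q - map_state ?e ?c)" by (rule wnorm_le_norm[OF 1(1)])
        also have "\<dots> \<le> 5 * w1\<^sup>2 * r" using order_trans[OF norm_le_wnorm[OF 2(1)] Q(1)] by (intro mult_left_mono) auto
        finally show ?thesis using r(3) by linarith
      qed
      have b2: "wnorm w1 (P (\<rho> * l) (\<rho> * m) - ?c) \<le> \<delta>1"
      proof -
        have "wnorm w1 (P (\<rho> * l) (\<rho> * m) - ?c) \<le> 5 * w1\<^sup>2 * norm (P (\<rho> * l) (\<rho> * m) - ?c)" by (rule wnorm_le_norm[OF 1(1)])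
        also have "\<dots> \<le> 5 * w1\<^sup>2 * \<delta>" using near[OF \<rho>1] by (intro mult_left_mono) auto
        finally show ?thesis using \<delta>(2) by linarith
      qed
      \<comment> \<open>Both states are fixed by the same contraction, so their distance is at most
        half of itself.\<close>
      have "wnorm w1 (P (\<rho> * l) (\<rho> * m) - map_state ?h Q) \<le> wnorm w1 (P (\<rho> * l) (\<rho> * m) - map_state ?h Q) / 2"
        using con1[unfolded step_contracts_def, rule_format, OF _ _ _ n1 b2 b1, of "LA a T" \<zeta>] linA nA nA4 unfolding fixp[OF \<rho>1] hQ[symmetric] by simp
      then have "norm (P (\<rho> * l) (\<rho> * m) - map_state ?h Q) \<le> 0"
        using norm_le_wnorm[OF 1(1), of "P (\<rho> * l) (\<rho> * m) - map_state ?h Q"] by linarith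
      then show ?thesis by simp
    qed
    then show ?thesis
      using \<rho> \<theta> by (intro exI[of _ \<rho>] conjI exI[of _ Q]) auto
  qed
  show ?thesis
    by (rule exI[of _ \<delta>], rule conjI[OF \<delta>(1)], rule exI[of _ T0], rule conjI[OF T0(1)], intro allI impI, rule main)
qed

section \<open>Fourier series\<close>

definition fourier_coeff :: "(real \<Rightarrow> complex) \<Rightarrow> int \<Rightarrow> complex" where
  "fourier_coeff g k = integral {-pi..pi} (\<lambda>y. g y * cis (- (of_int k * y))) / (2 * pi)"

lemma cont_cis [continuous_intros]: "continuous_on A f \<Longrightarrow> continuous_on A (\<lambda>x. cis (f x))"
  unfolding cis_conv_exp by (intro continuous_intros)

lemma has_vector_derivative_cis: "((\<lambda>y. cis (c * y)) has_vector_derivative (\<i> * of_real c * cis (c * y))) (at y within S)"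
proof -
  have "((\<lambda>y. exp (y *\<^sub>R (\<i> * of_real c))) has_vector_derivative exp (y *\<^sub>R (\<i> * of_real c)) * (\<i> * of_real c)) (at y within S)"
    by (rule exp_scaleR_has_vector_derivative_right)
  then show ?thesis by (simp add: cis_conv_exp scaleR_conv_of_real mult_ac)
qed

lemma cis_2pi_period: "cis (of_int k * (y + 2 * pi)) = cis (of_int k * y)"
proof -
  have "cis (of_int k * (y + 2 * pi)) = cis (of_int k * y) * cis (2 * pi * of_int k)"
    by (simp add: cis_mult algebra_simps)
  then show ?thesis by (simp add: cis_multiple_2pi)
qed

lemma fourier_coeff_integrable:
  assumes "continuous_on {-pi..pi} g"
  shows "(\<lambda>y. g y * cis (c * y)) integrable_on {-pi..pi}" "(\<lambda>y. g y * cis (- (c * y))) integrable_on {-pi..pi}"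
  by (intro integrable_continuous_real continuous_intros assms)+

lemma integral_cis:
  "integral {-pi..pi} (\<lambda>y. cis (of_int k * y)) = (if k = 0 then 2 * pi else 0)"
proof (cases "k = 0")
  case False
  have "((\<lambda>y. cis (of_int k * y)) has_integral (cis (of_int k * pi) / (\<i> * of_int k) - cis (of_int k * (- pi)) / (\<i> * of_int k))) {-pi..pi}"
  proof (rule fundamental_theorem_of_calculus)
    fix y
    show "((\<lambda>y. cis (of_int k * y) / (\<i> * of_int k)) has_vector_derivative cis (of_int k * y)) (at y within {-pi..pi})"
      using bounded_linear.has_vector_derivative[OF bounded_linear_mult_left[of "1 / (\<i> * of_int k)"] has_vector_derivative_cis[of "of_int k" y "{-pi..pi}"]] False
      by (simp add: field_simps)
  qed simp
  moreover have "cis (of_int k * pi) = cis (of_int k * (- pi))" using cis_2pi_period[of k "- pi"] by simp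
  ultimately show ?thesis using False by (simp add: integral_unique)
qed (simp add: scaleR_conv_of_real)

lemma norm_fc_le:
  assumes g: "continuous_on {-pi..pi} g" and M: "\<And>y. y \<in> {-pi..pi} \<Longrightarrow> norm (g y) \<le> M"
  shows "norm (fourier_coeff g k) \<le> M"
proof -
  have "norm (integral {-pi..pi} (\<lambda>y. g y * cis (- (of_int k * y)))) \<le> integral {-pi..pi} (\<lambda>y. M)"
    by (rule integral_norm_bound_integral[OF fourier_coeff_integrable(2)[OF g]]) (auto simp: norm_mult M)
  then have "norm (integral {-pi..pi} (\<lambda>y. g y * cis (- (of_int k * y)))) \<le> 2 * pi * M" by simp
  then show ?thesis by (simp add: fourier_coeff_def norm_divide field_simps)
qed

lemma fourier_coeff_add: "continuous_on {-pi..pi} g \<Longrightarrow> continuous_on {-pi..pi} h \<Longrightarrow> fourier_coeff (\<lambda>y. g y + h y) k = fourier_coeff g k + fourier_coeff h k"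
  by (simp add: fourier_coeff_def distrib_right integral_add fourier_coeff_integrable add_divide_distrib)

lemma fourier_coeff_cmult: "fourier_coeff (\<lambda>y. c * g y) k = c * fourier_coeff g k"
  by (simp add: fourier_coeff_def mult.assoc)

lemma fourier_coeff_diff:
  assumes "continuous_on {-pi..pi} g" "continuous_on {-pi..pi} h"
  shows "fourier_coeff (\<lambda>y. g y - h y) k = fourier_coeff g k - fourier_coeff h k"
  using fourier_coeff_add[OF assms(1), of "\<lambda>y. (-1) * h y" k] fourier_coeff_cmult[of "-1" h k] assms(2)
  by (auto intro!: continuous_intros)

lemma fourier_coeff_deriv:
  assumes g: "\<And>y. (g has_vector_derivative g' y) (at y)" and g': "continuous_on UNIV g'"
    and per: "g pi = g (- pi)"
  shows "fourier_coeff g' k = \<i> * of_int k * fourier_coeff g k"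
proof -
  have cg: "continuous_on UNIV g"
    using g by (meson continuous_at_imp_continuous_on has_vector_derivative_continuous)
  have "((\<lambda>y. g' y * cis (- of_int k * y) + g y * (\<i> * of_real (- of_int k) * cis (- of_int k * y))) has_integral
     g pi * cis (- of_int k * pi) - g (- pi) * cis (- of_int k * (- pi))) {-pi..pi}"
  proof (rule fundamental_theorem_of_calculus)
    show "((\<lambda>y. g y * cis (- of_int k * y)) has_vector_derivative
        (g' y * cis (- of_int k * y) + g y * (\<i> * of_real (- of_int k) * cis (- of_int k * y)))) (at y within {-pi..pi})" for y
      using has_vector_derivative_mult[OF has_vector_derivative_at_within[OF g] has_vector_derivative_cis[of "- of_int k"]]
      by (simp add: add.commute)
  qed simp
  moreover have "cis (- of_int k * pi) = cis (- of_int k * (- pi))" using cis_2pi_period[of "- k" "- pi"] by simp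
  ultimately have "integral {-pi..pi} (\<lambda>y. g' y * cis (- of_int k * y) + g y * (\<i> * of_real (- of_int k) * cis (- of_int k * y))) = 0"
    using per by (simp add: integral_unique)
  moreover have "integral {-pi..pi} (\<lambda>y. g' y * cis (- of_int k * y) + g y * (\<i> * of_real (- of_int k) * cis (- of_int k * y)))
     = integral {-pi..pi} (\<lambda>y. g' y * cis (- of_int k * y)) + integral {-pi..pi} (\<lambda>y. (\<i> * of_real (- of_int k)) * (g y * cis (- of_int k * y)))"
    by (subst integral_add[symmetric]) (auto intro!: integrable_continuous_real continuous_intros
        continuous_on_subset[OF cg] continuous_on_subset[OF g'] simp: mult_ac)
  ultimately show ?thesis by (simp add: fourier_coeff_def add_eq_0_iff)
qed

lemma fourier_coeff_trig_polynomial: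
  assumes "finite A"
  shows "fourier_coeff (\<lambda>y. \<Sum>j\<in>A. a j * cis (of_int j * y)) k = (if k \<in> A then a k else 0)"
proof -
  have "integral {-pi..pi} (\<lambda>y. (\<Sum>j\<in>A. a j * cis (of_int j * y)) * cis (- (of_int k * y)))
      = integral {-pi..pi} (\<lambda>y. \<Sum>j\<in>A. a j * cis (of_int (j - k) * y))"
    by (simp add: sum_distrib_right mult.assoc cis_mult left_diff_distrib)
  also have "\<dots> = (\<Sum>j\<in>A. a j * (if j - k = 0 then 2 * pi else 0))"
    by (subst integral_sum[OF assms])
      (intro integrable_continuous_real continuous_intros, simp only: integral_mult_right integral_cis)
  also have "\<dots> = (if k \<in> A then 2 * pi * a k else 0)"
  proof -
    have "(\<Sum>j\<in>A. a j * complex_of_real (if j - k = 0 then 2 * pi else 0)) = (\<Sum>j\<in>A. if k = j then 2 * pi * a j else 0)"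
      by (rule sum.cong) auto
    then show ?thesis using assms by simp
  qed
  finally show ?thesis by (simp add: fourier_coeff_def)
qed

lemma continuous_on_polymonial_cis:
  assumes "real_polynomial_function p" shows "continuous_on A (\<lambda>y. p (cis y))"
proof -
  have "continuous_on UNIV p"
    using assms by (intro continuous_at_imp_continuous_on) (simp add: continuous_real_polymonial_function)
  then show ?thesis by (rule continuous_on_compose2) (auto intro!: continuous_intros)
qed

text \<open>Coefficients are bounded by the supremum norm and exact on every finite partial sum that
  contains the index \<open>k\<close>; the partial sums converge uniformly.\<close>

lemma fourier_coeff_trig_series:
  assumes "(\<lambda>k. norm (a k)) summable_on UNIV"
    and g: "\<And>y. ((\<lambda>k. a k * cis (of_int k * y)) has_sum g y) UNIV"
  shows "fourier_coeff g k = a k" "continuous_on UNIV g"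
proof -
  have ul: "uniform_limit UNIV (\<lambda>A y. \<Sum>k\<in>A. a k * cis (of_int k * y)) g (finite_subsets_at_top UNIV)"
  proof -
    have "uniform_limit UNIV (\<lambda>A y. \<Sum>k\<in>A. a k * cis (of_int k * y)) (\<lambda>y. \<Sum>\<^sub>\<infinity>k. a k * cis (of_int k * y)) (finite_subsets_at_top UNIV)"
      by (rule Weierstrass_m_test_general[where M="\<lambda>k. norm (a k)"]) (auto simp: norm_mult assms(1))
    moreover have "(\<lambda>y. \<Sum>\<^sub>\<infinity>k. a k * cis (of_int k * y)) = g" using infsumI[OF g] by auto
    ultimately show ?thesis by simp
  qed
  show cg: "continuous_on UNIV g"
    by (rule uniform_limit_theorem[OF _ ul]) (auto intro!: always_eventually continuous_intros)
  have fin: "fourier_coeff (\<lambda>y. \<Sum>j\<in>A. a j * cis (of_int j * y)) k = a k" if "finite A" "k \<in> A" for A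
    unfolding fourier_coeff_trig_polynomial[OF that(1)] using that by simp
  have "norm (fourier_coeff g k - a k) \<le> e" if "e > 0" for e
  proof -
    have ev: "\<forall>\<^sub>F A in finite_subsets_at_top UNIV. finite A \<and> k \<in> (A :: int set)"
      unfolding eventually_finite_subsets_at_top by (intro exI[of _ "{k}"]) auto
    have "\<forall>\<^sub>F A in finite_subsets_at_top UNIV. (finite A \<and> k \<in> A) \<and> (\<forall>y\<in>UNIV. dist (\<Sum>k\<in>A. a k * cis (of_int k * y)) (g y) < e)"
      by (rule eventually_conj[OF ev uniform_limitD[OF ul that]])
    from eventually_happens'[OF finite_subsets_at_top_neq_bot this] obtain A
      where "(finite A \<and> k \<in> A) \<and> (\<forall>y\<in>UNIV. dist (\<Sum>k\<in>A. a k * cis (of_int k * y)) (g y) < e)" ..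
    then have A: "finite A" "k \<in> A" "\<And>y. dist (\<Sum>k\<in>A. a k * cis (of_int k * y)) (g y) < e" by auto
    have "fourier_coeff (\<lambda>y. g y - (\<Sum>j\<in>A. a j * cis (of_int j * y))) k = fourier_coeff g k - a k"
      by (subst fourier_coeff_diff) (auto simp: fin A intro!: continuous_intros continuous_on_subset[OF cg])
    moreover have "norm (fourier_coeff (\<lambda>y. g y - (\<Sum>j\<in>A. a j * cis (of_int j * y))) k) \<le> e"
    proof (rule norm_fc_le)
      show "continuous_on {-pi..pi} (\<lambda>y. g y - (\<Sum>j\<in>A. a j * cis (of_int j * y)))"
        by (intro continuous_intros continuous_on_subset[OF cg] subset_UNIV)
      show "norm (g y - (\<Sum>j\<in>A. a j * cis (of_int j * y))) \<le> e" for y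
        using A(3)[of y] by (simp add: dist_norm norm_minus_commute[of "g y"])
    qed
    ultimately show ?thesis by simp
  qed
  then have "norm (fourier_coeff g k - a k) \<le> 0 + e" if "e > 0" for e using that by simp
  then have "norm (fourier_coeff g k - a k) \<le> 0" by (rule field_le_epsilon)
  then show "fourier_coeff g k = a k" by simp
qed

section \<open>Uniqueness of Fourier coefficients\<close>

text \<open>Periodicity removes the jump of \<open>Arg\<close> at -1. Continuity is shown through
  closed sets: the preimage of a closed set is the image under \<open>cis\<close> of a compact part
  of [-pi, pi]. The lift opens periodic functions to polynomial approximation on the circle, a
  compact subset of the plane.\<close>

lemma continuous_on_circle_lift:
  fixes f :: "real \<Rightarrow> real"
  assumes f: "continuous_on UNIV f" and per: "\<And>y. f (y + 2 * pi) = f y"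
  shows "continuous_on (sphere 0 1) (\<lambda>z. f (Arg z))" "f (Arg (cis y)) = f y"
proof -
  have eq: "f (Arg (cis y)) = f y" if "y \<in> {-pi..pi}" for y
  proof (cases "y = - pi")
    case True
    then have "cis y = -1" by (simp add: complex_eq_iff)
    then have "Arg (cis y) = pi" by (simp add: Arg_eq_pi)
    then show ?thesis using per[of "- pi"] True by simp
  next
    case False
    then show ?thesis using that by (subst Arg_cis) auto
  qed
  have shift: "f (y + 2 * pi * of_int n) = f y" for y n
  proof (induction n arbitrary: y rule: int_induct[where k=0])
    case (step1 i)
    then show ?case using per[of "y + 2 * pi * of_int i"] by (simp add: algebra_simps)
  next
    case (step2 i)
    then show ?case using per[of "y + 2 * pi * of_int (i - 1)"] by (simp add: algebra_simps)
  qed simp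
  show "f (Arg (cis y)) = f y"
  proof -
    obtain n where n: "y + 2 * pi * of_int n \<in> {-pi..pi}"
    proof -
      define q where "q = (y + pi) / (2 * pi)"
      have "real_of_int \<lfloor>q\<rfloor> \<le> q" "q \<le> real_of_int \<lfloor>q\<rfloor> + 1" by linarith+
      then have "2 * pi * real_of_int \<lfloor>q\<rfloor> \<le> 2 * pi * q" "2 * pi * q \<le> 2 * pi * (real_of_int \<lfloor>q\<rfloor> + 1)"
        by (intro mult_left_mono; simp)+
      moreover have q: "2 * pi * q = y + pi" by (simp add: q_def)
      ultimately have "2 * pi * real_of_int \<lfloor>q\<rfloor> \<le> y + pi" "y + pi \<le> 2 * pi * real_of_int \<lfloor>q\<rfloor> + 2 * pi"
        unfolding q by (simp_all only: distrib_left mult_1_right)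
      then have "y + 2 * pi * of_int (- \<lfloor>q\<rfloor>) \<in> {-pi..pi}" by simp
      then show ?thesis by (rule that)
    qed
    have "cis (y + 2 * pi * of_int n) = cis y"
      by (simp add: cis_mult[symmetric] cis_multiple_2pi)
    then show ?thesis using eq[OF n] shift by simp
  qed
  show "continuous_on (sphere 0 1) (\<lambda>z. f (Arg z))"
    unfolding continuous_on_closed_invariant
  proof (intro allI impI)
    fix B :: "real set" assume "closed B"
    let ?A = "cis ` ({-pi..pi} \<inter> f -` B)"
    have "closed (f -` B)" using f \<open>closed B\<close> by (simp add: continuous_on_closed_vimage)
    then have "compact ({-pi..pi} \<inter> f -` B)" by (rule compact_Int_closed[OF compact_Icc])
    then have "compact ?A" by (intro compact_continuous_image continuous_intros)
    then have "closed ?A" by (rule compact_imp_closed)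
    moreover have "?A \<inter> sphere 0 1 = (\<lambda>z. f (Arg z)) -` B \<inter> sphere 0 1"
    proof (intro equalityI subsetI)
      fix z :: complex assume "z \<in> (\<lambda>z. f (Arg z)) -` B \<inter> sphere 0 1"
      moreover have "cis (Arg z) = z" if "norm z = 1" using that cis_Arg[of z] by (cases "z = 0") (auto simp: sgn_eq)
      ultimately show "z \<in> ?A \<inter> sphere 0 1"
        using Arg_bounded[of z] by (auto intro!: image_eqI[of _ _ "Arg z"])
    qed (auto simp: eq)
    ultimately show "\<exists>A. closed A \<and> A \<inter> sphere 0 1 = (\<lambda>z. f (Arg z)) -` B \<inter> sphere 0 1" by blast
  qed
qed

text \<open>On the circle a real-linear functional is a combination of \<open>cis y\<close> and
  \<open>cis (- y)\<close>, so multiplication by it only shifts coefficients. For products the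
  induction is applied to \<open>h\<close> times the first factor, hence \<open>h\<close> is
  arbitrary in it.\<close>

lemma fourier_coeff_null_mult_polynomial:
  assumes "real_polynomial_function p"
  shows "continuous_on UNIV h \<Longrightarrow> (\<And>k. fourier_coeff h k = 0) \<Longrightarrow> fourier_coeff (\<lambda>y. h y * of_real (p (cis y))) k = 0"
  using assms
proof (induction p arbitrary: h k rule: real_polynomial_function.induct)
  case (linear f)
  have f: "of_real (f (cis y)) = (of_real (f 1) - \<i> * of_real (f \<i>)) / 2 * cis (of_int 1 * y)
      + (of_real (f 1) + \<i> * of_real (f \<i>)) / 2 * cis (- (of_int 1 * y))" for y
  proof -
    have "cis y = cos y *\<^sub>R 1 + sin y *\<^sub>R \<i>" by (simp add: complex_eq_iff)
    then have "f (cis y) = cos y * f 1 + sin y * f \<i>"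
      using bounded_linear.linear[OF linear.hyps] by (simp only: linear_add linear_scale real_scaleR_def)
    then show ?thesis by (simp add: complex_eq_iff field_simps)
  qed
  have sh: "fourier_coeff (\<lambda>y. h y * cis (of_int j * y)) k = fourier_coeff h (k - j)" for j k
    by (simp add: fourier_coeff_def mult.assoc cis_mult algebra_simps)
  have "fourier_coeff (\<lambda>y. h y * of_real (f (cis y))) k =
     fourier_coeff (\<lambda>y. (of_real (f 1) - \<i> * of_real (f \<i>)) / 2 * (h y * cis (of_int 1 * y))
       + (of_real (f 1) + \<i> * of_real (f \<i>)) / 2 * (h y * cis (of_int (-1) * y))) k"
    by (rule arg_cong2[where f=fourier_coeff]) (simp_all add: f algebra_simps)
  also have "\<dots> = 0"
    by (subst fourier_coeff_add) (auto simp only: fourier_coeff_cmult sh linear.prems mult_zero_right add_0 intro!: continuous_intros continuous_on_subset[OF linear.prems(1)])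
  finally show ?case .
next
  case (const c)
  then show ?case using fourier_coeff_cmult[of "of_real c" h k] by (simp add: mult.commute)
next
  case (add f g)
  have c: "continuous_on UNIV (\<lambda>y. h y * of_real (f (cis y)))" "continuous_on UNIV (\<lambda>y. h y * of_real (g (cis y)))"
    using add.hyps add.prems(1) by (auto intro!: continuous_intros continuous_on_polymonial_cis)
  show ?case
    using fourier_coeff_add[OF continuous_on_subset[OF c(1)] continuous_on_subset[OF c(2)], of k] add.IH[OF add.prems]
    by (simp add: algebra_simps)
next
  case (mult f g)
  have c: "continuous_on UNIV (\<lambda>y. h y * of_real (f (cis y)))"
    using mult.hyps mult.prems(1) by (auto intro!: continuous_intros continuous_on_polymonial_cis)
  show ?case
    using mult.IH(2)[OF c mult.IH(1)[OF mult.prems]] by (simp add: mult.assoc)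
qed

text \<open>The conjugate of \<open>g\<close> is approximated uniformly by a polynomial
  \<open>P\<close> on the circle. As \<open>g * P\<close> has integral zero, the integral of
  \<open>|g|^2\<close> equals that of \<open>g * (cnj g - P)\<close> and is at most
  \<open>2 * pi * M * e\<close> for every \<open>e\<close>.\<close>

lemma fourier_coeff_null_imp_zero:
  assumes g: "continuous_on UNIV g" and per: "\<And>y. g (y + 2 * pi) = g y" and null: "\<And>k. fourier_coeff g k = 0"
  shows "y \<in> {-pi..pi} \<Longrightarrow> g y = 0"
proof -
  obtain M where M: "\<And>y. y \<in> {-pi..pi} \<Longrightarrow> norm (g y) \<le> M"
    using compact_imp_bounded[OF compact_continuous_image[OF continuous_on_subset[OF g subset_UNIV] compact_Icc, of "-pi" pi]]
    unfolding bounded_iff by blast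
  have M0: "M \<ge> 0" using order_trans[OF norm_ge_zero M[of 0]] by simp
  have cn: "continuous_on {-pi..pi} (\<lambda>y. (norm (g y))\<^sup>2)"
    by (intro continuous_intros continuous_on_subset[OF g]) auto
  have le: "integral {-pi..pi} (\<lambda>y. (norm (g y))\<^sup>2) \<le> e * (2 * pi * M)" if e: "e > 0" for e
  proof -
    have "continuous_on UNIV (\<lambda>y. Re (g y))" "continuous_on UNIV (\<lambda>y. Im (g y))"
      by (intro continuous_intros g)+
    note re = continuous_on_circle_lift[OF this(1)] and im = continuous_on_circle_lift[OF this(2)]
    have cl: "continuous_on (sphere 0 1) (\<lambda>z. Re (g (Arg z)))" "continuous_on (sphere 0 1) (\<lambda>z. Im (g (Arg z)))"
      "Re (g (Arg (cis y))) = Re (g y)" "Im (g (Arg (cis y))) = Im (g y)" for y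
      using re im by (simp_all add: per)
    obtain p where p: "real_polynomial_function p" "\<And>z. z \<in> sphere 0 1 \<Longrightarrow> \<bar>Re (g (Arg z)) - p z\<bar> < e / 2"
      using Stone_Weierstrass_real_polynomial_function[OF compact_sphere cl(1), of "e / 2"] e by auto
    obtain q where q: "real_polynomial_function q" "\<And>z. z \<in> sphere 0 1 \<Longrightarrow> \<bar>Im (g (Arg z)) - q z\<bar> < e / 2"
      using Stone_Weierstrass_real_polynomial_function[OF compact_sphere cl(2), of "e / 2"] e by auto
    let ?P = "\<lambda>y. of_real (p (cis y)) - \<i> * of_real (q (cis y))"
    have cP: "continuous_on A (\<lambda>y. complex_of_real (p (cis y)))" "continuous_on A (\<lambda>y. complex_of_real (q (cis y)))" for A
      using continuous_on_polymonial_cis[OF p(1)] continuous_on_polymonial_cis[OF q(1)] by (auto intro!: continuous_intros)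
    have "fourier_coeff (\<lambda>y. g y * of_real (p (cis y)) - \<i> * (g y * of_real (q (cis y)))) 0 = 0"
      by (subst fourier_coeff_diff) (auto simp: fourier_coeff_cmult fourier_coeff_null_mult_polynomial[OF p(1) g null] fourier_coeff_null_mult_polynomial[OF q(1) g null]
          intro!: continuous_intros cP continuous_on_subset[OF g])
    then have "integral {-pi..pi} (\<lambda>y. g y * ?P y) = 0" by (simp add: fourier_coeff_def algebra_simps)
    moreover have i: "(\<lambda>y. g y * cnj (g y)) integrable_on {-pi..pi}" "(\<lambda>y. g y * ?P y) integrable_on {-pi..pi}"
      by (intro integrable_continuous_real continuous_intros cP continuous_on_subset[OF g] subset_UNIV)+
    ultimately have "integral {-pi..pi} (\<lambda>y. g y * cnj (g y)) = integral {-pi..pi} (\<lambda>y. g y * (cnj (g y) - ?P y))"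
      using integral_diff[OF i] by (simp add: right_diff_distrib)
    moreover have "norm (integral {-pi..pi} (\<lambda>y. g y * (cnj (g y) - ?P y))) \<le> integral {-pi..pi} (\<lambda>y. M * e)"
    proof (rule integral_norm_bound_integral)
      show "(\<lambda>y. g y * (cnj (g y) - ?P y)) integrable_on {-pi..pi}"
        by (intro integrable_continuous_real continuous_intros cP continuous_on_subset[OF g] subset_UNIV)
      fix y assume y: "y \<in> {-pi..pi}"
      have "norm (cnj (g y) - ?P y) \<le> \<bar>Re (g y) - p (cis y)\<bar> + \<bar>Im (g y) - q (cis y)\<bar>"
        using cmod_le[of "cnj (g y) - ?P y"] by simp
      also have "\<dots> \<le> e" using p(2)[of "cis y"] q(2)[of "cis y"] cl(3,4)[of y] by simp
      finally show "norm (g y * (cnj (g y) - ?P y)) \<le> M * e"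
        unfolding norm_mult by (intro mult_mono M y) (use M0 in auto)
    qed (intro integrable_continuous_real continuous_intros)
    moreover have "integral {-pi..pi} (\<lambda>y. g y * cnj (g y)) = of_real (integral {-pi..pi} (\<lambda>y. (norm (g y))\<^sup>2))"
      using integral_linear[OF integrable_continuous_real[OF cn] bounded_linear_of_real[where ?'a=complex]]
      by (simp add: complex_norm_square o_def del: of_real_power)
    ultimately have "norm (complex_of_real (integral {-pi..pi} (\<lambda>y. (norm (g y))\<^sup>2))) \<le> integral {-pi..pi} (\<lambda>y. M * e)"
      by metis
    moreover have "integral {-pi..pi} (\<lambda>y. (norm (g y))\<^sup>2) \<ge> 0" by (rule integral_nonneg[OF integrable_continuous_real[OF cn]]) simp
    ultimately show ?thesis by (simp add: mult_ac)
  qed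
  have "integral {-pi..pi} (\<lambda>y. (norm (g y))\<^sup>2) \<le> 0"
  proof (rule field_le_epsilon)
    fix e :: real assume "e > 0"
    \<comment> \<open>The summand 1 keeps the denominator positive when
      \<open>M = 0\<close>.\<close>
    have "e / (2 * pi * M + 1) > 0" using \<open>e > 0\<close> M0 by (intro divide_pos_pos) (auto simp: add_nonneg_pos)
    from le[OF this] have "integral {-pi..pi} (\<lambda>y. (norm (g y))\<^sup>2) \<le> e * ((2 * pi * M) / (2 * pi * M + 1))" by simp
    also have "\<dots> \<le> e * 1"
      using \<open>e > 0\<close> M0 by (intro mult_left_mono) (auto simp: divide_simps add_nonneg_pos)
    finally show "integral {-pi..pi} (\<lambda>y. (norm (g y))\<^sup>2) \<le> 0 + e" by simp
  qed
  moreover have "integral {-pi..pi} (\<lambda>y. (norm (g y))\<^sup>2) \<ge> 0" by (rule integral_nonneg[OF integrable_continuous_real[OF cn]]) simp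
  ultimately have "integral {-pi..pi} (\<lambda>y. (norm (g y))\<^sup>2) = 0" by simp
  then have "\<forall>y\<in>{-pi..pi}. (norm (g y))\<^sup>2 = 0"
    by (subst (asm) integral_eq_0_iff[OF cn]) auto
  then show "y \<in> {-pi..pi} \<Longrightarrow> g y = 0" by simp
qed

text \<open>The sum of the series is a continuous periodic function with the same coefficients as
  \<open>g\<close>, so the difference has only zero coefficients.\<close>

lemma fourier_inversion:
  assumes g: "continuous_on UNIV g" and per: "\<And>y. g (y + 2 * pi) = g y"
    and s: "(\<lambda>k. norm (fourier_coeff g k)) summable_on UNIV"
  shows "((\<lambda>k. fourier_coeff g k * cis (of_int k * y)) has_sum g y) UNIV"
proof -
  define h where "h y = (\<Sum>\<^sub>\<infinity>k. fourier_coeff g k * cis (of_int k * y))" for y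
  have hs: "((\<lambda>k. fourier_coeff g k * cis (of_int k * y)) has_sum h y) UNIV" for y
    unfolding h_def by (rule has_sum_infsum, rule abs_summable_summable) (simp add: norm_mult s)
  note h = fourier_coeff_trig_series[OF s hs]
  have hper: "h (y + 2 * pi) = h y" for y by (simp only: h_def cis_2pi_period)
  have D: "continuous_on UNIV (\<lambda>y. g y - h y)" by (intro continuous_intros g h)
  have "g y - h y = 0" if "y \<in> {-pi..pi}" for y
  proof (rule fourier_coeff_null_imp_zero[OF D _ _ that])
    show "g (y + 2 * pi) - h (y + 2 * pi) = g y - h y" for y by (simp add: per hper)
    show "fourier_coeff (\<lambda>y. g y - h y) k = 0" for k
      by (subst fourier_coeff_diff) (auto intro: continuous_on_subset[OF g] continuous_on_subset[OF h(2)] simp: h(1))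
  qed
  moreover have "g y - h y = g (Arg (cis y)) - h (Arg (cis y))"
  proof -
    have "continuous_on UNIV (\<lambda>y. Re (g y - h y))" "continuous_on UNIV (\<lambda>y. Im (g y - h y))"
      by (intro continuous_intros g h)+
    from continuous_on_circle_lift(2)[OF this(1), of y] continuous_on_circle_lift(2)[OF this(2), of y]
    show ?thesis by (simp add: per hper complex_eq_iff)
  qed
  ultimately have "g y = h y" using Arg_bounded[of "cis y"] by simp
  then show ?thesis using hs[of y] by simp
qed

text \<open>With \<open>S\<close> the partial sum, the pointwise inequality
  \<open>2 * Re (g * cnj S) - |S|^2 \<le> |g|^2 \<le> M^2\<close> is integrated;
  \<open>Re (g * cnj S)\<close> and \<open>|S|^2\<close> have the same integral,
  \<open>2 * pi\<close> times the sum of squares.\<close>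

lemma bessel_inequality:
  assumes g: "continuous_on UNIV g" and M: "\<And>y. y \<in> {-pi..pi} \<Longrightarrow> norm (g y) \<le> M" and A: "finite A"
  shows "(\<Sum>k\<in>A. (norm (fourier_coeff g k))\<^sup>2) \<le> M\<^sup>2"
proof -
  let ?c = "fourier_coeff g"
  define S where "S y = (\<Sum>k\<in>A. ?c k * cis (of_int k * y))" for y
  have cS: "continuous_on B S" for B unfolding S_def by (intro continuous_intros)
  have cg: "continuous_on B g" for B by (rule continuous_on_subset[OF g]) simp
  have ip: "integral {-pi..pi} (\<lambda>y. h y * cnj (S y)) = 2 * pi * (\<Sum>k\<in>A. cnj (?c k) * fourier_coeff h k)"
    if h: "continuous_on {-pi..pi} h" for h
  proof -
    have "integral {-pi..pi} (\<lambda>y. h y * cnj (S y)) = integral {-pi..pi} (\<lambda>y. \<Sum>k\<in>A. cnj (?c k) * (h y * cis (- (of_int k * y))))"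
      by (simp add: S_def sum_distrib_left cis_cnj mult_ac)
    also have "\<dots> = (\<Sum>k\<in>A. cnj (?c k) * integral {-pi..pi} (\<lambda>y. h y * cis (- (of_int k * y))))"
      by (subst integral_sum[OF A]) (intro integrable_continuous_real continuous_intros h, simp only: integral_mult_right)
    also have "\<dots> = (\<Sum>k\<in>A. 2 * pi * (cnj (?c k) * fourier_coeff h k))"
      by (rule sum.cong) (simp_all add: fourier_coeff_def)
    finally show ?thesis by (simp only: sum_distrib_left)
  qed
  have q: "cnj (?c k) * ?c k = of_real ((norm (?c k))\<^sup>2)" for k
    by (simp add: complex_norm_square mult.commute del: of_real_power)
  have i1: "integral {-pi..pi} (\<lambda>y. g y * cnj (S y)) = of_real (2 * pi * (\<Sum>k\<in>A. (norm (?c k))\<^sup>2))"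
    unfolding ip[OF cg] q by simp
  have "fourier_coeff S k = ?c k" if "k \<in> A" for k
    using fourier_coeff_trig_polynomial[OF A, of ?c k] that unfolding S_def by simp
  then have i2: "integral {-pi..pi} (\<lambda>y. S y * cnj (S y)) = of_real (2 * pi * (\<Sum>k\<in>A. (norm (?c k))\<^sup>2))"
    unfolding ip[OF cS] by (simp add: q)
  have int: "(\<lambda>y. Re (g y * cnj (S y))) integrable_on {-pi..pi}" "(\<lambda>y. Re (S y * cnj (S y))) integrable_on {-pi..pi}"
    by (intro integrable_continuous_real continuous_intros cS cg)+
  have re: "integral {-pi..pi} (\<lambda>y. Re (g y * cnj (S y))) = 2 * pi * (\<Sum>k\<in>A. (norm (?c k))\<^sup>2)"
    "integral {-pi..pi} (\<lambda>y. Re (S y * cnj (S y))) = 2 * pi * (\<Sum>k\<in>A. (norm (?c k))\<^sup>2)"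
    using integral_linear[OF integrable_continuous_real bounded_linear_Re, of "-pi" pi "\<lambda>y. g y * cnj (S y)"]
      integral_linear[OF integrable_continuous_real bounded_linear_Re, of "-pi" pi "\<lambda>y. S y * cnj (S y)"] i1 i2
    by (simp_all add: o_def continuous_intros cS cg)
  have pw: "2 * Re (g y * cnj (S y)) - Re (S y * cnj (S y)) \<le> M\<^sup>2" if "y \<in> {-pi..pi}" for y
  proof -
    have "0 \<le> (norm (g y - S y))\<^sup>2" by simp
    also have "\<dots> = (norm (g y))\<^sup>2 - (2 * Re (g y * cnj (S y)) - Re (S y * cnj (S y)))"
      by (simp add: cmod_power2) (simp add: power2_eq_square algebra_simps)
    finally show ?thesis using power_mono[OF M[OF that] norm_ge_zero, of 2] by simp
  qed
  define X where "X y = Re (g y * cnj (S y))" for y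
  define Y where "Y y = Re (S y * cnj (S y))" for y
  note XY = int[folded X_def Y_def] re[folded X_def Y_def] pw[folded X_def Y_def]
  have X2: "(\<lambda>y. 2 * X y) integrable_on {-pi..pi}" using integrable_on_cmult_left[OF XY(1), of 2] by simp
  have "integral {-pi..pi} (\<lambda>y. 2 * X y - Y y) \<le> integral {-pi..pi} (\<lambda>y. M\<^sup>2)"
    by (rule integral_le[OF integrable_diff[OF X2 XY(2)]]) (use XY(5) in auto)
  moreover have "integral {-pi..pi} (\<lambda>y. 2 * X y - Y y) = 2 * pi * (\<Sum>k\<in>A. (norm (?c k))\<^sup>2)"
    unfolding integral_diff[OF X2 XY(2)] by (simp add: XY(3,4))
  ultimately show ?thesis by simp
qed

lemma summable_on_inverse_square_int: "(\<lambda>k :: int. 1 / (real_of_int k)\<^sup>2) summable_on UNIV"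
proof -
  have s: "(\<lambda>n :: nat. 1 / (real n)\<^sup>2) summable_on UNIV"
    using inverse_power_summable[of 2, where ?'a=real]
    by (intro norm_summable_imp_summable_on) (simp add: field_simps)
  have "(\<lambda>k :: int. 1 / (real_of_int k)\<^sup>2) summable_on (range int)"
    using s by (subst summable_on_reindex) (auto simp: o_def inj_def)
  moreover have "(\<lambda>k :: int. 1 / (real_of_int k)\<^sup>2) summable_on (range (\<lambda>n. - int n))"
    using s by (subst summable_on_reindex) (auto simp: o_def inj_def)
  moreover have "range int \<union> range (\<lambda>n. - int n) = UNIV"
  proof -
    have "k \<in> range int \<union> range (\<lambda>n. - int n)" for k by (cases k rule: int_cases2) auto
    then show ?thesis by blast
  qed
  ultimately show ?thesis using summable_on_union[of _ "range int" "range (\<lambda>n. - int n)"] by simp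
qed

text \<open>For \<open>k \<noteq> 0\<close> the coefficient is that of \<open>g'\<close> divided by
  \<open>k\<close> in modulus, hence at most \<open>1 / k^2\<close> plus the square of the
  coefficient of \<open>g'\<close>, and these squares are summable by Bessel. One derivative is all
  that is available for \<open>\<kappa>2\<close> below.\<close>

lemma fourier_coeff_summable_C1:
  assumes g: "\<And>y. (g has_vector_derivative g' y) (at y)" and g': "continuous_on UNIV g'" and per: "\<And>y. g (y + 2 * pi) = g y"
  shows "(\<lambda>k. norm (fourier_coeff g k)) summable_on UNIV"
proof -
  obtain M where M: "\<And>y. y \<in> {-pi..pi} \<Longrightarrow> norm (g' y) \<le> M"
    using compact_imp_bounded[OF compact_continuous_image[OF continuous_on_subset[OF g' subset_UNIV] compact_Icc, of "-pi" pi]]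
    unfolding bounded_iff by blast
  have "(\<lambda>k. (norm (fourier_coeff g' k))\<^sup>2) summable_on UNIV"
    by (rule nonneg_bdd_above_summable_on) (auto intro!: bdd_aboveI2[where M="M\<^sup>2"] bessel_inequality[OF g' M])
  then have s: "(\<lambda>k. norm (fourier_coeff g 0) * (if k = 0 then 1 else 0) + (1 / (real_of_int k)\<^sup>2 + (norm (fourier_coeff g' k))\<^sup>2)) summable_on UNIV"
    by (intro summable_on_add summable_on_inverse_square_int summable_on_cmult_right)
      (auto intro: finite_nonzero_values_imp_summable_on finite_subset[of _ "{0}"])
  show ?thesis
  proof (rule summable_on_comparison_test[OF s])
    fix k :: int
    show "norm (fourier_coeff g k) \<le> norm (fourier_coeff g 0) * (if k = 0 then 1 else 0) + (1 / (real_of_int k)\<^sup>2 + (norm (fourier_coeff g' k))\<^sup>2)"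
    proof (cases "k = 0")
      case False
      have "norm (fourier_coeff g' k) = \<bar>real_of_int k\<bar> * norm (fourier_coeff g k)"
        using fourier_coeff_deriv[OF g g'] per[of "- pi"] by (simp add: norm_mult)
      then have "norm (fourier_coeff g k) = (1 / \<bar>real_of_int k\<bar>) * norm (fourier_coeff g' k)" using False by simp
      also have "\<dots> \<le> (1 / \<bar>real_of_int k\<bar>)\<^sup>2 + (norm (fourier_coeff g' k))\<^sup>2"
      proof -
        have *: "x * y \<le> x\<^sup>2 + y\<^sup>2" if "x \<ge> 0" "y \<ge> 0" for x y :: real
          using sum_squares_bound[of x y] mult_nonneg_nonneg[OF that] by linarith
        show ?thesis by (rule *) auto
      qed
      finally show ?thesis using False by (simp add: power_divide)
    qed simp
  qed simp
qed

lemma duhamel_formula: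
  fixes u h :: "real \<Rightarrow> complex"
  assumes u: "\<And>t. t \<in> {0..1} \<Longrightarrow> (u has_vector_derivative (h t - b *\<^sub>R u t)) (at t within {0..1})" and t: "t \<in> {0..1}"
  shows "u t = exp (- b * t) *\<^sub>R u 0 + integral {0..t} (\<lambda>s. exp (- b * (t - s)) *\<^sub>R h s)"
proof -
  have e: "((\<lambda>s. exp (b * s)) has_real_derivative (exp (b * s) * b)) (at s within A)" for s A
    by (auto intro!: derivative_eq_intros)
  have "((\<lambda>s. exp (b * s) *\<^sub>R u s) has_vector_derivative exp (b * s) *\<^sub>R h s) (at s within {0..t})" if "s \<in> {0..t}" for s
  proof -
    have "(u has_vector_derivative (h s - b *\<^sub>R u s)) (at s within {0..t})"
      using u[of s] that t by (intro has_vector_derivative_within_subset[OF u[of s]]) auto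
    from has_vector_derivative_scaleR[OF e this] show ?thesis by (simp add: algebra_simps)
  qed
  then have "((\<lambda>s. exp (b * s) *\<^sub>R h s) has_integral (exp (b * t) *\<^sub>R u t - exp (b * 0) *\<^sub>R u 0)) {0..t}"
    using t by (intro fundamental_theorem_of_calculus) auto
  from has_integral_cmul[OF this, of "exp (- b * t)"]
  have "((\<lambda>s. exp (- b * (t - s)) *\<^sub>R h s) has_integral (u t - exp (- b * t) *\<^sub>R u 0)) {0..t}"
    by (simp add: algebra_simps mult_exp_exp)
  then show ?thesis by (simp add: integral_unique)
qed

section \<open>Functions with a parameter\<close>

text \<open>The number counts derivatives in the real variable; in the parameter only joint
  continuity is kept. The parameter is a time, a pair of a time and a shift, or the dummy point 0
  for functions without parameter.\<close>

primrec joint_C :: "nat \<Rightarrow> 'p::topological_space set \<Rightarrow> ('p \<Rightarrow> real \<Rightarrow> real) \<Rightarrow> bool" where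
  "joint_C 0 I g = continuous_on (I \<times> UNIV) (\<lambda>(p, y). g p y)"
| "joint_C (Suc n) I g = (continuous_on (I \<times> UNIV) (\<lambda>(p, y). g p y) \<and>
     (\<exists>g'. (\<forall>p\<in>I. \<forall>y. (g p has_real_derivative g' p y) (at y)) \<and> joint_C n I g'))"

lemma joint_C_cont: "joint_C n I g \<Longrightarrow> continuous_on (I \<times> UNIV) (\<lambda>(p, y). g p y)"
  by (cases n) auto

lemma joint_C_SucI:
  assumes "continuous_on (I \<times> UNIV) (\<lambda>(p, y). g p y)"
    "\<And>p y. p \<in> I \<Longrightarrow> (g p has_real_derivative g' p y) (at y)" "joint_C n I g'"
  shows "joint_C (Suc n) I g"
  using assms by auto

lemma joint_C_SucD:
  assumes "joint_C (Suc n) I g"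
  shows "\<exists>g'. (\<forall>p\<in>I. \<forall>y. (g p has_real_derivative g' p y) (at y)) \<and> joint_C n I g'"
  using assms by simp

lemma joint_C_Suc: "joint_C (Suc n) I g \<Longrightarrow> joint_C n I g"
proof (induction n arbitrary: g)
  case (Suc n)
  obtain g' where g': "\<And>p y. p \<in> I \<Longrightarrow> (g p has_real_derivative g' p y) (at y)" "joint_C (Suc n) I g'"
    using joint_C_SucD[OF Suc.prems] by blast
  show ?case by (rule joint_C_SucI[OF joint_C_cont[OF Suc.prems] g'(1) Suc.IH[OF g'(2)]])
qed auto

lemma joint_C_le: "joint_C n I g \<Longrightarrow> m \<le> n \<Longrightarrow> joint_C m I g"
  by (induction n) (auto simp del: joint_C.simps(2) simp: le_Suc_eq intro: joint_C_Suc)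

lemma joint_C_cong:
  assumes "\<And>p y. p \<in> I \<Longrightarrow> g p y = h p y"
  shows "joint_C n I g \<longleftrightarrow> joint_C n I h"
proof -
  have c: "continuous_on (I \<times> UNIV) (\<lambda>(p, y). g p y) \<longleftrightarrow> continuous_on (I \<times> UNIV) (\<lambda>(p, y). h p y)"
    by (rule continuous_on_cong) (use assms in auto)
  have "g p = h p" if "p \<in> I" for p using assms[OF that] by auto
  then show ?thesis using c by (cases n) (auto simp del: ex_simps)
qed

lemma joint_C_deriv:
  assumes "joint_C (Suc n) I g" "\<And>p y. p \<in> I \<Longrightarrow> (g p has_real_derivative h p y) (at y)"
  shows "joint_C n I h"
proof -
  obtain g' where g': "\<And>p y. p \<in> I \<Longrightarrow> (g p has_real_derivative g' p y) (at y)" "joint_C n I g'"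
    using joint_C_SucD[OF assms(1)] by blast
  have "g' p y = h p y" if "p \<in> I" for p y using DERIV_unique[OF g'(1) assms(2)] that by blast
  then show ?thesis using joint_C_cong[of I g' h n] g'(2) by blast
qed

lemma joint_C_const: "joint_C n I (\<lambda>p y. c)"
  by (induction n arbitrary: c) (auto intro!: exI[of _ "\<lambda>p y. 0"] simp: case_prod_unfold)

lemma joint_C_ident: "joint_C n I (\<lambda>p y. y)"
proof (cases n)
  case 0
  then show ?thesis by (auto simp: case_prod_unfold intro!: continuous_intros)
next
  case (Suc m)
  show ?thesis unfolding Suc
    by (rule joint_C_SucI[where g'="\<lambda>p y. 1"]) (auto simp: case_prod_unfold joint_C_const intro!: continuous_intros)
qed

lemma joint_C_param:
  assumes "continuous_on I f" shows "joint_C n I (\<lambda>p y. f p)"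
proof -
  have c: "continuous_on (I \<times> UNIV) (\<lambda>(p, y :: real). f p)"
    unfolding case_prod_unfold by (rule continuous_on_compose2[OF assms]) (auto intro!: continuous_intros)
  show ?thesis by (cases n) (use c joint_C_const[of _ I 0] in \<open>auto intro!: exI[of _ "\<lambda>p y. 0"]\<close>)
qed

lemma joint_C_add: "joint_C n I g \<Longrightarrow> joint_C n I h \<Longrightarrow> joint_C n I (\<lambda>p y. g p y + h p y)"
proof (induction n arbitrary: g h)
  case 0
  then show ?case by (auto simp: case_prod_unfold intro!: continuous_intros)
next
  case (Suc n)
  obtain g' where g': "\<And>p y. p \<in> I \<Longrightarrow> (g p has_real_derivative g' p y) (at y)" "joint_C n I g'"
    using joint_C_SucD[OF Suc.prems(1)] by blast
  obtain h' where h': "\<And>p y. p \<in> I \<Longrightarrow> (h p has_real_derivative h' p y) (at y)" "joint_C n I h'"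
    using joint_C_SucD[OF Suc.prems(2)] by blast
  show ?case
    by (rule joint_C_SucI[OF _ _ Suc.IH[OF g'(2) h'(2)]])
      (use joint_C_cont[OF Suc.prems(1)] joint_C_cont[OF Suc.prems(2)] g'(1) h'(1) in
        \<open>auto simp: case_prod_unfold intro!: continuous_intros derivative_eq_intros\<close>)
qed

lemma joint_C_mult: "joint_C n I g \<Longrightarrow> joint_C n I h \<Longrightarrow> joint_C n I (\<lambda>p y. g p y * h p y)"
proof (induction n arbitrary: g h)
  case 0
  then show ?case by (auto simp: case_prod_unfold intro!: continuous_intros)
next
  case (Suc n)
  obtain g' where g': "\<And>p y. p \<in> I \<Longrightarrow> (g p has_real_derivative g' p y) (at y)" "joint_C n I g'"
    using joint_C_SucD[OF Suc.prems(1)] by blast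
  obtain h' where h': "\<And>p y. p \<in> I \<Longrightarrow> (h p has_real_derivative h' p y) (at y)" "joint_C n I h'"
    using joint_C_SucD[OF Suc.prems(2)] by blast
  have "joint_C n I (\<lambda>p y. g' p y * h p y + g p y * h' p y)"
    by (intro joint_C_add Suc.IH g'(2) h'(2) joint_C_Suc[OF Suc.prems(1)] joint_C_Suc[OF Suc.prems(2)])
  then show ?case
    by (rule joint_C_SucI[rotated 2])
      (use joint_C_cont[OF Suc.prems(1)] joint_C_cont[OF Suc.prems(2)] g'(1) h'(1) in
        \<open>auto simp: case_prod_unfold intro!: continuous_intros derivative_eq_intros\<close>)
qed

lemma joint_C_cmult: "joint_C n I g \<Longrightarrow> joint_C n I (\<lambda>p y. c * g p y)"
  by (intro joint_C_mult joint_C_const)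

lemma joint_C_diff: "joint_C n I g \<Longrightarrow> joint_C n I h \<Longrightarrow> joint_C n I (\<lambda>p y. g p y - h p y)"
  using joint_C_add[of n I g "\<lambda>p y. (-1) * h p y"] joint_C_cmult[of n I h "-1"] by simp

lemma joint_C_power: "joint_C n I g \<Longrightarrow> joint_C n I (\<lambda>p y. g p y ^ m)"
  by (induction m) (auto intro: joint_C_const joint_C_mult)

lemma joint_C_inverse:
  "joint_C n I g \<Longrightarrow> (\<And>p y. p \<in> I \<Longrightarrow> g p y \<noteq> 0) \<Longrightarrow> joint_C n I (\<lambda>p y. inverse (g p y))"
proof (induction n arbitrary: g)
  case 0
  then show ?case by (auto simp: case_prod_unfold intro!: continuous_intros)
next
  case (Suc n)
  obtain g' where g': "\<And>p y. p \<in> I \<Longrightarrow> (g p has_real_derivative g' p y) (at y)" "joint_C n I g'"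
    using joint_C_SucD[OF Suc.prems(1)] by blast
  have "joint_C n I (\<lambda>p y. (-1) * (g' p y * (inverse (g p y) * inverse (g p y))))"
    by (intro joint_C_mult joint_C_const Suc.IH g'(2) joint_C_Suc[OF Suc.prems(1)] Suc.prems(2))
  then show ?case
  proof (rule joint_C_SucI[rotated 2])
    fix p y assume "p \<in> I"
    then show "((\<lambda>y. inverse (g p y)) has_real_derivative (-1) * (g' p y * (inverse (g p y) * inverse (g p y)))) (at y)"
      using DERIV_inverse_fun[OF g'(1)[of p y] Suc.prems(2)[of p y]] by (simp add: mult_ac)
  qed (use joint_C_cont[OF Suc.prems(1)] Suc.prems(2) in \<open>auto simp: case_prod_unfold intro!: continuous_intros\<close>)
qed

lemma joint_C_divide:
  "joint_C n I h \<Longrightarrow> joint_C n I g \<Longrightarrow> (\<And>p y. p \<in> I \<Longrightarrow> g p y \<noteq> 0) \<Longrightarrow> joint_C n I (\<lambda>p y. h p y / g p y)"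
  unfolding divide_inverse by (intro joint_C_mult joint_C_inverse) auto

lemma joint_C_sqrt:
  "joint_C n I g \<Longrightarrow> (\<And>p y. p \<in> I \<Longrightarrow> g p y > 0) \<Longrightarrow> joint_C n I (\<lambda>p y. sqrt (g p y))"
proof (induction n arbitrary: g)
  case 0
  then show ?case by (auto simp: case_prod_unfold intro!: continuous_intros)
next
  case (Suc n)
  obtain g' where g': "\<And>p y. p \<in> I \<Longrightarrow> (g p has_real_derivative g' p y) (at y)" "joint_C n I g'"
    using joint_C_SucD[OF Suc.prems(1)] by blast
  have nz: "sqrt (g p y) \<noteq> 0" if "p \<in> I" for p y using Suc.prems(2)[OF that, of y] by simp
  have "joint_C n I (\<lambda>p y. g' p y * ((1/2) * inverse (sqrt (g p y))))"
    by (intro joint_C_mult joint_C_const joint_C_inverse Suc.IH g'(2) joint_C_Suc[OF Suc.prems(1)] Suc.prems(2) nz)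
  then show ?case
  proof (rule joint_C_SucI[rotated 2])
    fix p y assume p: "p \<in> I"
    show "((\<lambda>y. sqrt (g p y)) has_real_derivative g' p y * ((1/2) * inverse (sqrt (g p y)))) (at y)"
      using DERIV_chain2[OF DERIV_real_sqrt[OF Suc.prems(2)[OF p, of y]] g'(1)[OF p, of y]] by (simp add: field_simps)
  qed (use joint_C_cont[OF Suc.prems(1)] in \<open>auto simp: case_prod_unfold intro!: continuous_intros\<close>)
qed

lemma joint_C_compose:
  "joint_C n J g \<Longrightarrow> joint_C n I q \<Longrightarrow> continuous_on I f \<Longrightarrow> (\<And>p. p \<in> I \<Longrightarrow> f p \<in> J) \<Longrightarrow> joint_C n I (\<lambda>p y. g (f p) (q p y))"
proof (induction n arbitrary: g q)
  case 0
  have "continuous_on (I \<times> UNIV) (\<lambda>x. (\<lambda>(p, y). g p y) (f (fst x), q (fst x) (snd x)))"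
    by (rule continuous_on_compose2[OF joint_C_cont[OF 0(1)]])
      (use 0 joint_C_cont[OF 0(2)] in \<open>auto simp: case_prod_unfold intro!: continuous_intros
         continuous_on_compose2[OF 0(3) continuous_on_fst[OF continuous_on_id]]\<close>)
  then show ?case by (simp add: case_prod_unfold)
next
  case (Suc n)
  obtain g' where g': "\<And>p y. p \<in> J \<Longrightarrow> (g p has_real_derivative g' p y) (at y)" "joint_C n J g'"
    using joint_C_SucD[OF Suc.prems(1)] by blast
  obtain q' where q': "\<And>p y. p \<in> I \<Longrightarrow> (q p has_real_derivative q' p y) (at y)" "joint_C n I q'"
    using joint_C_SucD[OF Suc.prems(2)] by blast
  have "joint_C n I (\<lambda>p y. g' (f p) (q p y) * q' p y)"
    by (rule joint_C_mult[OF Suc.IH[OF g'(2) joint_C_Suc[OF Suc.prems(2)] Suc.prems(3,4)] q'(2)])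
  then show ?case
  proof (rule joint_C_SucI[rotated 2])
    fix p y assume p: "p \<in> I"
    show "((\<lambda>y. g (f p) (q p y)) has_real_derivative g' (f p) (q p y) * q' p y) (at y)"
      by (rule DERIV_chain2[OF g'(1) q'(1)]) (use p Suc.prems(4) in auto)
    next
    have "continuous_on (I \<times> UNIV) (\<lambda>x. (\<lambda>(p, y). g p y) (f (fst x), q (fst x) (snd x)))"
      by (rule continuous_on_compose2[OF joint_C_cont[OF Suc.prems(1)]])
        (use Suc.prems(4) joint_C_cont[OF Suc.prems(2)] in \<open>auto simp: case_prod_unfold intro!: continuous_intros
           continuous_on_compose2[OF Suc.prems(3) continuous_on_fst[OF continuous_on_id]]\<close>)
    then show "continuous_on (I \<times> UNIV) (\<lambda>(p, y). g (f p) (q p y))" by (simp add: case_prod_unfold)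
  qed
qed

lemma joint_C_slice:
  assumes "joint_C n I g" "p \<in> I" shows "continuous_on A (g p)"
proof -
  have "continuous_on A (\<lambda>y. (\<lambda>(p, y). g p y) (p, y))"
    by (rule continuous_on_compose2[OF joint_C_cont[OF assms(1)]]) (use assms(2) in \<open>auto intro!: continuous_intros\<close>)
  then show ?thesis by simp
qed

lemma joint_C_bounded:
  fixes I :: "'p::metric_space set"
  assumes "joint_C n I g" "compact I"
  shows "\<exists>M\<ge>0. \<forall>p\<in>I. \<forall>y\<in>{-pi..pi}. \<bar>g p y\<bar> \<le> M"
proof -
  have "compact (I \<times> {-pi..pi})" using assms(2) by (intro compact_Times) auto
  then have "bounded ((\<lambda>(p, y). g p y) ` (I \<times> {-pi..pi}))"
    by (intro compact_imp_bounded compact_continuous_image continuous_on_subset[OF joint_C_cont[OF assms(1)]]) auto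
  then obtain M where "\<And>z. z \<in> I \<times> {-pi..pi} \<Longrightarrow> norm ((\<lambda>(p, y). g p y) z) \<le> M"
    unfolding bounded_iff by blast
  then have "\<bar>g p y\<bar> \<le> max M 0" if "p \<in> I" "y \<in> {-pi..pi}" for p y using that by fastforce
  then show ?thesis by (intro exI[of _ "max M 0"]) simp
qed

lemma joint_C_near:
  fixes I :: "'p::metric_space set"
  assumes "joint_C n I g" "compact I" "p0 \<in> I" "e > 0"
  shows "\<exists>d>0. \<forall>p\<in>I. \<forall>y\<in>{-pi..pi}. dist p p0 < d \<longrightarrow> \<bar>g p y - g p0 y\<bar> \<le> e"
proof -
  have "compact (I \<times> {-pi..pi})" using assms(2) by (intro compact_Times) auto
  then have "uniformly_continuous_on (I \<times> {-pi..pi}) (\<lambda>(p, y). g p y)"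
    by (intro compact_uniformly_continuous continuous_on_subset[OF joint_C_cont[OF assms(1)]]) auto
  then obtain d where d: "d > 0" "\<forall>z\<in>I \<times> {-pi..pi}. \<forall>z'\<in>I \<times> {-pi..pi}. dist z' z < d \<longrightarrow>
      dist ((\<lambda>(p, y). g p y) z') ((\<lambda>(p, y). g p y) z) < e"
    using assms(4) unfolding uniformly_continuous_on_def by meson
  have "\<bar>g p y - g p0 y\<bar> \<le> e" if "p \<in> I" "dist p p0 < d" "y \<in> {-pi..pi}" for p y
    using d(2)[rule_format, of "(p0, y)" "(p, y)"] that assms(3) by (simp add: dist_Pair_Pair dist_real_def)
  then show ?thesis using d(1) by blast
qed

section \<open>Fourier expansion of time-dependent functions\<close>

definition rfc :: "(real \<Rightarrow> real) \<Rightarrow> int \<Rightarrow> complex" where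
  "rfc g k = fourier_coeff (\<lambda>y. of_real (g y)) k"

definition point_eval :: "real \<Rightarrow> real \<Rightarrow> fourier \<Rightarrow> complex" where
  "point_eval t y = l1_eval (\<lambda>f. apply_bcontfun f t) (\<lambda>k. cis (of_int k * y))"

lemma nhom_point_eval: "nhom (point_eval t y)"
  unfolding point_eval_def
  by (rule nhom_l1_eval[OF nhom_apply_bcontfun]) (simp_all add: cis_mult distrib_right)

lemma nhom_of_real: "nhom (of_real :: real \<Rightarrow> 'a::{real_normed_algebra_1, comm_ring_1})"
  by (auto simp: nhom_def scaleR_conv_of_real intro!: linearI)

lemma point_eval_has_sum:
  "((\<lambda>k. apply_bcontfun (lcoeff F k) t * cis (of_int k * y)) has_sum point_eval t y F) UNIV"
  unfolding point_eval_def by (rule l1_eval_bounds(2)[OF nhom_apply_bcontfun]) simp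

text \<open>The link between the algebra \<open>fourier\<close> and functions. Point evaluations are
  homomorphisms and a represented function determines its element, so algebraic identities between
  functions hold in \<open>fourier\<close> without any computation with coefficients.\<close>

definition represents :: "fourier \<Rightarrow> (real \<Rightarrow> real \<Rightarrow> real) \<Rightarrow> bool" where
  "represents F g \<longleftrightarrow> (\<forall>t y. point_eval t y F = of_real (g (clamp01 t) y))"

lemma apply_lcoeff_abs_summable: "(\<lambda>k. norm (apply_bcontfun (lcoeff F k) t)) summable_on UNIV"
  by (rule summable_on_comparison_test[OF lcoeff_abs_summable[of F]]) (auto intro: norm_bounded)

lemma represents_coeff:
  assumes "represents F g"
  shows "apply_bcontfun (lcoeff F k) t = rfc (g (clamp01 t)) k"
  unfolding rfc_def
  by (rule fourier_coeff_trig_series(1)[symmetric, OF apply_lcoeff_abs_summable])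
    (use assms point_eval_has_sum[of F t] in \<open>auto simp: represents_def\<close>)

lemma represents_unique:
  assumes "represents F g" "represents G h" "\<And>t y. t \<in> {0..1} \<Longrightarrow> g t y = h t y"
  shows "F = G"
proof (intro l1_eqI bcontfun_eqI)
  fix k t
  have "g (clamp01 t) = h (clamp01 t)" using assms(3) by auto
  then show "apply_bcontfun (lcoeff F k) t = apply_bcontfun (lcoeff G k) t"
    by (simp add: represents_coeff[OF assms(1)] represents_coeff[OF assms(2)])
qed

lemma represents_ring:
  assumes "represents F g" "represents G h"
  shows "represents (F + G) (\<lambda>t y. g t y + h t y)" "represents (F - G) (\<lambda>t y. g t y - h t y)"
    "represents (F * G) (\<lambda>t y. g t y * h t y)" "represents (c *\<^sub>R F) (\<lambda>t y. c * g t y)"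
    "represents 1 (\<lambda>t y. 1)"
  using assms by (simp_all add: represents_def nhomD[OF nhom_point_eval] scaleR_conv_of_real[where 'a=complex])

lemma represents_rhs:
  assumes "represents K0 k0" "represents K1 k1" "represents K2 k2" "represents L l" "represents M m"
    "represents P0 p0" "represents P1 p1" "represents P2 p2" "represents Z z"
  shows "represents (rhs2 a K0 K1 L P0 P1 P2 Z) (\<lambda>t y. rhs2 a (k0 t y) (k1 t y) (l t y) (p0 t y) (p1 t y) (p2 t y) (z t y))"
    "represents (rhs1 K0 K1 L P0 P1 P2 Z) (\<lambda>t y. rhs1 (k0 t y) (k1 t y) (l t y) (p0 t y) (p1 t y) (p2 t y) (z t y))"
    "represents (rhs0 K0 K1 K2 L M P0 P1 P2 Z) (\<lambda>t y. rhs0 (k0 t y) (k1 t y) (k2 t y) (l t y) (m t y) (p0 t y) (p1 t y) (p2 t y) (z t y))"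
  using assms by (simp_all add: represents_def nhom_flux[OF nhom_point_eval] nhom_flux[OF nhom_of_real])

definition fourier_elt :: "(real \<Rightarrow> real \<Rightarrow> real) \<Rightarrow> fourier" where
  "fourier_elt g = Abs_l1 (\<lambda>k. Bcontfun (\<lambda>t. rfc (g (clamp01 t)) k))"

lemma continuous_on_rfc:
  assumes "continuous_on (I \<times> UNIV) (\<lambda>(p, y). g p y)"
  shows "continuous_on I (\<lambda>p. rfc (g p) k)"
proof -
  have "continuous_on (I \<times> {-pi..pi}) (\<lambda>x. of_real ((\<lambda>(p, y). g p y) x) * cis (- (of_int k * snd x)))"
    by (intro continuous_intros continuous_on_subset[OF assms]) auto
  then have "continuous_on I (\<lambda>p. integral (cbox (-pi) pi) (\<lambda>y. of_real (g p y) * cis (- (of_int k * y))))"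
    by (intro integral_continuous_on_param) (simp add: case_prod_unfold)
  then show ?thesis unfolding rfc_def fourier_coeff_def by (intro continuous_intros) auto
qed

text \<open>The majorant \<open>b\<close> is independent of time because the norm of
  \<open>fourier\<close> takes the supremum over time inside the sum over modes.\<close>

lemma fourier_elt:
  assumes g: "continuous_on ({0..1} \<times> UNIV) (\<lambda>(t, y). g t y)"
    and per: "\<And>t y. t \<in> {0..1} \<Longrightarrow> g t (y + 2 * pi) = g t y"
    and b: "b summable_on UNIV" and le: "\<And>t k. t \<in> {0..1} \<Longrightarrow> norm (rfc (g t) k) \<le> b k"
  shows "represents (fourier_elt g) g" "norm (lcoeff (fourier_elt g) k) \<le> b k"
proof -
  have "continuous_on UNIV (\<lambda>t. rfc (g (clamp01 t)) k)" for k
    by (rule continuous_on_compose2[OF continuous_on_rfc[OF g] continuous_on_clamp01]) auto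
  then have bc: "(\<lambda>t. rfc (g (clamp01 t)) k) \<in> bcontfun" for k
    by (rule bcontfun_normI) (rule le, simp)
  have nb: "norm (Bcontfun (\<lambda>t. rfc (g (clamp01 t)) k)) \<le> b k" for k
    by (rule norm_bound) (simp add: Bcontfun_inverse[OF bc] le)
  have s: "(\<lambda>k. norm (Bcontfun (\<lambda>t. rfc (g (clamp01 t)) k))) summable_on UNIV"
    by (rule summable_on_comparison_test[OF b]) (auto intro: nb)
  have lc: "lcoeff (fourier_elt g) k = Bcontfun (\<lambda>t. rfc (g (clamp01 t)) k)" for k
    by (simp add: fourier_elt_def lcoeff_Abs_l1[OF s])
  show "norm (lcoeff (fourier_elt g) k) \<le> b k" unfolding lc by (rule nb)
  show "represents (fourier_elt g) g"
    unfolding represents_def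
  proof (intro allI)
    fix t y
    let ?t = "clamp01 t"
    have "continuous_on UNIV (\<lambda>y. (\<lambda>(t, y). g t y) (?t, y))"
      by (rule continuous_on_compose2[OF g]) (auto intro!: continuous_intros)
    then have c: "continuous_on UNIV (\<lambda>y. complex_of_real (g ?t y))" by (auto intro!: continuous_intros)
    have "(\<lambda>k. norm (rfc (g ?t) k)) summable_on UNIV"
      by (rule summable_on_comparison_test[OF b]) (auto intro: le)
    then have "((\<lambda>k. rfc (g ?t) k * cis (of_int k * y)) has_sum of_real (g ?t y)) UNIV"
      unfolding rfc_def by (intro fourier_inversion[OF c]) (auto simp: per)
    moreover have "((\<lambda>k. rfc (g ?t) k * cis (of_int k * y)) has_sum point_eval t y (fourier_elt g)) UNIV"
      using point_eval_has_sum[of "fourier_elt g" t y] by (simp add: lc Bcontfun_inverse[OF bc])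
    ultimately show "point_eval t y (fourier_elt g) = of_real (g ?t y)" using has_sum_unique by blast
  qed
qed

lemma has_vector_derivative_of_real: "(g has_real_derivative d) F \<Longrightarrow> ((\<lambda>y. complex_of_real (g y)) has_vector_derivative of_real d) F"
  using bounded_linear.has_vector_derivative[OF bounded_linear_of_real]
  by (simp add: has_real_derivative_iff_has_vector_derivative)

lemma periodic_deriv:
  fixes g g' :: "real \<Rightarrow> real"
  assumes "\<And>y. (g has_real_derivative g' y) (at y)" "\<And>y. g (y + c) = g y"
  shows "g' (y + c) = g' y"
proof -
  have "((\<lambda>y. g (y + c)) has_real_derivative g' (y + c)) (at y)"
    using assms(1)[of "y + c"] by (simp add: DERIV_shift)
  then show ?thesis using assms DERIV_unique by (metis (no_types, lifting) ext)
qed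

lemma rfc_deriv:
  assumes "\<And>y. (g has_real_derivative g' y) (at y)" "continuous_on UNIV g'" "\<And>y. g (y + 2 * pi) = g y"
  shows "rfc g' k = \<i> * of_int k * rfc g k"
  unfolding rfc_def
proof (rule fourier_coeff_deriv)
  show "complex_of_real (g pi) = of_real (g (- pi))" using assms(3)[of "- pi"] by simp
qed (auto intro!: has_vector_derivative_of_real assms continuous_intros)

lemma norm_rfc_le:
  assumes "continuous_on {-pi..pi} g" "\<And>y. y \<in> {-pi..pi} \<Longrightarrow> \<bar>g y\<bar> \<le> M"
  shows "norm (rfc g k) \<le> M"
  unfolding rfc_def by (rule norm_fc_le) (auto intro!: continuous_intros assms)

lemma rfc_diff:
  "continuous_on {-pi..pi} g \<Longrightarrow> continuous_on {-pi..pi} h \<Longrightarrow> rfc (\<lambda>y. g y - h y) k = rfc g k - rfc h k"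
  unfolding rfc_def by (simp add: fourier_coeff_diff continuous_intros)

lemma rfc_add:
  "continuous_on {-pi..pi} g \<Longrightarrow> continuous_on {-pi..pi} h \<Longrightarrow> rfc (\<lambda>y. g y + h y) k = rfc g k + rfc h k"
  unfolding rfc_def by (simp add: fourier_coeff_add continuous_intros)

lemma rfc_cmult: "rfc (\<lambda>y. c * g y) k = of_real c * rfc g k"
  unfolding rfc_def by (simp add: fourier_coeff_cmult)

text \<open>Two derivatives give the decay \<open>M2 / k^2\<close>, uniformly in the parameter by
  compactness. The mode 0 is added by hand, since \<open>1 / 0\<close> is 0.\<close>

lemma rfc_decay:
  fixes I :: "'p::metric_space set"
  assumes g: "joint_C 2 I g" and I: "compact I" and per: "\<And>p y. p \<in> I \<Longrightarrow> g p (y + 2 * pi) = g p y"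
  shows "\<exists>b. b summable_on UNIV \<and> (\<forall>p\<in>I. \<forall>k. norm (rfc (g p) k) \<le> b k)"
proof -
  obtain g1 where g1: "\<forall>p\<in>I. \<forall>y. (g p has_real_derivative g1 p y) (at y)" "joint_C 1 I g1"
    using joint_C_SucD[of 1 I g] g by (auto simp: numeral_2_eq_2)
  obtain g2 where g2: "\<forall>p\<in>I. \<forall>y. (g1 p has_real_derivative g2 p y) (at y)" "joint_C 0 I g2"
    using joint_C_SucD[of 0 I g1] g1(2) by auto
  obtain M0 where M0: "M0 \<ge> 0" "\<forall>p\<in>I. \<forall>y\<in>{-pi..pi}. \<bar>g p y\<bar> \<le> M0" using joint_C_bounded[OF g I] by blast
  obtain M2 where M2: "M2 \<ge> 0" "\<forall>p\<in>I. \<forall>y\<in>{-pi..pi}. \<bar>g2 p y\<bar> \<le> M2" using joint_C_bounded[OF g2(2) I] by blast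
  define b where "b k = M0 * (if k = 0 then 1 else 0) + M2 * (1 / (real_of_int k)\<^sup>2)" for k :: int
  have "b summable_on UNIV"
    unfolding b_def by (intro summable_on_add summable_on_inverse_square_int summable_on_cmult_right)
      (auto intro: finite_nonzero_values_imp_summable_on finite_subset[of _ "{0}"])
  moreover have "norm (rfc (g p) k) \<le> b k" if p: "p \<in> I" for p k
  proof (cases "k = 0")
    case True
    then show ?thesis using norm_rfc_le[OF joint_C_slice[OF g p], of M0 k] M0 p by (simp add: b_def)
  next
    case False
    have p1: "g1 p (y + 2 * pi) = g1 p y" for y
      by (rule periodic_deriv[of "g p"]) (use g1(1) p per in auto)
    have "rfc (g2 p) k = \<i> * of_int k * (\<i> * of_int k * rfc (g p) k)"
      using rfc_deriv[of "g1 p" "g2 p" k] rfc_deriv[of "g p" "g1 p" k] g1 g2 p p1 per joint_C_slice by metis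
    then have "norm (rfc (g2 p) k) = (real_of_int k)\<^sup>2 * norm (rfc (g p) k)"
      by (simp add: norm_mult power2_eq_square)
    moreover have "norm (rfc (g2 p) k) \<le> M2"
      by (rule norm_rfc_le[OF joint_C_slice[OF g2(2) p]]) (use M2 p in auto)
    ultimately show ?thesis using False by (simp add: b_def field_simps)
  qed
  ultimately show ?thesis by blast
qed

text \<open>Dominated convergence, uniformly in \<open>F\<close>: outside a finite set the common
  majorant is small, and on it the coefficients are.\<close>

lemma l1_small:
  assumes b: "b summable_on UNIV" and e: "e > 0"
  shows "\<exists>d>0. \<forall>F :: ('m, 'c::real_normed_vector) l1. (\<forall>k. norm (lcoeff F k) \<le> b k \<and> norm (lcoeff F k) \<le> d) \<longrightarrow> norm F \<le> e"
proof -
  have "\<forall>\<^sub>F A in finite_subsets_at_top UNIV. dist (\<Sum>k\<in>A. b k) (infsum b UNIV) < e / 2"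
    using b e has_sum_infsum[OF b] unfolding has_sum_def by (intro tendstoD) auto
  then obtain A where A: "finite A" "dist (\<Sum>k\<in>A. b k) (infsum b UNIV) < e / 2"
    unfolding eventually_finite_subsets_at_top by auto
  define d where "d = e / (2 * (real (card A) + 1))"
  have d: "d > 0" "real (card A) * d \<le> e / 2" using e by (auto simp: d_def field_simps)
  have "norm F \<le> e" if F: "\<forall>k. norm (lcoeff F k) \<le> b k \<and> norm (lcoeff F k) \<le> d" for F :: "('m, 'c) l1"
  proof -
    have sF: "(\<lambda>k. norm (lcoeff F k)) summable_on B" and sb: "b summable_on B" for B
      using summable_on_subset[OF lcoeff_abs_summable[of F], of B] summable_on_subset[OF b, of B] by auto
    have "norm F = (\<Sum>\<^sub>\<infinity>k\<in>A \<union> -A. norm (lcoeff F k))" by (simp add: norm_l1_def)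
    also have "\<dots> = (\<Sum>k\<in>A. norm (lcoeff F k)) + (\<Sum>\<^sub>\<infinity>k\<in>-A. norm (lcoeff F k))"
      using A(1) by (subst infsum_Un_disjoint) (auto simp: sF)
    also have "\<dots> \<le> real (card A) * d + (\<Sum>\<^sub>\<infinity>k\<in>-A. b k)"
      by (intro add_mono sum_bounded_above infsum_mono sF sb) (use F in auto)
    also have "(\<Sum>\<^sub>\<infinity>k\<in>-A. b k) = infsum b UNIV - (\<Sum>k\<in>A. b k)"
      using infsum_Un_disjoint[OF sb[of A] sb[of "-A"]] A(1) by simp
    finally show ?thesis using d(2) A(2) unfolding dist_real_def by linarith
  qed
  then show ?thesis using d(1) by blast
qed

definition curve_in :: "'p::metric_space set \<Rightarrow> (real \<Rightarrow> 'p) \<Rightarrow> bool" where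
  "curve_in I p \<longleftrightarrow> continuous_on {0..1} p \<and> p ` {0..1} \<subseteq> I"

lemma represents_curve:
  fixes I :: "'p::metric_space set"
  assumes g: "joint_C 2 I g" and I: "compact I" and per: "\<And>p y. p \<in> I \<Longrightarrow> g p (y + 2 * pi) = g p y"
    and p: "curve_in I p"
  shows "represents (fourier_elt (\<lambda>t. g (p t))) (\<lambda>t. g (p t))"
proof -
  obtain b where b: "b summable_on UNIV" "\<forall>p\<in>I. \<forall>k. norm (rfc (g p) k) \<le> b k" using rfc_decay[OF g I per] by blast
  have "continuous_on ({0..1} \<times> UNIV) (\<lambda>x. (\<lambda>(p, y). g p y) (p (fst x), snd x))"
    by (rule continuous_on_compose2[OF joint_C_cont[OF g]])
      (use p in \<open>auto simp: curve_in_def intro!: continuous_intros continuous_on_compose2[of "{0..1}" p]\<close>)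
  then show ?thesis
    using p b per by (intro fourier_elt(1)[OF _ _ b(1)]) (auto simp: curve_in_def case_prod_unfold image_subset_iff)
qed

text \<open>The distance \<open>d\<close> does not depend on the curve, so one time step will serve
  all parameters \<open>l\<close> and \<open>m\<close>. Uniform continuity makes each coefficient of
  the difference small, and the common majorant \<open>2 * b\<close> controls the tail.\<close>

lemma fourier_elt_near:
  fixes I :: "'p::metric_space set"
  assumes g: "joint_C 2 I g" and I: "compact I" and per: "\<And>p y. p \<in> I \<Longrightarrow> g p (y + 2 * pi) = g p y"
    and p0: "p0 \<in> I" and e: "e > 0"
  shows "\<exists>d>0. \<forall>p. curve_in I p \<longrightarrow> (\<forall>t\<in>{0..1}. dist (p t) p0 < d) \<longrightarrow>
    norm (fourier_elt (\<lambda>t. g (p t)) - fourier_elt (\<lambda>t. g p0)) \<le> e"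
proof -
  obtain b where b: "b summable_on UNIV" "\<forall>p\<in>I. \<forall>k. norm (rfc (g p) k) \<le> b k" using rfc_decay[OF g I per] by blast
  have b2: "(\<lambda>k. 2 * b k) summable_on UNIV" by (rule summable_on_cmult_right[OF b(1)])
  obtain \<eta> where \<eta>: "\<eta> > 0" "\<forall>F :: fourier. (\<forall>k. norm (lcoeff F k) \<le> 2 * b k \<and> norm (lcoeff F k) \<le> \<eta>) \<longrightarrow> norm F \<le> e"
    using l1_small[OF b2 e, where ?'c="real \<Rightarrow>\<^sub>C complex"] by blast
  obtain d where d: "d > 0" "\<forall>p\<in>I. \<forall>y\<in>{-pi..pi}. dist p p0 < d \<longrightarrow> \<bar>g p y - g p0 y\<bar> \<le> \<eta>"
    using joint_C_near[OF g I p0 \<eta>(1)] by blast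
  have "norm (fourier_elt (\<lambda>t. g (p t)) - fourier_elt (\<lambda>t. g p0)) \<le> e"
    if p: "curve_in I p" and near: "\<forall>t\<in>{0..1}. dist (p t) p0 < d" for p
  proof (rule \<eta>(2)[rule_format])
    fix k
    have p': "curve_in I (\<lambda>_. p0)" using p0 by (auto simp: curve_in_def)
    note r = represents_coeff[OF represents_curve[OF g I per p]] represents_coeff[OF represents_curve[OF g I per p']]
    have pt: "p (clamp01 t) \<in> I" "dist (p (clamp01 t)) p0 < d" for t
      using p near by (auto simp: curve_in_def image_subset_iff)
    have co: "apply_bcontfun (lcoeff (fourier_elt (\<lambda>t. g (p t)) - fourier_elt (\<lambda>t. g p0)) k) t
        = rfc (g (p (clamp01 t))) k - rfc (g p0) k" for t
      by (simp add: r)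
    show "norm (lcoeff (fourier_elt (\<lambda>t. g (p t)) - fourier_elt (\<lambda>t. g p0)) k) \<le> 2 * b k \<and>
      norm (lcoeff (fourier_elt (\<lambda>t. g (p t)) - fourier_elt (\<lambda>t. g p0)) k) \<le> \<eta>"
    proof (intro conjI norm_bound; unfold co)
      fix t
      have "norm (rfc (g (p (clamp01 t))) k) \<le> b k" "norm (rfc (g p0) k) \<le> b k" using b(2) pt p0 by auto
      then show "norm (rfc (g (p (clamp01 t))) k - rfc (g p0) k) \<le> 2 * b k"
        using norm_triangle_ineq4[of "rfc (g (p (clamp01 t))) k" "rfc (g p0) k"] by linarith
      show "norm (rfc (g (p (clamp01 t))) k - rfc (g p0) k) \<le> \<eta>"
        by (subst rfc_diff[symmetric])
          (use d(2) pt in \<open>auto intro!: norm_rfc_le continuous_intros joint_C_slice[OF g] p0\<close>)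
    qed
  qed
  then show ?thesis using d(1) by blast
qed

text \<open>Without time dependence there is no supremum to take, and the summability that follows
  from one derivative is enough.\<close>

lemma represents_static:
  assumes g: "\<And>y. (g has_real_derivative g' y) (at y)" and g': "continuous_on UNIV g'" and per: "\<And>y. g (y + 2 * pi) = g y"
  shows "represents (fourier_elt (\<lambda>t. g)) (\<lambda>t. g)"
proof (rule fourier_elt(1))
  have "continuous_on UNIV g" using g DERIV_continuous_on by (metis DERIV_isCont continuous_at_imp_continuous_on)
  then have "continuous_on ({0..1} \<times> UNIV) (\<lambda>x :: real \<times> real. g (snd x))"
    by (rule continuous_on_compose2) (auto intro!: continuous_intros)
  then show "continuous_on ({0..1} \<times> UNIV) (\<lambda>(t :: real, y). g y)" by (simp add: case_prod_unfold)
  show "(\<lambda>k. norm (rfc g k)) summable_on UNIV"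
    unfolding rfc_def by (rule fourier_coeff_summable_C1[where g'="\<lambda>y. of_real (g' y)"])
      (auto intro!: has_vector_derivative_of_real g continuous_intros g' simp: per)
qed (auto simp: per)

section \<open>The equation in conservation form\<close>

lemma periodic_value_in_period:
  assumes "continuous_on UNIV f" "periodic_2pi f"
  shows "\<exists>y\<in>{-pi..pi}. f y = f x"
proof (rule bexI[of _ "Arg (cis x)"])
  show "f (Arg (cis x)) = f x"
    by (rule continuous_on_circle_lift(2)[OF assms(1)]) (use assms(2) in \<open>simp add: periodic_2pi_def\<close>)
qed (use Arg_bounded[of "cis x"] in auto)

section \<open>Derivatives in Hoelder spaces and joint regularity of solutions\<close>

lemma hoelder_space_deriv:
  assumes f: "f \<in> hoelder_space k a" and j: "j < k"
  shows "((deriv ^^ j) f has_real_derivative (deriv ^^ Suc j) f x) (at x)"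
  using assms by (simp add: hoelder_space_def DERIV_deriv_iff_real_differentiable)

lemma hoelder_space_continuous:
  assumes f: "f \<in> hoelder_space k a" and j: "j \<le> k"
  shows "continuous_on UNIV ((deriv ^^ j) f)"
proof (cases "j = k")
  case True
  then show ?thesis using f by (simp add: hoelder_space_def)
next
  case False
  then have "j < k" using j by simp
  then show ?thesis
    using hoelder_space_deriv[OF f] by (meson DERIV_isCont continuous_at_imp_continuous_on)
qed

lemma hoelder_space_periodic:
  assumes f: "f \<in> hoelder_space k a" and j: "j \<le> k"
  shows "periodic_2pi ((deriv ^^ j) f)"
  using j
proof (induction j)
  case 0
  then show ?case using f by (simp add: hoelder_space_def)
next
  case (Suc j)
  show ?case
    unfolding periodic_2pi_def
  proof
    fix x
    show "(deriv ^^ Suc j) f (x + 2 * pi) = (deriv ^^ Suc j) f x"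
      by (rule periodic_deriv[OF hoelder_space_deriv[OF f, of j]]) (use Suc in \<open>auto simp: periodic_2pi_def\<close>)
  qed
qed

lemma hoelder_space_deriv_diff:
  assumes f: "f \<in> hoelder_space k a" and g: "g \<in> hoelder_space k a" and j: "j \<le> k"
  shows "(deriv ^^ j) (\<lambda>x. f x - g x) = (\<lambda>x. (deriv ^^ j) f x - (deriv ^^ j) g x)"
  using j
proof (induction j)
  case (Suc j)
  then have "(deriv ^^ Suc j) (\<lambda>x. f x - g x) = deriv (\<lambda>x. (deriv ^^ j) f x - (deriv ^^ j) g x)" by simp
  also have "\<dots> = (\<lambda>x. (deriv ^^ Suc j) f x - (deriv ^^ Suc j) g x)"
    using hoelder_space_deriv[OF f, of j] hoelder_space_deriv[OF g, of j] Suc.prems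
    by (intro ext DERIV_imp_deriv DERIV_diff) (simp_all add: Suc_le_eq)
  finally show ?case .
qed simp

lemma pairs_T_0_1: "(0, 1) \<in> pairs_T"
  using pi_gt3 by (auto simp: pairs_T_def dist_T_def)

text \<open>A supremum of reals bounds the members only of a set that is bounded above, so
  boundedness is established for every term of the norm; as all terms are nonnegative, one can be
  singled out. Periodicity carries the bound beyond [-pi, pi].\<close>

lemma deriv_diff_le_hoelder_norm:
  assumes f: "f \<in> hoelder_space k a" and g: "g \<in> hoelder_space k a" and j: "j \<le> k"
  shows "\<bar>(deriv ^^ j) f x - (deriv ^^ j) g x\<bar> \<le> hoelder_norm k a (\<lambda>x. f x - g x)"
proof -
  let ?d = "\<lambda>i x. (deriv ^^ i) f x - (deriv ^^ i) g x"
  have c: "continuous_on UNIV (?d i)" if "i \<le> k" for i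
    by (intro continuous_intros hoelder_space_continuous[OF f that] hoelder_space_continuous[OF g that])
  have bd: "bdd_above ((\<lambda>x. \<bar>?d i x\<bar>) ` {-pi..pi})" if "i \<le> k" for i
    by (intro compact_imp_bounded bounded_imp_bdd_above compact_continuous_image continuous_intros continuous_on_subset[OF c[OF that]]) auto
  have nn: "0 \<le> (SUP x\<in>{-pi..pi}. \<bar>?d i x\<bar>)" if "i \<le> k" for i
    by (rule cSUP_upper2[OF bd[OF that], of 0]) auto
  have q: "hoelder_quot a (?d k) p \<le> hoelder_quot a ((deriv ^^ k) f) p + hoelder_quot a ((deriv ^^ k) g) p" for p
  proof -
    obtain x y where p: "p = (x, y)" by (cases p)
    have "\<bar>?d k x - ?d k y\<bar> \<le> \<bar>(deriv ^^ k) f x - (deriv ^^ k) f y\<bar> + \<bar>(deriv ^^ k) g x - (deriv ^^ k) g y\<bar>" by linarith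
    then show ?thesis unfolding p hoelder_quot_def split add_divide_distrib[symmetric] by (intro divide_right_mono) auto
  qed
  obtain A where A: "\<forall>p\<in>pairs_T. hoelder_quot a ((deriv ^^ k) f) p \<le> A"
    using f unfolding hoelder_space_def bdd_above_def by blast
  obtain B where B: "\<forall>p\<in>pairs_T. hoelder_quot a ((deriv ^^ k) g) p \<le> B"
    using g unfolding hoelder_space_def bdd_above_def by blast
  have bq: "bdd_above (hoelder_quot a (?d k) ` pairs_T)"
    by (rule bdd_aboveI2[where M="A + B"], rule order_trans[OF q]) (use A B in \<open>auto intro: add_mono\<close>)
  have nq: "0 \<le> (SUP p\<in>pairs_T. hoelder_quot a (?d k) p)"
    by (rule cSUP_upper2[OF bq pairs_T_0_1]) (auto simp: hoelder_quot_def)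
  have per: "periodic_2pi (?d j)"
    using hoelder_space_periodic[OF f j] hoelder_space_periodic[OF g j] by (simp add: periodic_2pi_def)
  obtain y where y: "y \<in> {-pi..pi}" "?d j y = ?d j x" using periodic_value_in_period[OF c[OF j] per] by blast
  have "\<bar>?d j x\<bar> \<le> (SUP x\<in>{-pi..pi}. \<bar>?d j x\<bar>)"
    using cSUP_upper[OF y(1) bd[OF j]] y(2) by simp
  also have "\<dots> \<le> (\<Sum>i\<le>k. SUP x\<in>{-pi..pi}. \<bar>?d i x\<bar>)"
    by (rule member_le_sum[where f="\<lambda>i. SUP x\<in>{-pi..pi}. \<bar>?d i x\<bar>"]) (use j nn in auto)
  also have "\<dots> \<le> hoelder_norm k a (\<lambda>x. f x - g x)"
    unfolding hoelder_norm_def using nq by (simp add: hoelder_space_deriv_diff[OF f g])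
  finally show ?thesis .
qed

text \<open>Continuity of the curve in the norm of order \<open>4 + \<alpha>\<close> controls the
  derivatives of \<open>r s - r t\<close> uniformly in \<open>x\<close>; together with the
  continuity of the single slice at \<open>t\<close> this gives joint continuity. It is used at
  positive times, hence the set \<open>J\<close>.\<close>

lemma ASD_solution_regular:
  assumes sol: "ASD_solution \<alpha> \<mu> r0 a r"
  defines "J \<equiv> {t. 0 < t \<and> ereal t < a}"
  shows "joint_C 4 J r" "\<And>t x. t \<in> J \<Longrightarrow> r t (x + 2 * pi) = r t x" "\<And>t x. t \<in> J \<Longrightarrow> r t x > 0"
    "\<And>t x. t \<in> J \<Longrightarrow> ((\<lambda>s. r s x) has_real_derivative ASD_rhs (r t) x) (at t)"
proof -
  have J: "time_interval a - {0} = J" by (auto simp: J_def time_interval_def)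
  have cc: "cont_curve (little_hoelder 4 \<alpha>) (hoelder_norm 4 \<alpha>) J r"
    using sol unfolding ASD_solution_def C_weighted_def J by blast
  have h: "r t \<in> hoelder_space 4 \<alpha>" if "t \<in> J" for t
    using cc that by (auto simp: cont_curve_def little_hoelder_def)
  show "r t (x + 2 * pi) = r t x" if "t \<in> J" for t x
    using h[OF that] by (auto simp: hoelder_space_def periodic_2pi_def)
  show "r t x > 0" if "t \<in> J" for t x
    using sol that J unfolding ASD_solution_def by blast
  show "((\<lambda>s. r s x) has_real_derivative ASD_rhs (r t) x) (at t)" if "t \<in> J" for t x
    using sol that J unfolding ASD_solution_def by blast
  have cont: "continuous_on (J \<times> UNIV) (\<lambda>(t, x). (deriv ^^ j) (r t) x)" if j: "j \<le> 4" for j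
    unfolding continuous_on_def
  proof (intro ballI)
    fix z assume z: "z \<in> J \<times> (UNIV :: real set)"
    obtain t x where zt: "z = (t, x)" by (cases z)
    then have t: "t \<in> J" using z by simp
    let ?F = "at z within J \<times> UNIV"
    have f1: "(fst \<longlongrightarrow> t) ?F" using tendsto_fst[OF tendsto_ident_at, of z "J \<times> UNIV"] zt by simp
    have "((\<lambda>s. hoelder_norm 4 \<alpha> (\<lambda>x. r s x - r t x)) \<longlongrightarrow> 0) (at t within J)"
      using cc t by (simp add: cont_curve_def)
    moreover have norm0: "hoelder_norm 4 \<alpha> (\<lambda>x. r t x - r t x) = 0"
    proof -
      have d0: "(deriv ^^ i) (\<lambda>x. 0) = (\<lambda>x. 0 :: real)" for i by (induction i) auto
      have "hoelder_quot \<alpha> (\<lambda>x. 0) = (\<lambda>p. 0)" by (auto simp: hoelder_quot_def fun_eq_iff)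
      moreover have "pairs_T \<noteq> {}" using pairs_T_0_1 by blast
      ultimately show ?thesis by (simp add: hoelder_norm_def d0)
    qed
    ultimately have "continuous (at t within J) (\<lambda>s. hoelder_norm 4 \<alpha> (\<lambda>x. r s x - r t x))"
      by (simp add: continuous_within)
    moreover have "\<forall>\<^sub>F z in ?F. fst z \<in> J"
      unfolding eventually_at_filter by (rule always_eventually) auto
    ultimately have "((\<lambda>z. hoelder_norm 4 \<alpha> (\<lambda>x. r (fst z) x - r t x)) \<longlongrightarrow> hoelder_norm 4 \<alpha> (\<lambda>x. r t x - r t x)) ?F"
      using f1 by (rule continuous_within_tendsto_compose)
    then have "((\<lambda>z. hoelder_norm 4 \<alpha> (\<lambda>x. r (fst z) x - r t x)) \<longlongrightarrow> 0) ?F"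
      by (simp only: norm0)
    moreover have "((\<lambda>z. (deriv ^^ j) (r t) (snd z)) \<longlongrightarrow> (deriv ^^ j) (r t) x) ?F"
    proof -
      have "isCont ((deriv ^^ j) (r t)) x"
        using hoelder_space_continuous[OF h[OF t] j] by (simp add: continuous_on_eq_continuous_at)
      moreover have "(snd \<longlongrightarrow> x) ?F" using tendsto_snd[OF tendsto_ident_at, of z "J \<times> UNIV"] zt by simp
      ultimately show ?thesis by (rule isCont_tendsto_compose)
    qed
    ultimately have lim: "((\<lambda>z. hoelder_norm 4 \<alpha> (\<lambda>x. r (fst z) x - r t x) + \<bar>(deriv ^^ j) (r t) (snd z) - (deriv ^^ j) (r t) x\<bar>) \<longlongrightarrow> 0 + \<bar>(deriv ^^ j) (r t) x - (deriv ^^ j) (r t) x\<bar>) ?F"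
      unfolding o_def by (intro tendsto_intros)
    have "((\<lambda>z. (deriv ^^ j) (r (fst z)) (snd z) - (deriv ^^ j) (r t) x) \<longlongrightarrow> 0) ?F"
    proof (rule Lim_null_comparison[OF _ lim[simplified]])
      show "\<forall>\<^sub>F z in ?F. norm ((deriv ^^ j) (r (fst z)) (snd z) - (deriv ^^ j) (r t) x) \<le>
          hoelder_norm 4 \<alpha> (\<lambda>x. r (fst z) x - r t x) + \<bar>(deriv ^^ j) (r t) (snd z) - (deriv ^^ j) (r t) x\<bar>"
        unfolding eventually_at_filter
      proof (rule always_eventually, intro allI impI)
        fix z assume "z \<in> J \<times> (UNIV :: real set)"
        then have "fst z \<in> J" by auto
        from deriv_diff_le_hoelder_norm[OF h[OF this] h[OF t] j, of "snd z"]
        show "norm ((deriv ^^ j) (r (fst z)) (snd z) - (deriv ^^ j) (r t) x) \<le>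
          hoelder_norm 4 \<alpha> (\<lambda>x. r (fst z) x - r t x) + \<bar>(deriv ^^ j) (r t) (snd z) - (deriv ^^ j) (r t) x\<bar>"
          by simp
      qed
    qed
    then show "((\<lambda>(t, x). (deriv ^^ j) (r t) x) \<longlongrightarrow> (case z of (t, x) \<Rightarrow> (deriv ^^ j) (r t) x)) ?F"
      unfolding zt by (simp add: case_prod_unfold Lim_null[symmetric])
  qed
  \<comment> \<open>The induction starts from the fourth derivative, as \<open>joint_C\<close>
    counts the derivatives still available.\<close>
  have "joint_C i J (\<lambda>t. (deriv ^^ (4 - i)) (r t))" if "i \<le> 4" for i
    using that
  proof (induction i)
    case 0
    then show ?case using cont[of 4] by simp
  next
    case (Suc i)
    show ?case
    proof (rule joint_C_SucI[OF _ _ Suc.IH])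
      have s: "4 - i = Suc (4 - Suc i)" using Suc.prems by simp
      show "((deriv ^^ (4 - Suc i)) (r t) has_real_derivative (deriv ^^ (4 - i)) (r t) x) (at x)" if "t \<in> J" for t x
        unfolding s by (rule hoelder_space_deriv[OF h[OF that]]) simp
    qed (use Suc.prems cont in auto)
  qed
  from this[of 4] show "joint_C 4 J r" by simp
qed

section \<open>Divergence form of the surface diffusion operator\<close>

lemma mean_curvature_flux_algebra:
  fixes f f1 f2 f3 s :: real
  assumes "f \<noteq> 0" "s \<noteq> 0"
  shows "f / s * (- (f1 * s + f * (f1 * f2 / s)) / (f * s)\<^sup>2 - (f3 * s ^ 3 - f2 * (3 * s\<^sup>2 * (f1 * f2 / s))) / (s ^ 3)\<^sup>2)
    = - (1/2) * ((2 * (f1 * f2 + f * f3) / (s\<^sup>2)\<^sup>2 - 8 * f * f1 * f2\<^sup>2 / (s\<^sup>2) ^ 3)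
        + (2 * f1 / (f * s\<^sup>2) + 2 * f * f1 * f2\<^sup>2 / (s\<^sup>2) ^ 3))"
  using assms by (simp add: field_simps eval_nat_numeral)

text \<open>The flux is \<open>- 1/2\<close> times the sum of the derivative of
  \<open>2 r r\<^sub>x\<^sub>x / (1 + r\<^sub>x\<^sup>2)\<^sup>2\<close>, written out, and of
  \<open>\<Gamma>\<^sub>1\<close>. In terms of \<open>s = sqrt (1 + r\<^sub>x\<^sup>2)\<close>,
  whose derivative is \<open>r\<^sub>x r\<^sub>x\<^sub>x / s\<close>, this is a rational
  identity.\<close>

lemma mean_curvature_flux:
  fixes f f1 f2 f3 :: "real \<Rightarrow> real"
  assumes pos: "\<And>x. f x > 0"
    and f: "\<And>x. (f has_real_derivative f1 x) (at x)" "\<And>x. (f1 has_real_derivative f2 x) (at x)"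
      "\<And>x. (f2 has_real_derivative f3 x) (at x)"
  shows "f x / sqrt (1 + (deriv f x)\<^sup>2) * deriv (mean_curv f) x =
      - (1/2) * ((2 * (f1 x * f2 x + f x * f3 x) / (1 + (f1 x)\<^sup>2)\<^sup>2 - 8 * f x * f1 x * (f2 x)\<^sup>2 / (1 + (f1 x)\<^sup>2) ^ 3)
        + (2 * f1 x / (f x * (1 + (f1 x)\<^sup>2)) + 2 * f x * f1 x * (f2 x)\<^sup>2 / (1 + (f1 x)\<^sup>2) ^ 3))"
proof -
  define s where "s x = sqrt (1 + (f1 x)\<^sup>2)" for x
  have w: "1 + (f1 x)\<^sup>2 > 0" for x by (simp add: add_pos_nonneg)
  have s: "s x > 0" "(s x)\<^sup>2 = 1 + (f1 x)\<^sup>2" for x using w[of x] by (simp_all add: s_def)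
  have d: "deriv f = f1" "deriv f1 = f2" using f DERIV_imp_deriv by blast+
  have p: "(1 + (f1 x)\<^sup>2) powr (3 / 2) = s x ^ 3" for x
  proof -
    have "(1 + (f1 x)\<^sup>2) powr (3 / 2) = (1 + (f1 x)\<^sup>2) powr (1 / 2 + 1)" by simp
    also have "\<dots> = (1 + (f1 x)\<^sup>2) powr (1 / 2) * (1 + (f1 x)\<^sup>2)" using w[of x] by (simp only: powr_add powr_one)
    also have "\<dots> = s x * (s x)\<^sup>2" using w[of x] by (simp add: powr_half_sqrt s(2) s_def)
    finally show ?thesis by (simp add: power3_eq_cube power2_eq_square)
  qed
  have mc: "mean_curv f = (\<lambda>x. 1 / (f x * s x) - f2 x / s x ^ 3)"
    by (rule ext) (simp only: mean_curv_def d p s_def)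
  have ds: "(s has_real_derivative (f1 x * f2 x / s x)) (at x)" for x
    unfolding s_def using w[of x] by (auto intro!: derivative_eq_intros f simp: field_simps)
  have "((\<lambda>x. 1 / (f x * s x) - f2 x / s x ^ 3) has_real_derivative
     - (f1 x * s x + f x * (f1 x * f2 x / s x)) / (f x * s x)\<^sup>2 - (f3 x * s x ^ 3 - f2 x * (3 * (s x)\<^sup>2 * (f1 x * f2 x / s x))) / (s x ^ 3)\<^sup>2) (at x)"
    using s(1)[of x] pos[of x]
    by (auto intro!: derivative_eq_intros f ds simp: power2_eq_square algebra_simps)
  then have "deriv (mean_curv f) x =
     - (f1 x * s x + f x * (f1 x * f2 x / s x)) / (f x * s x)\<^sup>2 - (f3 x * s x ^ 3 - f2 x * (3 * (s x)\<^sup>2 * (f1 x * f2 x / s x))) / (s x ^ 3)\<^sup>2"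
    unfolding mc by (rule DERIV_imp_deriv)
  then show ?thesis
    unfolding d s_def[symmetric] s(2)[symmetric]
    using mean_curvature_flux_algebra[of "f x" "s x" "f1 x" "f2 x" "f3 x"] s(1)[of x] pos[of x] by simp
qed

text \<open>The factor \<open>2 * f x\<close>, which the time derivative of a square supplies,
  cancels the \<open>1 / f x\<close> in front of the divergence. The fourth derivative of
  \<open>f\<close> is never named: it enters through the derivative of \<open>h\<close>, and
  \<open>h\<close> agrees with the explicit formula by uniqueness of derivatives.\<close>

lemma ASD_rhs_divergence:
  fixes f f1 f2 f3 :: "real \<Rightarrow> real"
  assumes pos: "\<And>x. f x > 0"
    and f: "\<And>x. (f has_real_derivative f1 x) (at x)" "\<And>x. (f1 has_real_derivative f2 x) (at x)"
      "\<And>x. (f2 has_real_derivative f3 x) (at x)"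
    and g2: "\<And>x. ((\<lambda>x. 2 * f x * f2 x / (1 + (f1 x)\<^sup>2)\<^sup>2) has_real_derivative h x) (at x)"
    and h: "(h has_real_derivative h') (at x)"
    and g1: "((\<lambda>x. 2 * f1 x / (f x * (1 + (f1 x)\<^sup>2)) + 2 * f x * f1 x * (f2 x)\<^sup>2 / (1 + (f1 x)\<^sup>2) ^ 3) has_real_derivative g1') (at x)"
  shows "2 * f x * ASD_rhs f x = - (h' + g1')"
proof -
  have w: "1 + (f1 x)\<^sup>2 > 0" for x by (simp add: add_pos_nonneg)
  have "((\<lambda>x. 2 * f x * f2 x / (1 + (f1 x)\<^sup>2)\<^sup>2) has_real_derivative
      (2 * (f1 x * f2 x + f x * f3 x) / (1 + (f1 x)\<^sup>2)\<^sup>2 - 8 * f x * f1 x * (f2 x)\<^sup>2 / (1 + (f1 x)\<^sup>2) ^ 3)) (at x)" for x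
  proof -
    define v where "v x = 1 + (f1 x)\<^sup>2" for x
    have v: "v x \<noteq> 0" using w[of x] by (simp add: v_def)
    have dv: "(v has_real_derivative 2 * f1 x * f2 x) (at x)"
      unfolding v_def by (auto intro!: derivative_eq_intros f)
    show ?thesis unfolding v_def[symmetric] using v
      by (auto intro!: derivative_eq_intros f dv simp: field_simps eval_nat_numeral)
  qed
  then have hx: "h x = 2 * (f1 x * f2 x + f x * f3 x) / (1 + (f1 x)\<^sup>2)\<^sup>2 - 8 * f x * f1 x * (f2 x)\<^sup>2 / (1 + (f1 x)\<^sup>2) ^ 3" for x
    using g2 DERIV_unique by blast
  have fl: "(\<lambda>y. f y / sqrt (1 + (deriv f y)\<^sup>2) * deriv (mean_curv f) y) = (\<lambda>x. - (1/2) * (h x +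
      (2 * f1 x / (f x * (1 + (f1 x)\<^sup>2)) + 2 * f x * f1 x * (f2 x)\<^sup>2 / (1 + (f1 x)\<^sup>2) ^ 3)))"
    unfolding hx by (rule ext) (rule mean_curvature_flux[OF pos f])
  have "deriv (\<lambda>y. f y / sqrt (1 + (deriv f y)\<^sup>2) * deriv (mean_curv f) y) x = - (1/2) * (h' + g1')"
    unfolding fl by (rule DERIV_imp_deriv) (rule DERIV_cmult[OF DERIV_add[OF h g1]])
  then show ?thesis using pos[of x] by (simp add: ASD_rhs_def)
qed

text \<open>\<open>\<psi>\<close> inverts a primitive of \<open>c * q\<close>; for
  \<open>q = sqrt (1 + r\<^sub>x\<^sup>2)\<close> this is scaled arclength. The scale
  \<open>c\<close> gives one period the length \<open>2 * pi\<close>, so that \<open>\<psi>\<close>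
  commutes with the shift by \<open>2 * pi\<close> and composition with it preserves
  periodicity.\<close>

lemma arclength_parametrization:
  fixes q :: "real \<Rightarrow> real"
  assumes q: "joint_C 3 {0 :: real} (\<lambda>_. q)" and pos: "\<And>x. q x > 0" and per: "\<And>x. q (x + 2 * pi) = q x"
  shows "\<exists>c>0. \<exists>\<psi>. joint_C 4 {0 :: real} (\<lambda>_. \<psi>) \<and> (\<forall>y. (\<psi> has_real_derivative inverse (c * q (\<psi> y))) (at y)) \<and>
    (\<forall>y. \<psi> (y + 2 * pi) = \<psi> y + 2 * pi) \<and> (\<forall>x. \<exists>y. \<psi> y = x)"
proof -
  have cq: "continuous_on UNIV q" by (rule joint_C_slice[OF q]) simp
  obtain \<Phi> where \<Phi>: "\<And>x. (\<Phi> has_real_derivative q x) (at x)"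
    using einterval_antiderivative[of "-\<infinity>" \<infinity> q] cq
    by (auto simp: continuous_on_eq_continuous_at has_real_derivative_iff_has_vector_derivative)
  define P where "P = \<Phi> (0 + 2 * pi) - \<Phi> 0"
  have "\<Phi> 0 < \<Phi> (2 * pi)"
    by (rule DERIV_pos_imp_increasing) (use \<Phi> pos in auto)
  then have P: "P > 0" by (simp add: P_def)
  have \<Phi>P: "\<Phi> (x + 2 * pi) - \<Phi> x = P" for x
  proof -
    have "((\<lambda>x. \<Phi> (x + 2 * pi) - \<Phi> x) has_real_derivative 0) (at x)" for x
      using DERIV_diff[OF _ \<Phi>[of x], of "\<lambda>x. \<Phi> (x + 2 * pi)" "q (x + 2 * pi)"] \<Phi>[of "x + 2 * pi"]
      by (simp add: DERIV_shift per)
    then show ?thesis unfolding P_def by (intro DERIV_isconst_all) blast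
  qed
  define c where "c = 2 * pi / P"
  define \<phi> where "\<phi> x = c * \<Phi> x" for x
  have c: "c > 0" using P by (simp add: c_def)
  have d\<phi>: "(\<phi> has_real_derivative c * q x) (at x)" for x unfolding \<phi>_def by (rule DERIV_cmult[OF \<Phi>])
  have c\<phi>: "isCont \<phi> x" for x by (rule DERIV_isCont[OF d\<phi>])
  have \<phi>2: "\<phi> (x + 2 * pi) = \<phi> x + 2 * pi" for x
    using \<Phi>P[of x] P by (simp add: \<phi>_def c_def field_simps)
  have mono: "x < y \<Longrightarrow> \<phi> x < \<phi> y" for x y
    by (rule DERIV_pos_imp_increasing) (use d\<phi> pos c in \<open>auto intro: mult_pos_pos\<close>)
  have inj: "inj \<phi>" by (rule injI) (metis mono less_irrefl linorder_neqE)
  have shift: "\<phi> (x + 2 * pi * real n) = \<phi> x + 2 * pi * real n" "\<phi> (x - 2 * pi * real n) = \<phi> x - 2 * pi * real n" for x n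
  proof (induction n)
    case (Suc n)
    {
      case 1
      show ?case using \<phi>2[of "x + 2 * pi * real n"] Suc(1) by (simp add: algebra_simps)
    next
      case 2
      show ?case using \<phi>2[of "x - 2 * pi * real (Suc n)"] Suc(2) by (simp add: algebra_simps)
    }
  qed simp_all
  have surj: "\<exists>x. \<phi> x = y" for y
  proof -
    obtain n where n: "real n \<ge> \<bar>y - \<phi> 0\<bar>" using real_arch_simple by blast
    have "real n \<le> 2 * pi * real n" using pi_gt3 by (cases "n = 0") auto
    then have "\<phi> (0 - 2 * pi * real n) \<le> y" "y \<le> \<phi> (0 + 2 * pi * real n)"
      unfolding shift using n by linarith+
    then show ?thesis
      using IVT[of \<phi> "0 - 2 * pi * real n" y "0 + 2 * pi * real n"] c\<phi> by auto
  qed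
  define \<psi> where "\<psi> = inv \<phi>"
  have \<phi>\<psi>: "\<phi> (\<psi> y) = y" for y using surj unfolding \<psi>_def by (metis f_inv_into_f rangeI)
  have \<psi>\<phi>: "\<psi> (\<phi> x) = x" for x unfolding \<psi>_def by (rule inv_f_f[OF inj])
  have cont\<psi>: "isCont \<psi> y" for y
    using isCont_inverse_function2[of "\<psi> y - 1" "\<psi> y" "\<psi> y + 1" \<psi> \<phi>] \<psi>\<phi> c\<phi> \<phi>\<psi>[of y] by simp
  have d\<psi>: "(\<psi> has_real_derivative inverse (c * q (\<psi> y))) (at y)" for y
    by (rule DERIV_inverse_function[OF d\<phi>, of _ _ "y - 1" "y + 1"])
      (use cont\<psi> \<phi>\<psi> c pos[of "\<psi> y"] in auto)
  have \<psi>2: "\<psi> (y + 2 * pi) = \<psi> y + 2 * pi" for y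
    using \<psi>\<phi>[of "\<psi> y + 2 * pi"] unfolding \<phi>2 \<phi>\<psi> .
  \<comment> \<open>Bootstrapping in the equation for the derivative of \<open>\<psi>\<close>: the
    right-hand side is as smooth as \<open>q\<close> and \<open>\<psi>\<close> permit, so
    \<open>\<psi>\<close> gains one derivative over \<open>q\<close>.\<close>
  have "joint_C n {0 :: real} (\<lambda>_. \<psi>)" if "n \<le> 4" for n
    using that
  proof (induction n)
    case 0
    have "continuous_on UNIV \<psi>" using cont\<psi> by (simp add: continuous_at_imp_continuous_on)
    then have "continuous_on ({0 :: real} \<times> UNIV) (\<lambda>x :: real \<times> real. \<psi> (snd x))"
      by (rule continuous_on_compose2) (auto intro!: continuous_intros)
    then show ?case by (simp add: case_prod_unfold)
  next
    case (Suc n)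
    have IH: "joint_C n {0 :: real} (\<lambda>_. \<psi>)" using Suc by simp
    have qn: "joint_C n {0 :: real} (\<lambda>_. q)" by (rule joint_C_le[OF q]) (use Suc.prems in simp)
    have "joint_C n {0 :: real} (\<lambda>_ y. inverse (c * q (\<psi> y)))"
      by (intro joint_C_inverse joint_C_mult joint_C_const joint_C_compose[OF qn IH, of "\<lambda>_. 0"]) (use c pos[of "\<psi> _"] in \<open>auto simp: less_imp_neq[symmetric]\<close>)
    then show ?case by (intro joint_C_SucI[OF joint_C_cont[OF IH] d\<psi>])
  qed
  moreover have "\<exists>y. \<psi> y = x" for x using \<psi>\<phi> by blast
  ultimately show ?thesis using c d\<psi> \<psi>2 by (intro exI[of _ c] conjI exI[of _ \<psi>]) auto
qed

section \<open>The pulled-back evolution\<close>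

text \<open>The Fourier series is summed for each power separately; the result is a coefficient in
  the power series of the value at \<open>(t, y)\<close>.\<close>

definition formal_coeff :: "real \<Rightarrow> real \<Rightarrow> formal \<Rightarrow> nat \<times> nat \<Rightarrow> complex" where
  "formal_coeff t y Q i = (\<Sum>\<^sub>\<infinity>k. apply_bcontfun (lcoeff (lcoeff Q k) i) t * cis (of_int k * y))"

text \<open>The double family over modes and powers is absolutely summable, as the weights and
  \<open>cis\<close> are bounded by one. Summation in both orders exchanges the Fourier series with
  the power series.\<close>

lemma formal_power_series:
  assumes lm: "\<bar>l\<bar> \<le> 1" "\<bar>m\<bar> \<le> 1"
  shows "((\<lambda>i. formal_coeff t y Q i * of_real (l ^ fst i * m ^ snd i)) has_sum point_eval t y (ev_formal l m Q)) UNIV"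
proof -
  define F where "F = (\<lambda>(k, i). apply_bcontfun (lcoeff (lcoeff Q k) i) t * cis (of_int k * y) * of_real (l ^ fst i * m ^ snd i))"
  have wle: "\<bar>l ^ fst i * m ^ snd i\<bar> \<le> 1" for i :: "nat \<times> nat"
    using mult_mono[OF power_le_one[of "\<bar>l\<bar>" "fst i"] power_le_one[of "\<bar>m\<bar>" "snd i"]] lm
    by (simp add: abs_mult power_abs)
  have le: "norm (F (k, i)) \<le> norm (lcoeff (lcoeff Q k) i)" for k i
    using mult_mono[OF norm_bounded[of "lcoeff (lcoeff Q k) i" t] wle[of i]]
    by (simp add: F_def norm_mult[of "_ * _"] norm_mult[of _ "cis _"] del: of_real_mult of_real_power)
  have s: "(\<lambda>(k, i). norm (lcoeff (lcoeff Q k) i)) summable_on UNIV \<times> UNIV"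
  proof (rule summable_on_SigmaI[where g="\<lambda>k. norm (lcoeff Q k)"])
    show "((\<lambda>i. case (k, i) of (k, i) \<Rightarrow> norm (lcoeff (lcoeff Q k) i)) has_sum norm (lcoeff Q k)) UNIV" for k
      unfolding norm_l1_def split by (rule has_sum_infsum[OF lcoeff_abs_summable])
  qed (auto simp: lcoeff_abs_summable)
  have "(\<lambda>p. norm (F p)) summable_on UNIV \<times> UNIV"
    by (rule summable_on_comparison_test[OF s]) (auto intro: le)
  then have sF: "F summable_on UNIV \<times> UNIV" by (rule abs_summable_summable)
  then obtain S where S: "(F has_sum S) (UNIV \<times> UNIV)" by (auto simp: summable_on_def)
  have "((\<lambda>i. F (k, i)) has_sum apply_bcontfun (ev_coefficient l m (lcoeff Q k)) t * cis (of_int k * y)) UNIV" for k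
  proof -
    have "((\<lambda>i. lcoeff (lcoeff Q k) i * ev_weight l m i) has_sum ev_coefficient l m (lcoeff Q k)) UNIV"
      unfolding ev_coefficient_def by (rule l1_eval_bounds(2)[OF nhom_id norm_ev_weight_le[OF lm]])
    from has_sum_cmult_left[OF has_sum_bounded_linear[OF nhomD(9)[OF nhom_apply_bcontfun[of t]] this], of "cis (of_int k * y)"]
    have "((\<lambda>i. apply_bcontfun (lcoeff (lcoeff Q k) i * ev_weight l m i) t * cis (of_int k * y)) has_sum
        apply_bcontfun (ev_coefficient l m (lcoeff Q k)) t * cis (of_int k * y)) UNIV" .
    moreover have "apply_bcontfun (lcoeff (lcoeff Q k) i * ev_weight l m i) t * cis (of_int k * y) = F (k, i)" for i
    proof -
      have "apply_bcontfun (ev_weight l m i) t = of_real (l ^ fst i * m ^ snd i)"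
        by (simp add: ev_weight_def case_prod_unfold of_real_def apply_one_bcontfun)
      then show ?thesis by (simp add: F_def apply_times_bcontfun)
    qed
    ultimately show ?thesis by simp
  qed
  from has_sum_SigmaD[OF S this]
  have "((\<lambda>k. apply_bcontfun (ev_coefficient l m (lcoeff Q k)) t * cis (of_int k * y)) has_sum S) UNIV" by simp
  then have Seq: "S = point_eval t y (ev_formal l m Q)"
    using point_eval_has_sum[of "ev_formal l m Q" t y] has_sum_unique by (simp add: nhom_ev_formal[OF lm]) blast
  have "((\<lambda>(i, k). F (k, i)) has_sum S) (UNIV \<times> UNIV)"
    using S by (subst has_sum_swap) (simp add: case_prod_unfold)
  moreover have "((\<lambda>k. (\<lambda>(i, k). F (k, i)) (i, k)) has_sum formal_coeff t y Q i * of_real (l ^ fst i * m ^ snd i)) UNIV" for i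
  proof -
    have "(\<lambda>k. norm (apply_bcontfun (lcoeff (lcoeff Q k) i) t * cis (of_int k * y))) summable_on UNIV"
    proof (rule summable_on_comparison_test[OF lcoeff_abs_summable[of Q]])
      show "norm (apply_bcontfun (lcoeff (lcoeff Q k) i) t * cis (of_int k * y)) \<le> norm (lcoeff Q k)" for k
        using norm_bounded[of "lcoeff (lcoeff Q k) i" t] norm_lcoeff_le[of "lcoeff Q k" i] by (simp add: norm_mult)
    qed simp
    then have "((\<lambda>k. apply_bcontfun (lcoeff (lcoeff Q k) i) t * cis (of_int k * y)) has_sum formal_coeff t y Q i) UNIV"
      unfolding formal_coeff_def by (intro has_sum_infsum) (rule abs_summable_summable)
    from has_sum_cmult_left[OF this] show ?thesis by (simp add: F_def)
  qed
  ultimately have "((\<lambda>i. formal_coeff t y Q i * of_real (l ^ fst i * m ^ snd i)) has_sum S) UNIV"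
    by (rule has_sum_SigmaD)
  then show ?thesis unfolding Seq .
qed

lemma rfc_time_derivative:
  assumes d: "\<And>t y. t \<in> {0..1} \<Longrightarrow> ((\<lambda>t. g t y) has_real_derivative g' t y) (at t within {0..1})"
    and g: "\<And>t. t \<in> {0..1} \<Longrightarrow> continuous_on {-pi..pi} (g t)"
    and g': "continuous_on ({0..1} \<times> {-pi..pi}) (\<lambda>(t, y). g' t y)" and t: "t \<in> {0..1}"
  shows "((\<lambda>t. rfc (g t) k) has_vector_derivative rfc (g' t) k) (at t within {0..1})"
proof -
  have "((\<lambda>t. integral (cbox (-pi) pi) (\<lambda>y. of_real (g t y) * cis (- (of_int k * y)))) has_vector_derivative
      integral (cbox (-pi) pi) (\<lambda>y. of_real (g' t y) * cis (- (of_int k * y)))) (at t within {0..1})"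
  proof (rule leibniz_rule_vector_derivative)
    fix s y assume "s \<in> {0..1::real}"
    show "((\<lambda>s. of_real (g s y) * cis (- (of_int k * y))) has_vector_derivative of_real (g' s y) * cis (- (of_int k * y))) (at s within {0..1})"
      by (rule has_vector_derivative_mult_left[OF has_vector_derivative_of_real[OF d[OF \<open>s \<in> {0..1}\<close>]]])
  next
    fix s assume "s \<in> {0..1::real}"
    show "(\<lambda>y. complex_of_real (g s y) * cis (- (of_int k * y))) integrable_on cbox (-pi) pi"
      unfolding interval_cbox[symmetric] by (intro integrable_continuous_real continuous_intros g \<open>s \<in> {0..1}\<close>)
  next
    have "continuous_on ({0..1} \<times> {-pi..pi}) (\<lambda>x. of_real ((\<lambda>(t, y). g' t y) x) * cis (- (of_int k * snd x)))"
      by (intro continuous_intros g')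
    then show "continuous_on ({0..1} \<times> cbox (-pi) pi) (\<lambda>(t, y). complex_of_real (g' t y) * cis (- (of_int k * y)))"
      by (simp add: case_prod_unfold)
  qed (use t in auto)
  from bounded_linear.has_vector_derivative[OF bounded_linear_mult_left this, of "1 / (2 * pi)"]
  show ?thesis by (simp add: rfc_def fourier_coeff_def)
qed

lemma joint_C_deriv_fun:
  assumes "joint_C (Suc n) S g"
  shows "p \<in> S \<Longrightarrow> (g p has_real_derivative deriv (g p) x) (at x)" "joint_C n S (\<lambda>p. deriv (g p))"
proof -
  obtain g' where g': "\<forall>p\<in>S. \<forall>y. (g p has_real_derivative g' p y) (at y)" using joint_C_SucD[OF assms] by blast
  show d: "p \<in> S \<Longrightarrow> (g p has_real_derivative deriv (g p) x) (at x)" for p x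
    using g' DERIV_imp_deriv[of "g p" "g' p x" x] by simp
  show "joint_C n S (\<lambda>p. deriv (g p))" by (rule joint_C_deriv[OF assms d])
qed

text \<open>The base time \<open>t0\<close> is fixed, and with it the coordinate
  \<open>\<psi>\<close> that parametrizes the profile at \<open>t0\<close> by scaled arclength. The
  point of expansion in space remains free.\<close>

locale surface_evolution =
  fixes J :: "real set" and r r1 r2 :: "real \<Rightarrow> real \<Rightarrow> real"
    and t0 d0 c :: real and \<psi> :: "real \<Rightarrow> real"
  assumes jr: "joint_C 4 J r" and r1: "\<And>t x. t \<in> J \<Longrightarrow> (r t has_real_derivative r1 t x) (at x)" "joint_C 3 J r1"
    and r2: "\<And>t x. t \<in> J \<Longrightarrow> (r1 t has_real_derivative r2 t x) (at x)" "joint_C 2 J r2"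
    and per: "\<And>t x. t \<in> J \<Longrightarrow> r t (x + 2 * pi) = r t x"
    and pos: "\<And>t x. t \<in> J \<Longrightarrow> r t x > 0"
    and rt: "\<And>t x. t \<in> J \<Longrightarrow> ((\<lambda>s. r s x) has_real_derivative ASD_rhs (r t) x) (at t)"
    and d0: "0 < d0" "d0 \<le> 1" "{t0 - d0..t0 + d0} \<subseteq> J"
    and c: "c > 0" and j\<psi>: "joint_C 4 {0 :: real} (\<lambda>_. \<psi>)"
    and \<psi>': "\<And>y. (\<psi> has_real_derivative inverse (c * sqrt (1 + (r1 t0 (\<psi> y))\<^sup>2))) (at y)"
    and \<psi>per: "\<And>y. \<psi> (y + 2 * pi) = \<psi> y + 2 * pi"
begin

definition "Jc = {t0 - d0..t0 + d0}"
text \<open>Parameters are pairs of a time and a shift in \<open>x\<close>. With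
  \<open>T \<le> d0 \<le> 1\<close> the curves below stay in this compact set.\<close>

definition "I = Jc \<times> {-1..1 :: real}"

lemma t0_J: "t0 \<in> J" and Jc_J: "Jc \<subseteq> J" and t0_I: "(t0, 0) \<in> I" and compact_I: "compact I"
  using d0 by (auto simp: Jc_def I_def intro!: compact_Times)

lemma I_J: "p \<in> I \<Longrightarrow> fst p \<in> J"
  using Jc_J by (auto simp: I_def)

definition "w t x = 1 + (r1 t x)\<^sup>2"

lemma w_pos: "w t x > 0" by (simp add: w_def add_pos_nonneg)

lemma per1: "t \<in> J \<Longrightarrow> r1 t (x + 2 * pi) = r1 t x"
  by (rule periodic_deriv[OF r1(1)]) (auto simp: per)

lemma per2: "t \<in> J \<Longrightarrow> r2 t (x + 2 * pi) = r2 t x"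
  by (rule periodic_deriv[OF r2(1)]) (auto simp: per1)

text \<open>The factor in \<open>\<partial>\<^sub>x = \<kappa> \<partial>\<^sub>y\<close>. Its
  profile is frozen at \<open>t0\<close>, so it depends neither on the time along a curve nor on
  \<open>l\<close> and \<open>m\<close>.\<close>

definition "\<kappa> y = c * sqrt (w t0 (\<psi> y))"

lemma \<kappa>_pos: "\<kappa> y > 0" using c w_pos by (simp add: \<kappa>_def)

lemma \<psi>_deriv: "(\<psi> has_real_derivative inverse (\<kappa> y)) (at y)"
  using \<psi>'[of y] by (simp add: \<kappa>_def w_def)

lemma \<kappa>_per: "\<kappa> (y + 2 * pi) = \<kappa> y"
  by (simp add: \<kappa>_def w_def \<psi>per per1[OF t0_J])

lemma j\<kappa>: "joint_C 3 {0 :: real} (\<lambda>_. \<kappa>)"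
proof -
  have "joint_C 3 {0 :: real} (\<lambda>_ y. r1 t0 (\<psi> y))"
    by (rule joint_C_compose[OF r1(2) joint_C_le[OF j\<psi>], of "\<lambda>_. t0"]) (auto simp: t0_J)
  then have "joint_C 3 {0 :: real} (\<lambda>_ y. c * sqrt (1 + (r1 t0 (\<psi> y))\<^sup>2))"
    by (intro joint_C_mult joint_C_const joint_C_sqrt joint_C_add joint_C_power) (auto simp: add_pos_nonneg)
  then show ?thesis by (simp add: \<kappa>_def[abs_def] w_def)
qed

definition "\<kappa>1 = deriv \<kappa>"
definition "\<kappa>2 = deriv \<kappa>1"

lemma \<kappa>1: "(\<kappa> has_real_derivative \<kappa>1 y) (at y)" "joint_C 2 {0 :: real} (\<lambda>_. \<kappa>1)"
proof -
  have j: "joint_C (Suc 2) {0 :: real} (\<lambda>_. \<kappa>)" using j\<kappa> by (simp only: Suc_numeral semiring_norm)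
  show "(\<kappa> has_real_derivative \<kappa>1 y) (at y)" unfolding \<kappa>1_def by (rule joint_C_deriv_fun(1)[OF j, of 0]) simp
  show "joint_C 2 {0 :: real} (\<lambda>_. \<kappa>1)" unfolding \<kappa>1_def by (rule joint_C_deriv_fun(2)[OF j])
qed

lemma \<kappa>2: "(\<kappa>1 has_real_derivative \<kappa>2 y) (at y)" "joint_C 1 {0 :: real} (\<lambda>_. \<kappa>2)"
proof -
  have j: "joint_C (Suc 1) {0 :: real} (\<lambda>_. \<kappa>1)" using \<kappa>1(2) by (simp only: Suc_1)
  show "(\<kappa>1 has_real_derivative \<kappa>2 y) (at y)" unfolding \<kappa>2_def by (rule joint_C_deriv_fun(1)[OF j, of 0]) simp
  show "joint_C 1 {0 :: real} (\<lambda>_. \<kappa>2)" unfolding \<kappa>2_def by (rule joint_C_deriv_fun(2)[OF j])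
qed

lemma \<kappa>1_per: "\<kappa>1 (y + 2 * pi) = \<kappa>1 y" by (rule periodic_deriv[OF \<kappa>1(1) \<kappa>_per])
lemma \<kappa>2_per: "\<kappa>2 (y + 2 * pi) = \<kappa>2 y" by (rule periodic_deriv[OF \<kappa>2(1) \<kappa>1_per])

lemma joint_C_static: "joint_C n {0 :: real} (\<lambda>_. f) \<Longrightarrow> joint_C n (S :: 'p::topological_space set) (\<lambda>_. f)"
  using joint_C_compose[of n "{0 :: real}" "\<lambda>_. f" S "\<lambda>_ y. y" "\<lambda>_. 0"] by (simp add: joint_C_ident)

lemma j_geom: "n \<le> 3 \<Longrightarrow> joint_C n S (\<lambda>_. \<kappa>)" "n \<le> 2 \<Longrightarrow> joint_C n S (\<lambda>_. \<kappa>1)" "n \<le> 1 \<Longrightarrow> joint_C n S (\<lambda>_. \<kappa>2)"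
  by (rule joint_C_static, erule joint_C_le[OF j\<kappa>] joint_C_le[OF \<kappa>1(2)] joint_C_le[OF \<kappa>2(2)])+

text \<open>The shift is added after \<open>\<psi>\<close>, in the variable \<open>x\<close>, so
  that the same \<open>\<kappa>\<close> converts derivatives for every shift.\<close>

definition pullback :: "(real \<Rightarrow> real \<Rightarrow> real) \<Rightarrow> real \<times> real \<Rightarrow> real \<Rightarrow> real" where
  "pullback g p y = g (fst p) (\<psi> y + snd p)"

lemma joint_C_pullback:
  assumes "joint_C n J g" "n \<le> 4" shows "joint_C n I (pullback g)"
proof -
  have q: "joint_C n I (\<lambda>p y. \<psi> y + snd p)"
    by (rule joint_C_add[OF joint_C_static[OF joint_C_le[OF j\<psi> assms(2)]] joint_C_param[OF continuous_on_snd[OF continuous_on_id]]])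
  show ?thesis unfolding pullback_def
    by (rule joint_C_compose[OF assms(1) q continuous_on_fst[OF continuous_on_id] I_J])
qed

lemma pullback_deriv:
  assumes "p \<in> I" "\<And>x. (g (fst p) has_real_derivative g' (fst p) x) (at x)"
  shows "(pullback g p has_real_derivative pullback g' p y * inverse (\<kappa> y)) (at y)"
  unfolding pullback_def by (rule DERIV_chain2[OF assms(2)]) (auto intro!: derivative_eq_intros \<psi>_deriv)

lemma pullback_per:
  assumes "\<And>x. g (fst p) (x + 2 * pi) = g (fst p) x"
  shows "pullback g p (y + 2 * pi) = pullback g p y"
  using assms[of "\<psi> y + snd p"] unfolding pullback_def \<psi>per by (simp add: algebra_simps)

section \<open>The square of the radius, its fluxes, and its jet in the arclength coordinate\<close>

definition "V t x = (r t x)\<^sup>2"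
definition "V1 t x = 2 * r t x * r1 t x"
definition "V2 t x = 2 * (r1 t x)\<^sup>2 + 2 * r t x * r2 t x"
text \<open>This is \<open>1 / (V + V\<^sub>x\<^sup>2 / 4)\<close>, because
  \<open>V\<^sub>x = 2 r r\<^sub>x\<close>.\<close>

definition "Zf t x = inverse ((r t x)\<^sup>2 * w t x)"
definition "\<Gamma>2 t x = 2 * r t x * r2 t x / (w t x)\<^sup>2"
definition "\<Gamma>1 t x = 2 * r1 t x / (r t x * w t x) + 2 * r t x * r1 t x * (r2 t x)\<^sup>2 / (w t x) ^ 3"

lemma j_basic: "n \<le> 4 \<Longrightarrow> joint_C n J r" "n \<le> 3 \<Longrightarrow> joint_C n J r1" "n \<le> 2 \<Longrightarrow> joint_C n J r2" "n \<le> 3 \<Longrightarrow> joint_C n J w"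
  using joint_C_le[OF jr] joint_C_le[OF r1(2)] joint_C_le[OF r2(2)] unfolding w_def[abs_def] by (auto intro!: joint_C_add joint_C_const joint_C_power)

lemma nz: "t \<in> J \<Longrightarrow> r t x \<noteq> 0" "w t x \<noteq> 0"
  using pos w_pos by (metis less_irrefl)+

lemma j_V: "joint_C 4 J V" "joint_C 3 J V1" "joint_C 2 J V2" "joint_C 3 J Zf" "joint_C 2 J \<Gamma>2" "joint_C 2 J \<Gamma>1"
  unfolding V_def[abs_def] V1_def[abs_def] V2_def[abs_def] Zf_def[abs_def] \<Gamma>2_def[abs_def] \<Gamma>1_def[abs_def]
  by (intro joint_C_add joint_C_mult joint_C_divide joint_C_inverse joint_C_power joint_C_const j_basic; use nz in simp)+

lemma V_deriv: "t \<in> J \<Longrightarrow> (V t has_real_derivative V1 t x) (at x)" "t \<in> J \<Longrightarrow> (V1 t has_real_derivative V2 t x) (at x)"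
  unfolding V_def[abs_def] V1_def[abs_def] V2_def[abs_def]
  by (auto intro!: derivative_eq_intros r1 r2 simp: power2_eq_square)

lemma V_per: "t \<in> J \<Longrightarrow> V t (x + 2 * pi) = V t x" "t \<in> J \<Longrightarrow> V1 t (x + 2 * pi) = V1 t x"
  "t \<in> J \<Longrightarrow> V2 t (x + 2 * pi) = V2 t x" "t \<in> J \<Longrightarrow> Zf t (x + 2 * pi) = Zf t x"
  "t \<in> J \<Longrightarrow> \<Gamma>2 t (x + 2 * pi) = \<Gamma>2 t x" "t \<in> J \<Longrightarrow> \<Gamma>1 t (x + 2 * pi) = \<Gamma>1 t x"
  by (simp_all add: V_def V1_def V2_def Zf_def \<Gamma>2_def \<Gamma>1_def w_def per per1 per2)

definition "\<Gamma>2x t = deriv (\<Gamma>2 t)"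
definition "\<Gamma>2xx t = deriv (\<Gamma>2x t)"
definition "\<Gamma>1x t = deriv (\<Gamma>1 t)"

lemma \<Gamma>_deriv:
  "t \<in> J \<Longrightarrow> (\<Gamma>2 t has_real_derivative \<Gamma>2x t x) (at x)" "joint_C 1 J \<Gamma>2x"
  "t \<in> J \<Longrightarrow> (\<Gamma>2x t has_real_derivative \<Gamma>2xx t x) (at x)" "joint_C 0 J \<Gamma>2xx"
  "t \<in> J \<Longrightarrow> (\<Gamma>1 t has_real_derivative \<Gamma>1x t x) (at x)" "joint_C 1 J \<Gamma>1x"
proof -
  have 2: "joint_C (Suc 1) J \<Gamma>2" "joint_C (Suc 1) J \<Gamma>1" using j_V by (simp_all only: Suc_1)
  show "t \<in> J \<Longrightarrow> (\<Gamma>2 t has_real_derivative \<Gamma>2x t x) (at x)" unfolding \<Gamma>2x_def by (rule joint_C_deriv_fun(1)[OF 2(1)])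
  show 1: "joint_C 1 J \<Gamma>2x" unfolding \<Gamma>2x_def[abs_def] by (rule joint_C_deriv_fun(2)[OF 2(1)])
  show "t \<in> J \<Longrightarrow> (\<Gamma>1 t has_real_derivative \<Gamma>1x t x) (at x)" unfolding \<Gamma>1x_def by (rule joint_C_deriv_fun(1)[OF 2(2)])
  show "joint_C 1 J \<Gamma>1x" unfolding \<Gamma>1x_def[abs_def] by (rule joint_C_deriv_fun(2)[OF 2(2)])
  have 1: "joint_C (Suc 0) J \<Gamma>2x" using 1 by (simp only: One_nat_def)
  show "t \<in> J \<Longrightarrow> (\<Gamma>2x t has_real_derivative \<Gamma>2xx t x) (at x)" unfolding \<Gamma>2xx_def by (rule joint_C_deriv_fun(1)[OF 1])
  show "joint_C 0 J \<Gamma>2xx" unfolding \<Gamma>2xx_def[abs_def] by (rule joint_C_deriv_fun(2)[OF 1])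
qed

definition "Vt t x = - (\<Gamma>2xx t x + \<Gamma>1x t x)"

lemma jVt: "joint_C 0 J Vt"
  unfolding Vt_def[abs_def] using joint_C_cmult[OF joint_C_add[OF \<Gamma>_deriv(4) joint_C_le[OF \<Gamma>_deriv(6)]], of "-1"] by simp

lemma V_time_deriv:
  assumes t: "t \<in> J" shows "((\<lambda>s. V s x) has_real_derivative Vt t x) (at t)"
proof -
  have r3: "(r2 t has_real_derivative deriv (r2 t) x) (at x)" for x
    using joint_C_deriv_fun(1)[of 1 J r2 t x] r2(2) t by (simp only: Suc_1)
  have "2 * r t x * ASD_rhs (r t) x = - (\<Gamma>2xx t x + \<Gamma>1x t x)"
    by (rule ASD_rhs_divergence[where ?f1.0="r1 t" and ?f2.0="r2 t" and ?f3.0="deriv (r2 t)" and h="\<Gamma>2x t"])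
      (use t r3 \<Gamma>_deriv(1)[OF t] \<Gamma>_deriv(3)[OF t] \<Gamma>_deriv(5)[OF t] in \<open>auto simp: pos r1 r2 \<Gamma>2_def[abs_def] \<Gamma>1_def[abs_def] w_def\<close>)
  then show ?thesis
    unfolding V_def Vt_def using rt[OF t, of x]
    by (auto intro!: derivative_eq_intros simp: power2_eq_square)
qed

definition "v = pullback V"
definition "v1 p y = pullback V1 p y / \<kappa> y"
definition "v2 p y = (pullback V2 p y - \<kappa> y * \<kappa>1 y * v1 p y) / (\<kappa> y)\<^sup>2"
definition "zf = pullback Zf"
definition "rf = pullback r"

lemma \<kappa>_nz: "\<kappa> y \<noteq> 0" using \<kappa>_pos[of y] by simp

text \<open>\<open>v2\<close> keeps two derivatives in \<open>y\<close>, which is what the decay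
  \<open>1 / k^2\<close> of its coefficients asks for. Here the four space derivatives of
  \<open>r\<close> are used up.\<close>

lemma j_v: "joint_C 4 I v" "joint_C 3 I v1" "joint_C 2 I v2" "joint_C 3 I zf" "joint_C 4 I rf"
proof -
  show "joint_C 4 I v" "joint_C 3 I zf" "joint_C 4 I rf" unfolding v_def zf_def rf_def by (intro joint_C_pullback j_V jr; simp)+
  show v1: "joint_C 3 I v1" unfolding v1_def[abs_def] by (intro joint_C_divide joint_C_pullback j_V j_geom) (auto simp: \<kappa>_nz)
  show "joint_C 2 I v2" unfolding v2_def[abs_def]
    by (intro joint_C_divide joint_C_diff joint_C_mult joint_C_power joint_C_pullback j_V j_geom joint_C_le[OF v1]) (auto simp: \<kappa>_nz)
qed

lemma v_deriv:
  assumes p: "p \<in> I"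
  shows "(v p has_real_derivative v1 p y) (at y)" "(v1 p has_real_derivative v2 p y) (at y)"
proof -
  show "(v p has_real_derivative v1 p y) (at y)"
    unfolding v_def v1_def divide_inverse by (rule pullback_deriv[where g=V and g'=V1, OF p V_deriv(1)[OF I_J[OF p]]])
  have "((\<lambda>y. pullback V1 p y / \<kappa> y) has_real_derivative
      (pullback V2 p y * inverse (\<kappa> y) * \<kappa> y - pullback V1 p y * \<kappa>1 y) / (\<kappa> y * \<kappa> y)) (at y)"
    by (rule DERIV_divide[OF pullback_deriv[where g=V1 and g'=V2, OF p V_deriv(2)[OF I_J[OF p]]] \<kappa>1(1) \<kappa>_nz])
  then show "(v1 p has_real_derivative v2 p y) (at y)"
    unfolding v1_def[abs_def] v2_def using \<kappa>_nz[of y] by (simp add: field_simps power2_eq_square)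
qed

lemma v_per:
  assumes p: "p \<in> I"
  shows "v p (y + 2 * pi) = v p y" "v1 p (y + 2 * pi) = v1 p y" "v2 p (y + 2 * pi) = v2 p y"
    "zf p (y + 2 * pi) = zf p y" "rf p (y + 2 * pi) = rf p y"
  unfolding v_def v1_def v2_def zf_def rf_def \<kappa>_per \<kappa>1_per
  by (simp_all add: pullback_per V_per per I_J[OF p])

lemma flux_pullback:
  assumes p: "p \<in> I"
  shows "flux2 (\<kappa> y) (\<kappa>1 y) (v p y) (v1 p y) (v2 p y) (zf p y) = pullback \<Gamma>2 p y"
    "flux1 (\<kappa> y) (\<kappa>1 y) (v p y) (v1 p y) (v2 p y) (zf p y) = pullback \<Gamma>1 p y"
    "zf p y * (v p y + (1/4) * (\<kappa> y * v1 p y * (\<kappa> y * v1 p y))) = 1"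
proof -
  have a: "\<kappa> y * v1 p y = pullback V1 p y" using \<kappa>_nz[of y] by (simp add: v1_def)
  have b: "\<kappa> y * \<kappa> y * v2 p y + \<kappa> y * \<kappa>1 y * v1 p y = pullback V2 p y"
    using \<kappa>_nz[of y] by (simp add: v2_def power2_eq_square)
  define R where "R = pullback r p y"
  define R1 where "R1 = pullback r1 p y"
  define R2 where "R2 = pullback r2 p y"
  define W where "W = pullback w p y"
  have R: "R \<noteq> 0" using pos[OF I_J[OF p]] by (auto simp: R_def pullback_def less_imp_neq[symmetric])
  have W: "W \<noteq> 0" "W = 1 + R1\<^sup>2" using w_pos by (auto simp: W_def R1_def pullback_def w_def less_imp_neq[symmetric])
  have V: "v p y = R\<^sup>2" "pullback V1 p y = 2 * R * R1" "pullback V2 p y = 2 * R1\<^sup>2 + 2 * R * R2" "zf p y = inverse (R\<^sup>2 * W)"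
    "pullback \<Gamma>2 p y = 2 * R * R2 / W\<^sup>2" "pullback \<Gamma>1 p y = 2 * R1 / (R * W) + 2 * R * R1 * R2\<^sup>2 / W ^ 3"
    by (simp_all add: v_def zf_def pullback_def V_def V1_def V2_def Zf_def \<Gamma>2_def \<Gamma>1_def R_def R1_def R2_def W_def)
  have "flux2 (\<kappa> y) (\<kappa>1 y) (v p y) (v1 p y) (v2 p y) (zf p y) =
      R\<^sup>2 * R\<^sup>2 * inverse (R\<^sup>2 * W) * inverse (R\<^sup>2 * W) * (2 * R1\<^sup>2 + 2 * R * R2)
      - (1/2) * (R\<^sup>2 * (2 * R * R1) * (2 * R * R1) * inverse (R\<^sup>2 * W) * inverse (R\<^sup>2 * W))"
    unfolding flux2_def a b V by simp
  also have "\<dots> = 2 * R * R2 / W\<^sup>2" using R W(1) by (simp add: field_simps power2_eq_square)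
  finally show "flux2 (\<kappa> y) (\<kappa>1 y) (v p y) (v1 p y) (v2 p y) (zf p y) = pullback \<Gamma>2 p y" by (simp add: V)
  \<comment> \<open>The bracket that occurs squared in \<open>flux1\<close> is
    \<open>r\<^sup>3 r\<^sub>x\<^sub>x\<close>: the terms with \<open>r\<^sub>x\<^sup>2\<close>
    cancel.\<close>
  have q: "(1/2) * (R\<^sup>2 * (2 * R1\<^sup>2 + 2 * R * R2)) - (1/4) * (2 * R * R1 * (2 * R * R1)) = R ^ 3 * R2"
    by (simp add: field_simps eval_nat_numeral)
  have "flux1 (\<kappa> y) (\<kappa>1 y) (v p y) (v1 p y) (v2 p y) (zf p y) =
      2 * R * R1 * inverse (R\<^sup>2 * W) + 2 * R * R1 * (R ^ 3 * R2) * (R ^ 3 * R2) * inverse (R\<^sup>2 * W) * inverse (R\<^sup>2 * W) * inverse (R\<^sup>2 * W)"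
    unfolding flux1_def a b V real_scaleR_def q by simp
  also have "\<dots> = 2 * R1 / (R * W) + 2 * R * R1 * R2\<^sup>2 / W ^ 3"
    using R W(1) by (simp add: field_simps eval_nat_numeral)
  finally show "flux1 (\<kappa> y) (\<kappa>1 y) (v p y) (v1 p y) (v2 p y) (zf p y) = pullback \<Gamma>1 p y" by (simp add: V)
  have e: "v p y + (1/4) * (\<kappa> y * v1 p y * (\<kappa> y * v1 p y)) = R\<^sup>2 * W"
    unfolding a V W(2) by (simp add: power2_eq_square algebra_simps)
  show "zf p y * (v p y + (1/4) * (\<kappa> y * v1 p y * (\<kappa> y * v1 p y))) = 1"
    unfolding e V(4) using R W(1) by (simp del: inverse_mult_distrib)
qed

text \<open>Since \<open>V * Zf = 1 / w\<close> and \<open>\<kappa>\<^sup>2 = c\<^sup>2 * w\<close>,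
  the slope of the profile drops out. Arclength is chosen for this cancellation.\<close>

lemma leading_coefficient:
  "\<kappa> y * \<kappa> y * (v (t0, 0) y * v (t0, 0) y * zf (t0, 0) y * zf (t0, 0) y * (\<kappa> y * \<kappa> y)) = c ^ 4"
proof -
  have R: "r t0 (\<psi> y) \<noteq> 0" and W: "w t0 (\<psi> y) > 0" using nz(1)[OF t0_J] w_pos by auto
  have k: "\<kappa> y * \<kappa> y = c\<^sup>2 * w t0 (\<psi> y)" using W by (simp add: \<kappa>_def power2_eq_square)
  show ?thesis unfolding k v_def zf_def pullback_def V_def Zf_def fst_conv snd_conv add_0_right
    using R W by (simp add: field_simps eval_nat_numeral)
qed

text \<open>The \<open>y\<close>-derivatives are pulled in front of the fluxes, where they act as
  Fourier symbols: \<open>\<kappa> \<partial>(\<kappa> \<partial>\<Gamma>\<^sub>2) =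
  \<partial>\<^sup>2(\<kappa>\<^sup>2 \<Gamma>\<^sub>2) - 3 \<partial>(\<kappa> \<kappa>'
  \<Gamma>\<^sub>2) + (\<kappa>'\<^sup>2 + \<kappa> \<kappa>'') \<Gamma>\<^sub>2\<close> and
  \<open>\<kappa> \<partial>\<Gamma>\<^sub>1 = \<partial>(\<kappa> \<Gamma>\<^sub>1) - \<kappa>'
  \<Gamma>\<^sub>1\<close>. This is the origin of the factor 3 in \<open>rhs1\<close> and of the
  coefficients in \<open>rhs0\<close>.\<close>

lemma rfc_Vt:
  assumes p: "p \<in> I"
  shows "rfc (pullback Vt p) k = (of_int k)\<^sup>2 * rfc (\<lambda>y. \<kappa> y * \<kappa> y * pullback \<Gamma>2 p y) k
    + \<i> * of_int k * rfc (\<lambda>y. 3 * (\<kappa> y * \<kappa>1 y * pullback \<Gamma>2 p y) - \<kappa> y * pullback \<Gamma>1 p y) k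
    + rfc (\<lambda>y. \<kappa>1 y * pullback \<Gamma>1 p y - (\<kappa>1 y * \<kappa>1 y + \<kappa> y * \<kappa>2 y) * pullback \<Gamma>2 p y) k"
proof -
  define A where "A y = \<kappa> y * \<kappa> y * pullback \<Gamma>2 p y" for y
  define A1 where "A1 y = 2 * \<kappa> y * \<kappa>1 y * pullback \<Gamma>2 p y + \<kappa> y * pullback \<Gamma>2x p y" for y
  define A2 where "A2 y = 2 * (\<kappa>1 y * \<kappa>1 y + \<kappa> y * \<kappa>2 y) * pullback \<Gamma>2 p y + 3 * \<kappa>1 y * pullback \<Gamma>2x p y + pullback \<Gamma>2xx p y" for y
  define B where "B y = 3 * (\<kappa> y * \<kappa>1 y * pullback \<Gamma>2 p y) - \<kappa> y * pullback \<Gamma>1 p y" for y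
  define B1 where "B1 y = 3 * (\<kappa>1 y * \<kappa>1 y + \<kappa> y * \<kappa>2 y) * pullback \<Gamma>2 p y + 3 * \<kappa>1 y * pullback \<Gamma>2x p y - \<kappa>1 y * pullback \<Gamma>1 p y - pullback \<Gamma>1x p y" for y
  define C where "C y = \<kappa>1 y * pullback \<Gamma>1 p y - (\<kappa>1 y * \<kappa>1 y + \<kappa> y * \<kappa>2 y) * pullback \<Gamma>2 p y" for y
  note t = I_J[OF p]
  note dd = \<kappa>1(1) \<kappa>2(1) pullback_deriv[where g=\<Gamma>2 and g'=\<Gamma>2x, OF p \<Gamma>_deriv(1)[OF t]] pullback_deriv[where g=\<Gamma>2x and g'=\<Gamma>2xx, OF p \<Gamma>_deriv(3)[OF t]] pullback_deriv[where g=\<Gamma>1 and g'=\<Gamma>1x, OF p \<Gamma>_deriv(5)[OF t]]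
  have dA: "(A has_real_derivative A1 y) (at y)" for y
    unfolding A_def A1_def using \<kappa>_nz[of y] by (auto intro!: derivative_eq_intros dd simp: field_simps)
  have dA1: "(A1 has_real_derivative A2 y) (at y)" for y
    unfolding A1_def A2_def using \<kappa>_nz[of y] by (auto intro!: derivative_eq_intros dd simp: field_simps)
  have dB: "(B has_real_derivative B1 y) (at y)" for y
    unfolding B_def B1_def using \<kappa>_nz[of y] by (auto intro!: derivative_eq_intros dd simp: field_simps)
  have ck: "continuous_on S \<kappa>" "continuous_on S \<kappa>1" "continuous_on S \<kappa>2" for S
    using joint_C_slice[OF j\<kappa>] joint_C_slice[OF \<kappa>1(2)] joint_C_slice[OF \<kappa>2(2)] by auto
  have cg: "continuous_on S (pullback \<Gamma>2 p)" "continuous_on S (pullback \<Gamma>2x p)" "continuous_on S (pullback \<Gamma>2xx p)"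
    "continuous_on S (pullback \<Gamma>1 p)" "continuous_on S (pullback \<Gamma>1x p)" for S
    by (rule joint_C_slice[OF joint_C_pullback[OF j_V(5)] p] joint_C_slice[OF joint_C_pullback[OF \<Gamma>_deriv(2)] p] joint_C_slice[OF joint_C_pullback[OF \<Gamma>_deriv(4)] p]
        joint_C_slice[OF joint_C_pullback[OF j_V(6)] p] joint_C_slice[OF joint_C_pullback[OF \<Gamma>_deriv(6)] p]; simp)+
  have cA: "continuous_on S A1" "continuous_on S A2" "continuous_on S B" "continuous_on S B1" "continuous_on S C" for S
    unfolding A1_def[abs_def] A2_def[abs_def] B_def[abs_def] B1_def[abs_def] C_def[abs_def] by (intro continuous_intros ck cg)+
  have gper: "pullback \<Gamma>2 p (y + 2 * pi) = pullback \<Gamma>2 p y" "pullback \<Gamma>1 p (y + 2 * pi) = pullback \<Gamma>1 p y" for y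
    by (rule pullback_per, rule V_per[OF t])+
  have perA: "A (y + 2 * pi) = A y" "B (y + 2 * pi) = B y" for y
    by (simp_all add: A_def B_def \<kappa>_per \<kappa>1_per gper)
  have perA1: "A1 (y + 2 * pi) = A1 y" for y by (rule periodic_deriv[OF dA perA(1)])
  have "pullback Vt p y = (B1 y - A2 y) + C y" for y
    by (simp add: A2_def B1_def C_def pullback_def Vt_def algebra_simps)
  then have "rfc (pullback Vt p) k = rfc (\<lambda>y. (B1 y - A2 y) + C y) k" by (metis ext)
  also have "\<dots> = rfc B1 k - rfc A2 k + rfc C k"
    by (simp add: rfc_add rfc_diff cA continuous_intros)
  also have "rfc A2 k = \<i> * of_int k * (\<i> * of_int k * rfc A k)"
    using rfc_deriv[OF dA1 cA(2) perA1] rfc_deriv[OF dA cA(1) perA(1)] by simp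
  also have "rfc B1 k = \<i> * of_int k * rfc B k" by (rule rfc_deriv[OF dB cA(4) perA(2)])
  finally show ?thesis
    unfolding A_def[symmetric] B_def[symmetric] C_def[symmetric] by (simp add: power2_eq_square algebra_simps)
qed

text \<open>All these curves start at \<open>(t0 - T, 0)\<close>; at \<open>s = 1\<close> they reach \<open>(t0 + l T, m T)\<close>.\<close>

definition "pt T l m s = (t0 - T + (1 + l) * T * s, m * T * s)"

definition "E g T l m = fourier_elt (\<lambda>s. g (pt T l m s))"
definition "K0 = fourier_elt (\<lambda>_. \<kappa>)"
definition "K1 = fourier_elt (\<lambda>_. \<kappa>1)"
definition "K2 = fourier_elt (\<lambda>_. \<kappa>2)"

definition "G2 T l m = rhs2 (c ^ 4) K0 K1 (l *\<^sub>R 1) (E v T l m) (E v1 T l m) (E v2 T l m) (E zf T l m)"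
definition "G1 T l m = rhs1 K0 K1 (l *\<^sub>R 1) (E v T l m) (E v1 T l m) (E v2 T l m) (E zf T l m)"
definition "G0 T l m = rhs0 K0 K1 K2 (l *\<^sub>R 1) (m *\<^sub>R 1) (E v T l m) (E v1 T l m) (E v2 T l m) (E zf T l m)"
text \<open>The \<open>j\<close>-th \<open>y\<close>-derivative of the inhomogeneous part in the
  variation of constants formula for \<open>v\<close>.\<close>

definition "N T l m j = LA (c ^ 4) T (j + 2) (G2 T l m) + LA (c ^ 4) T (j + 1) (G1 T l m) + LA (c ^ 4) T j (G0 T l m)"

lemma represents_\<kappa>: "represents K0 (\<lambda>_. \<kappa>)" "represents K1 (\<lambda>_. \<kappa>1)" "represents K2 (\<lambda>_. \<kappa>2)"
proof -
  have j: "joint_C (Suc 0) {0 :: real} (\<lambda>_. \<kappa>2)" using \<kappa>2(2) by (simp only: One_nat_def)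
  show "represents K0 (\<lambda>_. \<kappa>)" unfolding K0_def by (rule represents_static[OF \<kappa>1(1) joint_C_slice[OF \<kappa>1(2)] \<kappa>_per]) simp
  show "represents K1 (\<lambda>_. \<kappa>1)" unfolding K1_def by (rule represents_static[OF \<kappa>2(1) joint_C_slice[OF \<kappa>2(2)] \<kappa>1_per]) simp
  have d: "(\<kappa>2 has_real_derivative deriv \<kappa>2 y) (at y)" for y by (rule joint_C_deriv_fun(1)[OF j, of 0]) simp
  show "represents K2 (\<lambda>_. \<kappa>2)" unfolding K2_def
    by (rule represents_static[OF d joint_C_slice[OF joint_C_deriv_fun(2)[OF j]] \<kappa>2_per]) simp
qed

section \<open>Evolution of the Fourier modes along one curve\<close>

context
  fixes T l m :: real
  assumes T: "0 < T" "T \<le> d0" and lm: "\<bar>l\<bar> \<le> 1" "\<bar>m\<bar> \<le> 1"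
begin

lemma pt_bounds:
  assumes s: "s \<in> {0..1}"
  shows "pt T l m s \<in> I" "dist (pt T l m s) (t0, 0) \<le> 2 * T"
proof -
  have "(1 + l) * s \<le> 2 * 1" "0 \<le> (1 + l) * s"
    using lm s by (intro mult_mono mult_nonneg_nonneg; force)+
  then have "(1 + l) * s * T \<le> 2 * T" "0 \<le> (1 + l) * s * T" using T by auto
  then have 1: "\<bar>fst (pt T l m s) - t0\<bar> \<le> T" by (simp add: pt_def abs_le_iff algebra_simps)
  have "\<bar>m\<bar> * (T * s) \<le> 1 * (T * 1)" using lm s T by (intro mult_mono) auto
  then have 2: "\<bar>snd (pt T l m s)\<bar> \<le> T" using T s by (simp add: pt_def abs_mult mult.assoc)
  show "pt T l m s \<in> I" using 1 2 T d0 by (auto simp: I_def Jc_def abs_le_iff mem_Times_iff)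
  have "dist (pt T l m s) (t0, 0) = norm (fst (pt T l m s) - t0, snd (pt T l m s))"
    by (simp add: dist_norm minus_prod_def)
  also have "\<dots> \<le> 2 * T" using norm_Pair_le[of "fst (pt T l m s) - t0" "snd (pt T l m s)"] 1 2 by simp
  finally show "dist (pt T l m s) (t0, 0) \<le> 2 * T" .
qed

lemma continuous_pt: "continuous_on A (pt T l m)"
  unfolding pt_def by (intro continuous_intros)

lemma curve: "curve_in I (pt T l m)"
  using pt_bounds(1) continuous_pt unfolding curve_in_def by blast

lemma represents_E:
  "represents (E v T l m) (\<lambda>s. v (pt T l m s))" "represents (E v1 T l m) (\<lambda>s. v1 (pt T l m s))"
  "represents (E v2 T l m) (\<lambda>s. v2 (pt T l m s))" "represents (E zf T l m) (\<lambda>s. zf (pt T l m s))"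
  "represents (E rf T l m) (\<lambda>s. rf (pt T l m s))"
  unfolding E_def
  by (rule represents_curve[OF joint_C_le[OF j_v(1)] compact_I v_per(1) curve] represents_curve[OF joint_C_le[OF j_v(2)] compact_I v_per(2) curve]
      represents_curve[OF joint_C_le[OF j_v(3)] compact_I v_per(3) curve] represents_curve[OF joint_C_le[OF j_v(4)] compact_I v_per(4) curve]
      represents_curve[OF joint_C_le[OF j_v(5)] compact_I v_per(5) curve]; simp)+

lemma represents_G:
  "represents (G2 T l m) (\<lambda>s y. c ^ 4 * v2 (pt T l m s) y - (1 + l) * (\<kappa> y * \<kappa> y * flux2 (\<kappa> y) (\<kappa>1 y) (v (pt T l m s) y) (v1 (pt T l m s) y) (v2 (pt T l m s) y) (zf (pt T l m s) y)))"
  "represents (G1 T l m) (\<lambda>s y. (1 + l) * (3 * (\<kappa> y * \<kappa>1 y * flux2 (\<kappa> y) (\<kappa>1 y) (v (pt T l m s) y) (v1 (pt T l m s) y) (v2 (pt T l m s) y) (zf (pt T l m s) y)) - \<kappa> y * flux1 (\<kappa> y) (\<kappa>1 y) (v (pt T l m s) y) (v1 (pt T l m s) y) (v2 (pt T l m s) y) (zf (pt T l m s) y)))"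
  "represents (G0 T l m) (\<lambda>s y. (1 + l) * (\<kappa>1 y * flux1 (\<kappa> y) (\<kappa>1 y) (v (pt T l m s) y) (v1 (pt T l m s) y) (v2 (pt T l m s) y) (zf (pt T l m s) y)
     - (\<kappa>1 y * \<kappa>1 y + \<kappa> y * \<kappa>2 y) * flux2 (\<kappa> y) (\<kappa>1 y) (v (pt T l m s) y) (v1 (pt T l m s) y) (v2 (pt T l m s) y) (zf (pt T l m s) y)) + m * (\<kappa> y * v1 (pt T l m s) y))"
proof -
  note one = represents_ring(5)[OF represents_E(1) represents_E(1)]
  have lr: "represents (x *\<^sub>R 1) (\<lambda>_ _. x)" for x
    using represents_ring(4)[OF one one, of x] by simp
  note r = represents_rhs[OF represents_\<kappa> lr lr represents_E(1-4)]
  show "represents (G2 T l m) (\<lambda>s y. c ^ 4 * v2 (pt T l m s) y - (1 + l) * (\<kappa> y * \<kappa> y * flux2 (\<kappa> y) (\<kappa>1 y) (v (pt T l m s) y) (v1 (pt T l m s) y) (v2 (pt T l m s) y) (zf (pt T l m s) y)))"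
    using r(1) unfolding G2_def rhs2_def[where ?'a=real] real_scaleR_def .
  show "represents (G1 T l m) (\<lambda>s y. (1 + l) * (3 * (\<kappa> y * \<kappa>1 y * flux2 (\<kappa> y) (\<kappa>1 y) (v (pt T l m s) y) (v1 (pt T l m s) y) (v2 (pt T l m s) y) (zf (pt T l m s) y)) - \<kappa> y * flux1 (\<kappa> y) (\<kappa>1 y) (v (pt T l m s) y) (v1 (pt T l m s) y) (v2 (pt T l m s) y) (zf (pt T l m s) y)))"
    using r(2) unfolding G1_def rhs1_def[where ?'a=real] real_scaleR_def .
  show "represents (G0 T l m) (\<lambda>s y. (1 + l) * (\<kappa>1 y * flux1 (\<kappa> y) (\<kappa>1 y) (v (pt T l m s) y) (v1 (pt T l m s) y) (v2 (pt T l m s) y) (zf (pt T l m s) y)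
     - (\<kappa>1 y * \<kappa>1 y + \<kappa> y * \<kappa>2 y) * flux2 (\<kappa> y) (\<kappa>1 y) (v (pt T l m s) y) (v1 (pt T l m s) y) (v2 (pt T l m s) y) (zf (pt T l m s) y)) + m * (\<kappa> y * v1 (pt T l m s) y))"
    using r(3) unfolding G0_def rhs0_def[where ?'a=real] .
qed

text \<open>The total derivative of \<open>V\<close> comes from the time derivative at the point and
  the joint continuity of the \<open>x\<close>-derivative. Derivatives are taken within [0, 1] and
  \<open>Jc\<close>, as the curve may reach the ends of both.\<close>

lemma V_along_curve:
  assumes s: "s \<in> {0..1}"
  shows "((\<lambda>s. v (pt T l m s) y) has_real_derivative
    T * ((1 + l) * pullback Vt (pt T l m s) y + m * pullback V1 (pt T l m s) y)) (at s within {0..1})"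
proof -
  let ?x = "fst (pt T l m s)" and ?y = "\<psi> y + snd (pt T l m s)"
  have fst: "fst (pt T l m s) \<in> Jc" if "s \<in> {0..1}" for s
    using pt_bounds(1)[OF that] by (auto simp: I_def)
  have dt: "((\<lambda>t. V t ?y) has_derivative (\<lambda>h. Vt ?x ?y * h)) (at ?x within Jc)"
    using V_time_deriv[of ?x ?y] fst[OF s] Jc_J has_field_derivative_imp_has_derivative has_derivative_at_withinI by blast
  have dx: "((\<lambda>x. V t x) has_derivative blinfun_apply (blinfun_mult_right (V1 t x))) (at x within UNIV)" if "t \<in> Jc" for t x
    using V_deriv(1)[of t x] that Jc_J unfolding has_field_derivative_def by auto
  have "continuous_on (Jc \<times> UNIV) (\<lambda>(t, x). V1 t x)"
    using continuous_on_subset[OF joint_C_cont[OF j_V(2)]] Jc_J by blast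
  then have "continuous (at (?x, ?y) within Jc \<times> UNIV) (\<lambda>(t, x). V1 t x)"
    using fst[OF s] continuous_on_eq_continuous_within by blast
  from bounded_linear.continuous[OF bounded_linear_blinfun_mult_right this]
  have ct: "continuous (at (?x, ?y) within Jc \<times> UNIV) (\<lambda>(t, x). blinfun_mult_right (V1 t x))"
    by (simp add: case_prod_unfold)
  have "((\<lambda>(t, x). V t x) has_derivative (\<lambda>(tx, ty). Vt ?x ?y * tx + blinfun_apply (blinfun_mult_right (V1 ?x ?y)) ty))
      (at (?x, ?y) within Jc \<times> UNIV)"
    by (rule has_derivative_partialsI[where fy="\<lambda>t x. blinfun_mult_right (V1 t x)", OF dt dx ct]) auto
  from has_derivative_subset[OF this, of "(\<lambda>s. (fst (pt T l m s), \<psi> y + snd (pt T l m s))) ` {0..1}"]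
  have V: "((\<lambda>(t, x). V t x) has_derivative (\<lambda>(tx, ty). Vt ?x ?y * tx + V1 ?x ?y * ty))
      (at (?x, ?y) within (\<lambda>s. (fst (pt T l m s), \<psi> y + snd (pt T l m s))) ` {0..1})"
    using fst by (auto simp: image_subset_iff)
  have "((\<lambda>s. (fst (pt T l m s), \<psi> y + snd (pt T l m s))) has_derivative (\<lambda>h. ((1 + l) * T * h, m * T * h))) (at s within {0..1})"
    unfolding pt_def fst_conv snd_conv by (auto intro!: derivative_eq_intros)
  from has_derivative_in_compose[OF this V]
  show ?thesis
    unfolding has_field_derivative_def v_def pullback_def split
    by (rule has_derivative_eq_rhs) (auto simp: fun_eq_iff algebra_simps)
qed

lemma continuous_pullback_curve:
  assumes "joint_C n J g" "n \<le> 4"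
  shows "continuous_on ({0..1} \<times> UNIV) (\<lambda>(s, y). pullback g (pt T l m s) y)"
proof -
  have "continuous_on ({0..1} \<times> UNIV) (\<lambda>x. (\<lambda>(p, y). pullback g p y) (pt T l m (fst x), snd x))"
    by (rule continuous_on_compose2[OF joint_C_cont[OF joint_C_pullback[OF assms]]])
      (use pt_bounds(1) in \<open>auto intro!: continuous_intros continuous_on_compose2[OF continuous_pt]\<close>)
  then show ?thesis by (simp add: case_prod_unfold)
qed

lemma rfc_jet:
  assumes s: "s \<in> {0..1}"
  shows "rfc (v1 (pt T l m s)) k = \<i> * of_int k * rfc (v (pt T l m s)) k"
    "rfc (v2 (pt T l m s)) k = (\<i> * of_int k)\<^sup>2 * rfc (v (pt T l m s)) k"
proof -
  note p = pt_bounds(1)[OF s]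
  show 1: "rfc (v1 (pt T l m s)) k = \<i> * of_int k * rfc (v (pt T l m s)) k"
    by (rule rfc_deriv[OF v_deriv(1)[OF p] joint_C_slice[OF j_v(2) p] v_per(1)[OF p]])
  show "rfc (v2 (pt T l m s)) k = (\<i> * of_int k)\<^sup>2 * rfc (v (pt T l m s)) k"
    using rfc_deriv[OF v_deriv(2)[OF p] joint_C_slice[OF j_v(3) p] v_per(2)[OF p], of k] by (simp add: 1 power2_eq_square)
qed

definition "forcing k s = of_real T * ((\<i> * of_int k)\<^sup>2 * apply_bcontfun (lcoeff (G2 T l m) k) s
  + \<i> * of_int k * apply_bcontfun (lcoeff (G1 T l m) k) s + apply_bcontfun (lcoeff (G0 T l m) k) s)"

text \<open>\<open>G2\<close> contains \<open>c ^ 4 * v2\<close>, which contributes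
  \<open>c ^ 4 * T * k ^ 4\<close> times the coefficient of \<open>v\<close>; the damping term
  removes this again. What remains is the equation for \<open>V\<close>, with the factor
  \<open>1 + l\<close> from the speed of time and the transport term \<open>m\<close> from the
  moving shift.\<close>

lemma rfc_evolution:
  assumes s: "s \<in> {0..1}"
  shows "((\<lambda>s. rfc (v (pt T l m s)) k) has_vector_derivative
    forcing k s - (c ^ 4 * T * of_int k ^ 4) *\<^sub>R rfc (v (pt T l m s)) k) (at s within {0..1})"
proof -
  let ?p = "pt T l m s"
  note p = pt_bounds(1)[OF s]
  have ck: "continuous_on S \<kappa>" "continuous_on S \<kappa>1" "continuous_on S \<kappa>2" for S
    using joint_C_slice[OF j\<kappa>] joint_C_slice[OF \<kappa>1(2)] joint_C_slice[OF \<kappa>2(2)] by auto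
  have cg: "continuous_on S (pullback \<Gamma>2 ?p)" "continuous_on S (pullback \<Gamma>1 ?p)" "continuous_on S (pullback V1 ?p)" "continuous_on S (pullback Vt ?p)"
    "continuous_on S (v2 ?p)" for S
    by (rule joint_C_slice[OF joint_C_pullback[OF j_V(5)] p] joint_C_slice[OF joint_C_pullback[OF j_V(6)] p] joint_C_slice[OF joint_C_pullback[OF j_V(2)] p]
        joint_C_slice[OF joint_C_pullback[OF jVt] p] joint_C_slice[OF j_v(3) p]; simp)+
  define a2 where "a2 = rfc (\<lambda>y. \<kappa> y * \<kappa> y * pullback \<Gamma>2 ?p y) k"
  define a1 where "a1 = rfc (\<lambda>y. 3 * (\<kappa> y * \<kappa>1 y * pullback \<Gamma>2 ?p y) - \<kappa> y * pullback \<Gamma>1 ?p y) k"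
  define a0 where "a0 = rfc (\<lambda>y. \<kappa>1 y * pullback \<Gamma>1 ?p y - (\<kappa>1 y * \<kappa>1 y + \<kappa> y * \<kappa>2 y) * pullback \<Gamma>2 ?p y) k"
  have V1: "\<kappa> y * v1 ?p y = pullback V1 ?p y" for y using \<kappa>_nz[of y] by (simp add: v1_def)
  have G: "apply_bcontfun (lcoeff (G2 T l m) k) s = of_real (c ^ 4) * rfc (v2 ?p) k - of_real (1 + l) * a2"
    "apply_bcontfun (lcoeff (G1 T l m) k) s = of_real (1 + l) * a1"
    "apply_bcontfun (lcoeff (G0 T l m) k) s = of_real (1 + l) * a0 + of_real m * rfc (pullback V1 ?p) k"
    unfolding represents_coeff[OF represents_G(1)] represents_coeff[OF represents_G(2)] represents_coeff[OF represents_G(3)]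
      clamp01_id[of s, OF s[unfolded atLeastAtMost_iff, THEN conjunct1] s[unfolded atLeastAtMost_iff, THEN conjunct2]]
      flux_pullback[OF p] V1 a2_def a1_def a0_def
    by (simp_all add: rfc_diff rfc_add rfc_cmult cg ck continuous_intros del: of_real_add of_real_power)
  have "rfc (\<lambda>y. T * ((1 + l) * pullback Vt ?p y + m * pullback V1 ?p y)) k
      = of_real T * (of_real (1 + l) * rfc (pullback Vt ?p) k + of_real m * rfc (pullback V1 ?p) k)"
    by (simp add: rfc_add rfc_cmult cg continuous_intros del: of_real_add)
  also have "\<dots> = forcing k s - (c ^ 4 * T * of_int k ^ 4) *\<^sub>R rfc (v ?p) k"
    unfolding rfc_Vt[OF p] a2_def[symmetric] a1_def[symmetric] a0_def[symmetric] forcing_def G rfc_jet(2)[OF s] scaleR_conv_of_real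
    by (simp add: algebra_simps eval_nat_numeral)
  finally have e: "rfc (\<lambda>y. T * ((1 + l) * pullback Vt ?p y + m * pullback V1 ?p y)) k
    = forcing k s - (c ^ 4 * T * of_int k ^ 4) *\<^sub>R rfc (v ?p) k" .
  have "((\<lambda>s. rfc (v (pt T l m s)) k) has_vector_derivative
      rfc (\<lambda>y. T * ((1 + l) * pullback Vt ?p y + m * pullback V1 ?p y)) k) (at s within {0..1})"
  proof (rule rfc_time_derivative[OF V_along_curve _ _ s])
    show "continuous_on {-pi..pi} (v (pt T l m t))" if "t \<in> {0..1}" for t
      by (rule joint_C_slice[OF j_v(1) pt_bounds(1)[OF that]])
    have "continuous_on ({0..1} \<times> UNIV) (\<lambda>x. T * ((1 + l) * (\<lambda>(s, y). pullback Vt (pt T l m s) y) x + m * (\<lambda>(s, y). pullback V1 (pt T l m s) y) x))"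
      by (intro continuous_intros continuous_pullback_curve[OF jVt] continuous_pullback_curve[OF j_V(2)]; simp)
    then have "continuous_on ({0..1} \<times> {-pi..pi}) (\<lambda>x. T * ((1 + l) * (\<lambda>(s, y). pullback Vt (pt T l m s) y) x + m * (\<lambda>(s, y). pullback V1 (pt T l m s) y) x))"
      by (rule continuous_on_subset) auto
    then show "continuous_on ({0..1} \<times> {-pi..pi}) (\<lambda>(t, y). T * ((1 + l) * pullback Vt (pt T l m t) y + m * pullback V1 (pt T l m t) y))"
      by (simp add: case_prod_unfold)
  qed
  then show ?thesis unfolding e .
qed

text \<open>Differentiation multiplies a mode by \<open>\<i> * k\<close>, so every \<open>j\<close>
  reduces to the formula for \<open>v\<close> itself. The bound on \<open>j\<close> keeps the order
  \<open>j + 2\<close> within 4.\<close>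

lemma mild_formula:
  assumes j: "j \<le> 2"
  shows "apply_bcontfun (lcoeff (N T l m j) k) t = (\<i> * of_int k) ^ j *
    (rfc (v (pt T l m (clamp01 t))) k - exp (- (c ^ 4 * T * of_int k ^ 4) * clamp01 t) *\<^sub>R rfc (v (t0 - T, 0)) k)"
proof -
  let ?b = "c ^ 4 * T * of_int k ^ 4" and ?z = "\<i> * of_int k" and ?G = "\<lambda>F :: fourier. apply_bcontfun (lcoeff F k)"
  let ?D = "\<lambda>F. integral {0..clamp01 t} (\<lambda>s. exp (- ?b * (clamp01 t - s)) *\<^sub>R ?G F s)"
  have ac: "c ^ 4 > 0" "T \<ge> 0" using c T by auto
  have int: "(\<lambda>s. exp (- ?b * (clamp01 t - s)) *\<^sub>R ?G F s) integrable_on {0..clamp01 t}" for F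
    by (rule duhamel_integrable[OF continuous_on_apply_bcontfun])
  have "rfc (v (pt T l m (clamp01 t))) k = exp (- ?b * clamp01 t) *\<^sub>R rfc (v (pt T l m 0)) k
      + integral {0..clamp01 t} (\<lambda>s. exp (- ?b * (clamp01 t - s)) *\<^sub>R forcing k s)"
    by (rule duhamel_formula[OF rfc_evolution]) auto
  also have "(\<lambda>s. exp (- ?b * (clamp01 t - s)) *\<^sub>R forcing k s) = (\<lambda>s. of_real T * ?z\<^sup>2 * (exp (- ?b * (clamp01 t - s)) *\<^sub>R ?G (G2 T l m) s)
      + of_real T * ?z * (exp (- ?b * (clamp01 t - s)) *\<^sub>R ?G (G1 T l m) s) + of_real T * (exp (- ?b * (clamp01 t - s)) *\<^sub>R ?G (G0 T l m) s))"
    by (simp add: forcing_def scaleR_conv_of_real algebra_simps)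
  also have "integral {0..clamp01 t} \<dots> = of_real T * ?z\<^sup>2 * ?D (G2 T l m) + of_real T * ?z * ?D (G1 T l m) + of_real T * ?D (G0 T l m)"
    by (simp only: integral_add integrable_add integrable_on_mult_right int integral_mult_right)
  finally have S: "rfc (v (pt T l m (clamp01 t))) k - exp (- ?b * clamp01 t) *\<^sub>R rfc (v (pt T l m 0)) k
    = of_real T * ?z\<^sup>2 * ?D (G2 T l m) + of_real T * ?z * ?D (G1 T l m) + of_real T * ?D (G0 T l m)" by simp
  have 0: "pt T l m 0 = (t0 - T, 0)" by (simp add: pt_def)
  have "?G (LA (c ^ 4) T i F) t = of_real T * ?z ^ i * ?D F" if "i \<le> 4" for i F
    unfolding LA_props(2)[OF ac that] apply_Lop[OF ac] duhamel_def ..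
  then have "?G (N T l m j) t = of_real T * ?z ^ (j + 2) * ?D (G2 T l m) + of_real T * ?z ^ (j + 1) * ?D (G1 T l m)
      + of_real T * ?z ^ j * ?D (G0 T l m)"
    using j by (simp only: N_def lcoeff_simps plus_bcontfun.rep_eq)
  also have "\<dots> = ?z ^ j * (of_real T * ?z\<^sup>2 * ?D (G2 T l m) + of_real T * ?z * ?D (G1 T l m) + of_real T * ?D (G0 T l m))"
    by (simp only: power_add power_one_right distrib_left mult_ac)
  finally show ?thesis unfolding S[symmetric] 0 .
qed

text \<open>What is left is the free evolution of the profile at time \<open>t0 - T\<close>. It
  contains neither \<open>l\<close> nor \<open>m\<close>, since all curves start at the same point;
  so \<open>initial\<close>, computed at \<open>l = m = 0\<close>, serves every pair of
  parameters.\<close>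

lemma residual:
  "apply_bcontfun (lcoeff (E v T l m - N T l m 0) k) t
    = exp (- (c ^ 4 * T * of_int k ^ 4) * clamp01 t) *\<^sub>R rfc (v (t0 - T, 0)) k"
  "apply_bcontfun (lcoeff (E v1 T l m - N T l m 1) k) t
    = \<i> * of_int k * (exp (- (c ^ 4 * T * of_int k ^ 4) * clamp01 t) *\<^sub>R rfc (v (t0 - T, 0)) k)"
  "apply_bcontfun (lcoeff (E v2 T l m - N T l m 2) k) t
    = (\<i> * of_int k)\<^sup>2 * (exp (- (c ^ 4 * T * of_int k ^ 4) * clamp01 t) *\<^sub>R rfc (v (t0 - T, 0)) k)"
  unfolding lcoeff_simps minus_bcontfun.rep_eq mild_formula[of 0, OF zero_le] mild_formula[of 1, OF one_le_numeral]
    mild_formula[of 2, OF order_refl] represents_coeff[OF represents_E(1)] represents_coeff[OF represents_E(2)]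
    represents_coeff[OF represents_E(3)] rfc_jet[OF clamp01(3)] power_0 power_one_right mult_1_left right_diff_distrib
  by simp_all

end

section \<open>The jet as a fixed point near its value at the base point\<close>

definition "jet T l m = (E v T l m, E v1 T l m, E v2 T l m, E zf T l m, E rf T l m)"
definition "center g = fourier_elt (\<lambda>_ :: real. g (t0, 0 :: real))"
definition "initial T (j :: nat) = (if j = 0 then E v T 0 0 - N T 0 0 0 else if j = 1 then E v1 T 0 0 - N T 0 0 1 else E v2 T 0 0 - N T 0 0 2)"

lemma curve_center: "curve_in I (\<lambda>_. (t0, 0))"
  using t0_I by (auto simp: curve_in_def)

lemma represents_center:
  assumes "joint_C 2 I g" "\<And>p y. p \<in> I \<Longrightarrow> g p (y + 2 * pi) = g p y"
  shows "represents (center g) (\<lambda>_. g (t0, 0))"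
  unfolding center_def by (rule represents_curve[OF assms(1) compact_I assms(2) curve_center])

lemma represents_centers:
  "represents (center v) (\<lambda>_. v (t0, 0))" "represents (center v1) (\<lambda>_. v1 (t0, 0))"
  "represents (center zf) (\<lambda>_. zf (t0, 0))" "represents (center rf) (\<lambda>_. rf (t0, 0))"
  by (rule represents_center[OF joint_C_le[OF j_v(1)] v_per(1)] represents_center[OF joint_C_le[OF j_v(2)] v_per(2)]
      represents_center[OF joint_C_le[OF j_v(4)] v_per(4)] represents_center[OF joint_C_le[OF j_v(5)] v_per(5)]; simp)+

lemma rf_pos: "p \<in> I \<Longrightarrow> rf p y > 0"
  using pos[OF I_J] by (simp add: rf_def pullback_def)

lemma represents_inverse_rf: "represents (center (\<lambda>p y. inverse (rf p y))) (\<lambda>_ y. inverse (rf (t0, 0) y))"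
  using rf_pos by (intro represents_center joint_C_inverse joint_C_le[OF j_v(5)]) (auto simp: v_per less_imp_neq[symmetric])

lemma center_relations:
  "K0 * K0 * (center v * center v * center zf * center zf * (K0 * K0)) = c ^ 4 *\<^sub>R 1"
  "center zf * (center v + (1/4) *\<^sub>R (K0 * center v1 * (K0 * center v1))) = 1"
  "center (\<lambda>p y. inverse (rf p y)) * center rf = 1"
proof -
  note one = represents_ring(5)[OF represents_\<kappa>(1) represents_\<kappa>(1)]
  note r = represents_\<kappa> represents_centers represents_inverse_rf
  show "K0 * K0 * (center v * center v * center zf * center zf * (K0 * K0)) = c ^ 4 *\<^sub>R 1"
    by (rule represents_unique[OF represents_ring(3)[OF represents_ring(3)[OF r(1) r(1)]
          represents_ring(3)[OF represents_ring(3)[OF represents_ring(3)[OF represents_ring(3)[OF r(4) r(4)] r(6)] r(6)]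
            represents_ring(3)[OF r(1) r(1)]]]
          represents_ring(4)[OF one one]]) (simp add: leading_coefficient)
  have b: "represents (K0 * center v1) (\<lambda>_ y. \<kappa> y * v1 (t0, 0) y)" by (rule represents_ring(3)[OF r(1) r(5)])
  note b2 = represents_ring(3)[OF b b]
  show "center zf * (center v + (1/4) *\<^sub>R (K0 * center v1 * (K0 * center v1))) = 1"
    by (rule represents_unique[OF represents_ring(3)[OF r(6) represents_ring(1)[OF r(4) represents_ring(4)[OF b2 b2]]] one])
      (rule flux_pullback(3)[OF t0_I])
  show "center (\<lambda>p y. inverse (rf p y)) * center rf = 1"
    by (rule represents_unique[OF represents_ring(3)[OF r(8) r(7)] one]) (use rf_pos[OF t0_I] in \<open>simp add: less_imp_neq[symmetric]\<close>)
qed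

lemma step_jet:
  assumes T: "0 < T" "T \<le> d0" and lm: "\<bar>l\<bar> \<le> 1" "\<bar>m\<bar> \<le> 1"
  shows "step (c ^ 4) K0 K1 K2 zs qs (LA (c ^ 4) T) (initial T) (l *\<^sub>R 1) (m *\<^sub>R 1) (jet T l m) = jet T l m"
proof -
  note E = represents_E[OF T lm] and p = pt_bounds(1)[OF T lm]
  have eq: "E v T l m - N T l m 0 = E v T 0 0 - N T 0 0 0" "E v1 T l m - N T l m 1 = E v1 T 0 0 - N T 0 0 1"
    "E v2 T l m - N T l m 2 = E v2 T 0 0 - N T 0 0 2"
    using T lm by (auto intro!: l1_eqI bcontfun_eqI simp only: residual abs_zero zero_le_one)
  have "initial T 0 + N T l m 0 = E v T l m" "initial T 1 + N T l m 1 = E v1 T l m" "initial T 2 + N T l m 2 = E v2 T l m"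
    by (simp_all add: initial_def eq[symmetric] del: One_nat_def)
  then have i: "initial T 0 + LA (c ^ 4) T 2 (G2 T l m) + LA (c ^ 4) T 1 (G1 T l m) + LA (c ^ 4) T 0 (G0 T l m) = E v T l m"
    "initial T 1 + LA (c ^ 4) T 3 (G2 T l m) + LA (c ^ 4) T 2 (G1 T l m) + LA (c ^ 4) T 1 (G0 T l m) = E v1 T l m"
    "initial T 2 + LA (c ^ 4) T 4 (G2 T l m) + LA (c ^ 4) T 3 (G1 T l m) + LA (c ^ 4) T 2 (G0 T l m) = E v2 T l m"
    by (simp_all only: N_def add.assoc[symmetric] add_0 one_add_one one_plus_numeral numeral_plus_one numeral_plus_numeral semiring_norm)
  note one = represents_ring(5)[OF E(1) E(1)]
  have b: "represents (K0 * E v1 T l m) (\<lambda>s y. \<kappa> y * v1 (pt T l m s) y)" by (rule represents_ring(3)[OF represents_\<kappa>(1) E(2)])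
  note b2 = represents_ring(3)[OF b b]
  have z: "E zf T l m * (E v T l m + (1/4) *\<^sub>R (K0 * E v1 T l m * (K0 * E v1 T l m))) = 1"
    by (rule represents_unique[OF represents_ring(3)[OF E(4) represents_ring(1)[OF E(1) represents_ring(4)[OF b2 b2]]] one])
      (rule flux_pullback(3)[OF p])
  have q: "E v T l m = E rf T l m * E rf T l m"
    by (rule represents_unique[OF E(1) represents_ring(3)[OF E(5) E(5)]]) (simp add: v_def rf_def pullback_def V_def power2_eq_square)
  show ?thesis
    unfolding step_def jet_def split Let_def G2_def[symmetric] G1_def[symmetric] G0_def[symmetric] i z q[symmetric] by simp
qed

text \<open>The radius is carried as the fifth component of the jet for this purpose. Its value at
  \<open>s = 1\<close>, \<open>y = y0\<close> and parameters \<open>\<rho> * l\<close>,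
  \<open>\<rho> * m\<close> is that of \<open>r\<close> at time \<open>t0 + \<rho> * l * T\<close>
  and place \<open>\<psi> y0 + \<rho> * m * T\<close>, and analytic dependence makes it a power
  series in \<open>l\<close> and \<open>m\<close>.\<close>

theorem analytic_expansion:
  "\<exists>\<epsilon>>0. \<exists>a. \<forall>t x. \<bar>t - t0\<bar> < \<epsilon> \<and> \<bar>x - \<psi> y0\<bar> < \<epsilon> \<longrightarrow>
    ((\<lambda>(i, j). a (i, j) * (t - t0) ^ i * (x - \<psi> y0) ^ j) has_sum r t x) UNIV"
proof -
  have c4: "c ^ 4 > 0" using c by simp
  obtain \<delta> T0 where \<delta>: "\<delta> > 0" and T0: "T0 > 0" and dep: "\<forall>T \<zeta> P. 0 < T \<longrightarrow> T \<le> T0 \<longrightarrow>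
      (\<forall>l m. \<bar>l\<bar> \<le> 1 \<longrightarrow> \<bar>m\<bar> \<le> 1 \<longrightarrow> norm (P l m - (center v, center v1, center v2, center zf, center rf)) \<le> \<delta>) \<longrightarrow>
      (\<forall>l m. \<bar>l\<bar> \<le> 1 \<longrightarrow> \<bar>m\<bar> \<le> 1 \<longrightarrow>
        step (c ^ 4) K0 K1 K2 (center zf) (center (\<lambda>p y. inverse (rf p y))) (LA (c ^ 4) T) \<zeta> (l *\<^sub>R 1) (m *\<^sub>R 1) (P l m) = P l m) \<longrightarrow>
      (\<exists>\<rho>>0. \<rho> \<le> 1 \<and> (\<exists>Q. \<forall>l m. \<bar>l\<bar> \<le> 1 \<longrightarrow> \<bar>m\<bar> \<le> 1 \<longrightarrow> P (\<rho> * l) (\<rho> * m) = map_state (ev_formal l m) Q))"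
    using analytic_dependence[OF c4 center_relations, where ?k1.0=K1 and ?k2.0=K2 and ?c2.0="center v2"] by blast
  \<comment> \<open>Each of the five components of the jet receives a fifth of
    \<open>\<delta>\<close>.\<close>
  define near where "near d g \<longleftrightarrow> (\<forall>p. curve_in I p \<longrightarrow> (\<forall>t\<in>{0..1}. dist (p t) (t0, 0) < d) \<longrightarrow>
    norm (fourier_elt (\<lambda>t. g (p t)) - center g) \<le> \<delta> / 5)" for d g
  have near: "\<exists>d>0. near d g" if "joint_C 2 I g" "\<And>p y. p \<in> I \<Longrightarrow> g p (y + 2 * pi) = g p y" for g
    unfolding near_def center_def by (rule fourier_elt_near[OF that(1) compact_I that(2) t0_I]) (use \<delta> in auto)
  have "\<exists>d>0. near d v" by (rule near[OF joint_C_le[OF j_v(1)] v_per(1)]) simp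
  then obtain e0 where e0: "e0 > 0" "near e0 v" by (elim exE conjE)
  have "\<exists>d>0. near d v1" by (rule near[OF joint_C_le[OF j_v(2)] v_per(2)]) simp
  then obtain e1 where e1: "e1 > 0" "near e1 v1" by (elim exE conjE)
  have "\<exists>d>0. near d v2" by (rule near[OF joint_C_le[OF j_v(3)] v_per(3)]) simp
  then obtain e2 where e2: "e2 > 0" "near e2 v2" by (elim exE conjE)
  have "\<exists>d>0. near d zf" by (rule near[OF joint_C_le[OF j_v(4)] v_per(4)]) simp
  then obtain e3 where e3: "e3 > 0" "near e3 zf" by (elim exE conjE)
  have "\<exists>d>0. near d rf" by (rule near[OF joint_C_le[OF j_v(5)] v_per(5)]) simp
  then obtain e4 where e4: "e4 > 0" "near e4 rf" by (elim exE conjE)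
  \<comment> \<open>The curves stay within \<open>2 * T\<close> of \<open>(t0, 0)\<close>; the
    divisor 4 in place of 2 yields strict inequalities.\<close>
  let ?A = "{T0, d0, e0 / 4, e1 / 4, e2 / 4, e3 / 4, e4 / 4}"
  define T where "T = Min ?A"
  have "T \<in> ?A" unfolding T_def by (rule Min_in) auto
  then have Tpos: "0 < T" using T0 d0(1) e0(1) e1(1) e2(1) e3(1) e4(1) by fastforce
  have le: "\<And>x. x \<in> ?A \<Longrightarrow> T \<le> x" unfolding T_def by (rule Min_le) auto
  have T: "0 < T" "T \<le> T0" "T \<le> d0" by (rule Tpos le; simp)+
  have "T \<le> e0 / 4" "T \<le> e1 / 4" "T \<le> e2 / 4" "T \<le> e3 / 4" "T \<le> e4 / 4" by (rule le; simp)+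
  then have Te: "2 * T < e0" "2 * T < e1" "2 * T < e2" "2 * T < e3" "2 * T < e4" using Tpos by simp_all
  have near_center: "norm (E g T l m - center g) \<le> \<delta> / 5"
    if "near d g" "2 * T < d" "\<bar>l\<bar> \<le> 1" "\<bar>m\<bar> \<le> 1" for d g l m
    using that(1) curve[OF T(1,3) that(3,4)] pt_bounds(2)[OF T(1,3) that(3,4)] that(2)
    unfolding near_def E_def by fastforce
  have jet_near: "norm (jet T l m - (center v, center v1, center v2, center zf, center rf)) \<le> \<delta>"
    if "\<bar>l\<bar> \<le> 1" "\<bar>m\<bar> \<le> 1" for l m
  proof -
    have "norm (a0, a1, a2, a3, a4) \<le> norm a0 + (norm a1 + (norm a2 + (norm a3 + norm a4)))" for a0 a1 a2 a3 a4 :: fourier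
      by (meson add_left_mono norm_tuple_le order_trans)
    note this[of "E v T l m - center v" "E v1 T l m - center v1" "E v2 T l m - center v2" "E zf T l m - center zf" "E rf T l m - center rf"]
    moreover note near_center[OF e0(2) Te(1) that] near_center[OF e1(2) Te(2) that] near_center[OF e2(2) Te(3) that]
      near_center[OF e3(2) Te(4) that] near_center[OF e4(2) Te(5) that]
    ultimately show ?thesis unfolding jet_def diff_Pair by linarith
  qed
  obtain \<rho> Q where \<rho>: "\<rho> > 0" "\<rho> \<le> 1"
    and Q: "\<And>l m. \<bar>l\<bar> \<le> 1 \<Longrightarrow> \<bar>m\<bar> \<le> 1 \<Longrightarrow> jet T (\<rho> * l) (\<rho> * m) = map_state (ev_formal l m) Q"
    using dep[rule_format, OF T(1,2), of "jet T" "initial T", OF jet_near step_jet[OF T(1,3)]] by blast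
  obtain q0 q1 q2 qz qr where Qr: "Q = (q0, q1, q2, qz, qr)" by (cases Q)
  \<comment> \<open>\<open>l\<close> and \<open>m\<close> are the increments divided by
    \<open>\<rho> * T\<close>, which rescales the coefficients. Real parts may be taken because
    \<open>r\<close> and the monomials are real.\<close>
  define a where "a i = Re (formal_coeff 1 y0 qr i) / (\<rho> * T) ^ (fst i + snd i)" for i
  have "((\<lambda>(i, j). a (i, j) * (t - t0) ^ i * (x - \<psi> y0) ^ j) has_sum r t x) UNIV"
    if tx: "\<bar>t - t0\<bar> < \<rho> * T" "\<bar>x - \<psi> y0\<bar> < \<rho> * T" for t x
  proof -
    define l where "l = (t - t0) / (\<rho> * T)"
    define m where "m = (x - \<psi> y0) / (\<rho> * T)"
    have \<rho>T: "\<rho> * T > 0" using \<rho> T by simp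
    have lm: "\<bar>l\<bar> \<le> 1" "\<bar>m\<bar> \<le> 1" using tx \<rho>T by (simp_all add: l_def m_def)
    have lm': "\<bar>\<rho> * l\<bar> \<le> 1" "\<bar>\<rho> * m\<bar> \<le> 1" using lm \<rho> by (simp_all add: abs_mult mult_le_one)
    have lT: "\<rho> * l * T = t - t0" "\<rho> * m * T = x - \<psi> y0" using \<rho> T by (simp_all add: l_def m_def)
    have "E rf T (\<rho> * l) (\<rho> * m) = ev_formal l m qr"
      using Q[OF lm] unfolding Qr jet_def map_state_def by simp
    moreover have "point_eval 1 y0 (E rf T (\<rho> * l) (\<rho> * m)) = of_real (r t x)"
    proof -
      have "pt T (\<rho> * l) (\<rho> * m) 1 = (t, x - \<psi> y0)"
        unfolding pt_def using lT by (simp add: algebra_simps)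
      then have "rf (pt T (\<rho> * l) (\<rho> * m) (clamp01 1)) y0 = r t x" by (simp add: rf_def pullback_def clamp01_id)
      with represents_E(5)[OF T(1,3) lm'] show ?thesis unfolding represents_def by metis
    qed
    ultimately have "((\<lambda>i. formal_coeff 1 y0 qr i * of_real (l ^ fst i * m ^ snd i)) has_sum of_real (r t x)) UNIV"
      using formal_power_series[OF lm, of 1 y0 qr] by simp
    from has_sum_Re[OF this] have "((\<lambda>i. Re (formal_coeff 1 y0 qr i) * (l ^ fst i * m ^ snd i)) has_sum r t x) UNIV"
      by (simp del: of_real_mult of_real_power)
    moreover have "Re (formal_coeff 1 y0 qr i) * (l ^ fst i * m ^ snd i) = (case i of (i, j) \<Rightarrow> a (i, j) * (t - t0) ^ i * (x - \<psi> y0) ^ j)" for i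
      using \<rho>T by (simp add: a_def l_def m_def case_prod_unfold power_divide power_add)
    ultimately show ?thesis by simp
  qed
  then show ?thesis using \<rho> T(1) by (intro exI[of _ "\<rho> * T"] conjI exI[of _ a] allI impI) auto
qed

end

theorem proposition2p4:
  fixes \<alpha> \<mu> :: real and r0 :: "real \<Rightarrow> real" and r :: "real \<Rightarrow> real \<Rightarrow> real" and tplus :: ereal
  assumes "0 < \<alpha>" and "\<alpha> < 1"
    and "1 / 2 \<le> \<mu>" and "\<mu> \<le> 1"
    and "4 * \<mu> + \<alpha> \<notin> \<int>"
    and "r0 \<in> V_space \<alpha> \<mu>"
    and "ASD_maximal_solution \<alpha> \<mu> r0 tplus r"
  shows "r \<in> C_omega_cylinder {t. 0 < t \<and> ereal t < tplus}"
proof -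
  let ?J = "{t. 0 < t \<and> ereal t < tplus}"
  have "ASD_solution \<alpha> \<mu> r0 tplus r" using assms(7) by (simp add: ASD_maximal_solution_def)
  note reg = ASD_solution_regular[OF this]
  have j4: "joint_C (Suc 3) ?J r" using reg(1) by (simp only: Suc_numeral semiring_norm)
  define r1 where "r1 t = deriv (r t)" for t
  define r2 where "r2 t = deriv (r1 t)" for t
  have r1: "t \<in> ?J \<Longrightarrow> (r t has_real_derivative r1 t x) (at x)" "joint_C 3 ?J r1" for t x
    unfolding r1_def[abs_def] by (rule joint_C_deriv_fun[OF j4]; assumption)+
  have j3: "joint_C (Suc 2) ?J r1" using r1(2) by (simp only: Suc_numeral semiring_norm)
  have r2: "t \<in> ?J \<Longrightarrow> (r1 t has_real_derivative r2 t x) (at x)" "joint_C 2 ?J r2" for t x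
    unfolding r2_def[abs_def] by (rule joint_C_deriv_fun[OF j3]; assumption)+
  have expansion: "\<exists>\<epsilon>>0. \<exists>a. \<forall>t x. \<bar>t - t0\<bar> < \<epsilon> \<and> \<bar>x - x0\<bar> < \<epsilon> \<longrightarrow>
    ((\<lambda>(i, j). a (i, j) * (t - t0) ^ i * (x - x0) ^ j) has_sum r t x) UNIV" if t0: "t0 \<in> ?J" for t0 x0
  proof -
    have "open ?J" by (intro open_Collect_conj open_Collect_less continuous_intros continuous_on_ereal)
    then obtain e where e: "e > 0" "cball t0 e \<subseteq> ?J" using t0 open_contains_cball by blast
    define d0 where "d0 = min e 1"
    have d0: "0 < d0" "d0 \<le> 1" "{t0 - d0..t0 + d0} \<subseteq> ?J"
      using e(1) order_trans[OF _ e(2), of "{t0 - d0..t0 + d0}"] by (auto simp: d0_def cball_eq_atLeastAtMost)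
    have "joint_C 3 {0 :: real} (\<lambda>_ y. r1 t0 y)"
      by (rule joint_C_compose[OF r1(2) joint_C_ident, of "{0}" "\<lambda>_. t0"]) (use t0 in auto)
    then have "joint_C 3 {0 :: real} (\<lambda>_ y. sqrt (1 + (r1 t0 y)\<^sup>2))"
      by (intro joint_C_sqrt joint_C_add joint_C_const joint_C_power) (auto simp: add_pos_nonneg)
    moreover have "r1 t0 (x + 2 * pi) = r1 t0 x" for x
      by (rule periodic_deriv[OF r1(1)[OF t0] reg(2)[OF t0]])
    moreover have "sqrt (1 + (r1 t0 x)\<^sup>2) > 0" for x by (simp add: add_pos_nonneg)
    \<comment> \<open>The arclength coordinate belongs to the base time, so the locale is
      instantiated anew for each \<open>t0\<close>. As \<open>\<psi>\<close> is onto, every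
      \<open>x0\<close> has the form \<open>\<psi> y0\<close>.\<close>
    ultimately obtain c \<psi> where arc: "c > 0" "joint_C 4 {0 :: real} (\<lambda>_. \<psi>)"
      "\<And>y. (\<psi> has_real_derivative inverse (c * sqrt (1 + (r1 t0 (\<psi> y))\<^sup>2))) (at y)"
      "\<And>y. \<psi> (y + 2 * pi) = \<psi> y + 2 * pi" "\<And>x. \<exists>y. \<psi> y = x"
      using arclength_parametrization[of "\<lambda>x. sqrt (1 + (r1 t0 x)\<^sup>2)"] by auto
    interpret surface_evolution ?J r r1 r2 t0 d0 c \<psi>
      by (rule surface_evolution.intro[OF reg(1) r1 r2 reg(2,3,4) d0 arc(1-4)])
    obtain y0 where "\<psi> y0 = x0" using arc(5) by blast
    then show ?thesis using analytic_expansion[of y0] by simp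
  qed
  then have "real_analytic_on (\<lambda>(t, x). r t x) (?J \<times> UNIV)"
    unfolding real_analytic_on_def by auto
  moreover have "periodic_2pi (r t)" if "t \<in> ?J" for t using reg(2)[OF that] by (simp add: periodic_2pi_def)
  ultimately show ?thesis unfolding C_omega_cylinder_def by blast
qed

end
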